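(* Let $N$ be an acyclic planar directed network in a rectangle with $m$ sinks on the left side, labelled $1,\dots,m$ from top to bottom, and $n$ sources on the right side, labelled $1,\dots,n$ from top to bottom, and let $Q_q$ be its $m\times n$ matrix of quantum boundary measurements. Then $$\mathcal R_m(q)\,\overset1{Q_q}\otimes\overset2{Q_q}=\overset2{Q_q}\otimes\overset1{Q_q}\,\mathcal R_n(q),$$ where $$\mathcal R_k(q)=\sum_{1\le i,j\le k}\overset1e_{ii}\otimes\overset2e_{jj}+(q-1)\sum_{1\le i\le k}\overset1e_{ii}\otimes\overset2e_{ii}+(q-q^{-1})\sum_{1\le j<i\le k}\overset1e_{ij}\otimes\overset2e_{ji}.$$
   Context: A network is a planar directed graph in a rectangle (disk) whose boundary vertices are univalent (sources or sinks) and whose inner vertices are trivalent: black (two incoming, one outgoing edge) or white (one incoming, two outgoing). Here the network has no oriented cycles, all sources lie on the right side and all sinks on the left side. Let $\tilde\Lambda$ be the lattice generated by the faces of $N$. Each inner vertex contributes three dual arrows between the three faces around it, each crossing one of the three incident edges: counterclockwise around a black vertex, clockwise around a white vertex. For faces $\theta,\phi$ set $\langle\theta,\phi\rangle=\frac12(\#(\theta\to\phi)-\#(\phi\to\theta))$, where $\#$ counts dual arrows. The sum of all faces lies in the kernel of this form; let $\Lambda$ be the quotient of $\tilde\Lambda$ by it with the induced form. The quantum torus has basis $Z_\lambda$, $\lambda\in\Lambda$, with $Z_\lambda Z_\mu=q^{-\langle\lambda,\mu\rangle}Z_{\lambda+\mu}$, over a field containing the needed powers of $q$. The weight of a directed path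 $P$ from a source to a sink is $w_P=Z_{v_P}$, where $v_P$ is the sum of all faces lying to the right of $P$ (i.e. above $P$). The quantum boundary measurements are $(Q_q)_{ba}=\sum_{P:a\leadsto b}w_P$, the sum over all directed paths from source $a$ to sink $b$. $e_{ij}$ are matrix units, $(\overset1M\otimes\overset2N)_{(ik),(jl)}=M_{ij}N_{kl}$ and $(\overset2N\otimes\overset1M)_{(ik),(jl)}=N_{kl}M_{ij}$. *)

theory Defs
  imports
    "Graph_Theory.Digraph"
    "Graph_Theory.Arc_Walk"
    "HOL-Combinatorics.Orbits"
    "HOL-Algebra.Free_Abelian_Groups"
    "HOL-Algebra.Generated_Groups"
    "HOL-Algebra.Coset"
    "HOL-Library.Poly_Mapping"
begin

section \<open>Planar networks in a rectangle\<close>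

text \<open>
  A network is a directed multigraph drawn in a rectangle. The drawing is recorded, up to isotopy,
  as a combinatorial map: \<open>cw N v\<close> sends each arc at the inner vertex \<open>v\<close> to the next one in
  clockwise order around \<open>v\<close>. \<open>source N a\<close> (\<open>1 \<le> a \<le> nsources N\<close>) is the \<open>a\<close>-th boundary vertex
  from the top on the right side, \<open>sink N b\<close> (\<open>1 \<le> b \<le> nsinks N\<close>) the \<open>b\<close>-th one from the top on
  the left side. Networks may have parallel arcs, since planar trivalent networks need them.
\<close>

record ('v, 'e) network =
  net :: "('v, 'e) pre_digraph"
  nsources :: nat
  nsinks :: nat
  source :: "nat \<Rightarrow> 'v"
  sink :: "nat \<Rightarrow> 'v"
  cw :: "'v \<Rightarrow> 'e \<Rightarrow> 'e"

definition black :: "('v, 'e) network \<Rightarrow> 'v set" where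
  "black N = {v \<in> verts (net N). in_degree (net N) v = 2 \<and> out_degree (net N) v = 1}"

definition white :: "('v, 'e) network \<Rightarrow> 'v set" where
  "white N = {v \<in> verts (net N). in_degree (net N) v = 1 \<and> out_degree (net N) v = 2}"

definition inner_verts :: "('v, 'e) network \<Rightarrow> 'v set" where
  "inner_verts N = black N \<union> white N"

definition incident :: "('v, 'e) network \<Rightarrow> 'v \<Rightarrow> 'e set" where
  "incident N v = in_arcs (net N) v \<union> out_arcs (net N) v"

definition source_arc :: "('v, 'e) network \<Rightarrow> nat \<Rightarrow> 'e" where
  "source_arc N a = (THE e. e \<in> out_arcs (net N) (source N a))"

definition sink_arc :: "('v, 'e) network \<Rightarrow> nat \<Rightarrow> 'e" where
  "sink_arc N b = (THE e. e \<in> in_arcs (net N) (sink N b))"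

subsection \<open>Faces\<close>

text \<open>
  Every arc has a left and a right side with respect to its direction. A face is represented by
  the set of all arc sides on its boundary.
\<close>

datatype side = Lft | Rgt

definition arc_sides :: "('v, 'e) network \<Rightarrow> ('e \<times> side) set" where
  "arc_sides N = arcs (net N) \<times> UNIV"

text \<open>
  The side of an arc \<open>e\<close> met first when turning clockwise, respectively counterclockwise, around
  its endpoint \<open>v\<close> starting from \<open>e\<close>. (For an arc ending in \<open>v\<close> one looks against its direction.)
\<close>

definition cw_side :: "('v, 'e) network \<Rightarrow> 'v \<Rightarrow> 'e \<Rightarrow> 'e \<times> side" where
  "cw_side N v e = (e, if tail (net N) e = v then Rgt else Lft)"

definition ccw_side :: "('v, 'e) network \<Rightarrow> 'v \<Rightarrow> 'e \<Rightarrow> 'e \<times> side" where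
  "ccw_side N v e = (e, if tail (net N) e = v then Lft else Rgt)"

definition inner_corners :: "('v, 'e) network \<Rightarrow> ('e \<times> side) rel" where
  "inner_corners N = {(cw_side N v e, ccw_side N v (cw N v e)) | v e. v \<in> inner_verts N \<and> e \<in> incident N v}"

text \<open>
  The boundary vertices cut the boundary of the rectangle into segments, each of which also joins
  two arc sides: segments between consecutive sources, segments between consecutive sinks, and the
  two segments containing the top and the bottom side. Arcs at the boundary point left, so
  their right sides face upwards.
\<close>

definition boundary_corners :: "('v, 'e) network \<Rightarrow> ('e \<times> side) rel" where
  "boundary_corners N =
     {((source_arc N a, Lft), (source_arc N (Suc a), Rgt)) | a. 1 \<le> a \<and> a < nsources N}
   \<union> {((sink_arc N b, Lft), (sink_arc N (Suc b), Rgt)) | b. 1 \<le> b \<and> b < nsinks N}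
   \<union> {((source_arc N 1, Rgt), (sink_arc N 1, Rgt)),
      ((source_arc N (nsources N), Lft), (sink_arc N (nsinks N), Lft))}"

definition same_face :: "('v, 'e) network \<Rightarrow> ('e \<times> side) rel" where
  "same_face N = (let C = inner_corners N \<union> boundary_corners N in (C \<union> C\<inverse>)\<^sup>*)"

definition face_of :: "('v, 'e) network \<Rightarrow> 'e \<times> side \<Rightarrow> ('e \<times> side) set" where
  "face_of N s = same_face N `` {s}"

definition faces :: "('v, 'e) network \<Rightarrow> ('e \<times> side) set set" where
  "faces N = arc_sides N // same_face N"

text \<open>
  The network together with the boundary of the rectangle is a connected map, because in an
  acyclic network every vertex is joined to the boundary by a directed path. Hence it is a plane
  map, i.e. the surface obtained by gluing in the faces is a disk, iff its Euler characteristic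
  is 1. The boundary vertices and the boundary segments are equal in number, so
  they cancel in \<open>planar\<close>. (Without arcs there are no arc sides to represent the single face, and
  nothing to require.)
\<close>

locale acyclic_network =
  fixes N :: "('v, 'e) network"
  assumes fin_digraph: "fin_digraph (net N)"
    and acyclic: "\<nexists>p. pre_digraph.cycle (net N) p"
    and sources: "bij_betw (source N) {1..nsources N}
          {v \<in> verts (net N). in_degree (net N) v = 0 \<and> out_degree (net N) v = 1}"
    and sinks: "bij_betw (sink N) {1..nsinks N}
          {v \<in> verts (net N). in_degree (net N) v = 1 \<and> out_degree (net N) v = 0}"
    and vertices: "verts (net N)
          = inner_verts N \<union> source N ` {1..nsources N} \<union> sink N ` {1..nsinks N}"
    and rotation: "v \<in> inner_verts N \<Longrightarrow> cyclic_on (cw N v) (incident N v)"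
    and planar: "arcs (net N) \<noteq> {} \<Longrightarrow>
          int (card (inner_verts N)) - int (card (arcs (net N))) + int (card (faces N)) = 1"

section \<open>The face lattice and its skew form\<close>

text \<open>
  The dual arrow crossing \<open>e\<close> near the inner vertex \<open>v\<close> runs counterclockwise around \<open>v\<close>, that is
  from the clockwise to the counterclockwise side of \<open>e\<close>, if \<open>v\<close> is black, and conversely if \<open>v\<close>
  is white. An arrow is identified by the pair \<open>(v, e)\<close>.
\<close>

definition dual_arrows ::
  "('v, 'e) network \<Rightarrow> ('e \<times> side) set \<Rightarrow> ('e \<times> side) set \<Rightarrow> ('v \<times> 'e) set" where
  "dual_arrows N \<theta> \<phi> =
     {(v, e). v \<in> black N \<and> e \<in> incident N v \<and>
        face_of N (cw_side N v e) = \<theta> \<and> face_of N (ccw_side N v e) = \<phi>}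
   \<union> {(v, e). v \<in> white N \<and> e \<in> incident N v \<and>
        face_of N (ccw_side N v e) = \<theta> \<and> face_of N (cw_side N v e) = \<phi>}"

definition face_pairing ::
  "('v, 'e) network \<Rightarrow> ('e \<times> side) set \<Rightarrow> ('e \<times> side) set \<Rightarrow> rat" where
  "face_pairing N \<theta> \<phi> =
     (of_nat (card (dual_arrows N \<theta> \<phi>)) - of_nat (card (dual_arrows N \<phi> \<theta>))) / 2"

type_synonym 'e face_vector = "('e \<times> side) set \<Rightarrow>\<^sub>0 int"

definition pre_form :: "('v, 'e) network \<Rightarrow> 'e face_vector \<Rightarrow> 'e face_vector \<Rightarrow> rat" where
  "pre_form N x y = (\<Sum>\<theta>\<in>faces N. \<Sum>\<phi>\<in>faces N.
     of_int (Poly_Mapping.lookup x \<theta>) * of_int (Poly_Mapping.lookup y \<phi>) * face_pairing N \<theta> \<phi>)"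

definition pre_lattice :: "('v, 'e) network \<Rightarrow> 'e face_vector monoid" where
  "pre_lattice N = free_Abelian_group (faces N)"

definition all_faces :: "('v, 'e) network \<Rightarrow> 'e face_vector" where
  "all_faces N = (\<Sum>\<theta>\<in>faces N. frag_of \<theta>)"

definition face_relation :: "('v, 'e) network \<Rightarrow> 'e face_vector set" where
  "face_relation N = generate (pre_lattice N) {all_faces N}"

definition face_lattice :: "('v, 'e) network \<Rightarrow> 'e face_vector set monoid" where
  "face_lattice N = pre_lattice N Mod face_relation N"

definition face_class :: "('v, 'e) network \<Rightarrow> 'e face_vector \<Rightarrow> 'e face_vector set" where
  "face_class N x = face_relation N #>\<^bsub>pre_lattice N\<^esub> x"

text \<open>
  The induced form. The values of \<open>pre_form\<close> on representatives of two classes agree (see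
  \<open>lattice_form_class\<close> below), so the set inside \<open>the_elem\<close> is a singleton.
\<close>

definition lattice_form ::
  "('v, 'e) network \<Rightarrow> 'e face_vector set \<Rightarrow> 'e face_vector set \<Rightarrow> rat" where
  "lattice_form N \<alpha> \<beta> = the_elem ((\<lambda>(x, y). pre_form N x y) ` (\<alpha> \<times> \<beta>))"

lemma face_pairing_antisym: "face_pairing N \<theta> \<phi> = - face_pairing N \<phi> \<theta>"
  by (simp add: face_pairing_def field_simps)

lemma sum_card_fibre:
  assumes "finite A" "finite B" "f ` A \<subseteq> B"
  shows "(\<Sum>y\<in>B. card {x \<in> A. f x = y}) = card A"
  using sum.group[OF assms, of "\<lambda>_. 1 :: nat"] by simp

lemma same_face_refl: "(s, s) \<in> same_face N"
  by (simp add: same_face_def Let_def)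

lemma face_of_eqI:
  assumes "(s, t) \<in> same_face N" shows "face_of N s = face_of N t"
proof -
  let ?C = "inner_corners N \<union> boundary_corners N"
  have "sym (same_face N)" "trans (same_face N)"
    unfolding same_face_def Let_def by (auto intro: sym_rtrancl simp: sym_Un_converse trans_rtrancl)
  then show ?thesis
    using assms unfolding face_of_def by (auto dest: symD transD)
qed

context acyclic_network
begin

lemma finite_faces: "finite (faces N)"
proof -
  have "finite (arcs (net N))" using fin_digraph by (simp add: fin_digraph.finite_arcs)
  moreover have "finite (UNIV :: side set)"
  proof -
    have "(UNIV :: side set) = {Lft, Rgt}"
      by (metis (full_types) UNIV_eq_I insertCI side.exhaust)
    then show ?thesis by (metis finite.emptyI finite_insert)
  qed
  ultimately have "finite (arc_sides N)" by (simp add: arc_sides_def)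
  then show ?thesis
    unfolding faces_def quotient_def by auto
qed

lemma face_of_in_faces: "e \<in> incident N v \<Longrightarrow> face_of N (e, s) \<in> faces N"
  by (auto simp: faces_def face_of_def arc_sides_def incident_def in_arcs_def out_arcs_def intro: quotientI)

lemma cw_bij:
  assumes "v \<in> inner_verts N"
  shows "bij_betw (cw N v) (incident N v) (incident N v)"
proof -
  have c: "cyclic_on (cw N v) (incident N v)" by (rule rotation[OF assms])
  have fin: "finite (incident N v)" by (rule finite_cyclic_on[OF c])
  have "incident N v \<subseteq> cw N v ` incident N v"
  proof
    fix e assume e: "e \<in> incident N v"
    then have "incident N v = orbit (cw N v) e" using c by (auto simp: cyclic_on_alldef)
    with e have "e \<in> orbit (cw N v) e" by simp
    then show "e \<in> cw N v ` incident N v"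
      using \<open>incident N v = orbit (cw N v) e\<close> e by (cases rule: orbit.cases) auto
  qed
  moreover have "cw N v ` incident N v \<subseteq> incident N v"
    using cyclic_on_inI[OF c] by auto
  ultimately have "cw N v ` incident N v = incident N v" by auto
  then show ?thesis using fin by (simp add: bij_betw_def finite_surj_inj)
qed

lemma face_of_corner:
  assumes "v \<in> inner_verts N" "e \<in> incident N v"
  shows "face_of N (ccw_side N v (cw N v e)) = face_of N (cw_side N v e)"
proof -
  have "(cw_side N v e, ccw_side N v (cw N v e)) \<in> inner_corners N"
    using assms by (auto simp: inner_corners_def)
  then have "(cw_side N v e, ccw_side N v (cw N v e)) \<in> same_face N"
    unfolding same_face_def Let_def by auto
  from face_of_eqI[OF this] show ?thesis by simp
qed

lemma sum_face_pairing_eq_0: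
  "(\<Sum>\<phi>\<in>faces N. face_pairing N \<theta> \<phi>) = 0"
proof -
  let ?fl = "\<lambda>(v, e). face_of N (cw_side N v e)" and ?fr = "\<lambda>(v, e). face_of N (ccw_side N v e)"
  let ?B = "Sigma (black N) (incident N)" and ?W = "Sigma (white N) (incident N)"
  have fin: "finite (black N)" "finite (white N)" "\<And>v. finite (incident N v)"
    using fin_digraph
    by (auto simp: black_def white_def incident_def in_arcs_def out_arcs_def
        fin_digraph.finite_arcs fin_digraph.finite_verts)
  then have finBW: "finite ?B" "finite ?W" by auto
  have disj: "black N \<inter> white N = {}" by (auto simp: black_def white_def)
  have d: "card (dual_arrows N a b) =
      card {x \<in> ?B. ?fl x = a \<and> ?fr x = b} + card {x \<in> ?W. ?fr x = a \<and> ?fl x = b}" for a b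
  proof -
    have "dual_arrows N a b = {x \<in> ?B. ?fl x = a \<and> ?fr x = b} \<union> {x \<in> ?W. ?fr x = a \<and> ?fl x = b}"
      by (auto simp: dual_arrows_def)
    moreover have "{x \<in> ?B. ?fl x = a \<and> ?fr x = b} \<inter> {x \<in> ?W. ?fr x = a \<and> ?fl x = b} = {}"
      using disj by auto
    moreover have "finite {x \<in> ?B. ?fl x = a \<and> ?fr x = b}" "finite {x \<in> ?W. ?fr x = a \<and> ?fl x = b}"
      using finBW by simp_all
    ultimately show ?thesis by (simp only: card_Un_disjoint)
  qed
  have im: "?fl ` ?B \<subseteq> faces N" "?fr ` ?B \<subseteq> faces N" "?fl ` ?W \<subseteq> faces N" "?fr ` ?W \<subseteq> faces N"
    by (auto simp: cw_side_def ccw_side_def intro: face_of_in_faces)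
  have s: "(\<Sum>b\<in>faces N. card {x \<in> A. P x \<and> g x = b}) = card {x \<in> A. P x}"
    if "finite A" "g ` A \<subseteq> faces N" for A P and g :: "'v \<times> 'e \<Rightarrow> _"
    using sum_card_fibre[of "{x \<in> A. P x}" "faces N" g] that finite_faces
    by (simp add: conj_assoc image_subset_iff)
  have s': "(\<Sum>b\<in>faces N. card {x \<in> A. g x = b \<and> P x}) = card {x \<in> A. P x}"
    if "finite A" "g ` A \<subseteq> faces N" for A P and g :: "'v \<times> 'e \<Rightarrow> _"
    using s[OF that, of P] by (simp add: conj_commute)
  have turn: "card {x \<in> Sigma C (incident N). ?fl x = \<theta>} = card {x \<in> Sigma C (incident N). ?fr x = \<theta>}"
    if C: "C \<subseteq> inner_verts N" for C
  proof (rule bij_betw_same_card[of "\<lambda>(v, e). (v, cw N v e)"])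
    let ?t = "\<lambda>(v, e). (v, cw N v e)"
    have inj: "inj_on ?t (Sigma C (incident N))"
      using C cw_bij by (auto simp: inj_on_def bij_betw_def)
    have mem: "cw N v e \<in> incident N v" if "v \<in> C" "e \<in> incident N v" for v e
      using cw_bij[of v] C that by (auto simp: bij_betw_def)
    have "?t ` {x \<in> Sigma C (incident N). ?fl x = \<theta>} = {x \<in> Sigma C (incident N). ?fr x = \<theta>}"
    proof (intro equalityI subsetI)
      fix y assume "y \<in> ?t ` {x \<in> Sigma C (incident N). ?fl x = \<theta>}"
      then obtain v e where "v \<in> C" "e \<in> incident N v" "face_of N (cw_side N v e) = \<theta>"
        and y: "y = (v, cw N v e)" by auto
      moreover from this have "v \<in> inner_verts N" using C by blast
      ultimately have "cw N v e \<in> incident N v" "face_of N (ccw_side N v (cw N v e)) = \<theta>"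
        using mem face_of_corner by simp_all
      then show "y \<in> {x \<in> Sigma C (incident N). ?fr x = \<theta>}"
        using y \<open>v \<in> C\<close> by simp
    next
      fix y assume "y \<in> {x \<in> Sigma C (incident N). ?fr x = \<theta>}"
      then obtain v e where y: "y = (v, e)" "v \<in> C" "e \<in> incident N v" "face_of N (ccw_side N v e) = \<theta>"
        by auto
      then obtain e' where e': "e' \<in> incident N v" "e = cw N v e'"
        using cw_bij[of v] C by (auto simp: bij_betw_def)
      then have "(v, e') \<in> {x \<in> Sigma C (incident N). ?fl x = \<theta>}"
        using y C face_of_corner[of v e'] by auto
      then show "y \<in> ?t ` {x \<in> Sigma C (incident N). ?fl x = \<theta>}"
        by (intro image_eqI[of _ _ "(v, e')"]) (simp_all add: y(1) e'(2))
    qed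
    then show "bij_betw ?t {x \<in> Sigma C (incident N). ?fl x = \<theta>} {x \<in> Sigma C (incident N). ?fr x = \<theta>}"
      using inj by (auto simp: bij_betw_def intro: inj_on_subset)
  qed
  have out: "(\<Sum>\<phi>\<in>faces N. card (dual_arrows N \<theta> \<phi>)) =
      card {x \<in> ?B. ?fl x = \<theta>} + card {x \<in> ?W. ?fr x = \<theta>}"
    unfolding d sum.distrib using s[OF finBW(1) im(2)] s[OF finBW(2) im(3)] by simp
  have "in": "(\<Sum>\<phi>\<in>faces N. card (dual_arrows N \<phi> \<theta>)) =
      card {x \<in> ?B. ?fr x = \<theta>} + card {x \<in> ?W. ?fl x = \<theta>}"
    unfolding d sum.distrib using s'[OF finBW(1) im(1)] s'[OF finBW(2) im(4)] by simp
  have "(\<Sum>\<phi>\<in>faces N. card (dual_arrows N \<theta> \<phi>)) = (\<Sum>\<phi>\<in>faces N. card (dual_arrows N \<phi> \<theta>))"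
    unfolding out "in" using turn[of "black N"] turn[of "white N"] by (auto simp: inner_verts_def)
  then have "(\<Sum>\<phi>\<in>faces N. of_nat (card (dual_arrows N \<theta> \<phi>)) :: rat)
      = (\<Sum>\<phi>\<in>faces N. of_nat (card (dual_arrows N \<phi> \<theta>)))"
    by (metis of_nat_sum)
  then show ?thesis
    by (simp add: face_pairing_def sum_subtractf flip: sum_divide_distrib)
qed

lemma face_relation_const:
  "z \<in> face_relation N \<Longrightarrow> \<exists>c. \<forall>\<theta>\<in>faces N. Poly_Mapping.lookup z \<theta> = c"
  unfolding face_relation_def
proof (induction rule: generate.induct)
  have s: "Poly_Mapping.lookup (all_faces N) \<theta> = 1" if "\<theta> \<in> faces N" for \<theta>
    using that finite_faces
    by (simp add: all_faces_def lookup_sum lookup_single when_def)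
  have all: "all_faces N \<in> carrier (pre_lattice N)"
  proof -
    have "Poly_Mapping.keys (all_faces N) \<subseteq> faces N"
      unfolding all_faces_def using keys_sum[of "\<lambda>\<theta>. frag_of \<theta>" "faces N"] by fastforce
    then show ?thesis by (simp add: pre_lattice_def free_Abelian_group_def)
  qed
  case one
  show ?case by (auto simp: pre_lattice_def)
  case (incl h)
  then show ?case using s by auto
  case (inv h)
  then show ?case using s all by (auto simp: pre_lattice_def)
next
  case (eng h1 h2)
  then show ?case by (auto simp: pre_lattice_def lookup_add)
qed

lemma pre_form_const:
  assumes "\<And>\<theta>. \<theta> \<in> faces N \<Longrightarrow> Poly_Mapping.lookup x' \<theta> = c + Poly_Mapping.lookup x \<theta>"
    and "\<And>\<theta>. \<theta> \<in> faces N \<Longrightarrow> Poly_Mapping.lookup y' \<theta> = d + Poly_Mapping.lookup y \<theta>"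
  shows "pre_form N x' y' = pre_form N x y"
proof -
  let ?l = "\<lambda>x \<theta>. of_int (Poly_Mapping.lookup x \<theta>) :: rat" and ?p = "face_pairing N"
  have 0: "(\<Sum>\<phi>\<in>faces N. ?p \<phi> \<theta>) = 0" for \<theta>
  proof -
    have "(\<Sum>\<phi>\<in>faces N. ?p \<phi> \<theta>) = (\<Sum>\<phi>\<in>faces N. - ?p \<theta> \<phi>)"
      by (intro sum.cong refl face_pairing_antisym)
    then show ?thesis by (simp add: sum_negf sum_face_pairing_eq_0)
  qed
  have "pre_form N x' y' = (\<Sum>\<theta>\<in>faces N. \<Sum>\<phi>\<in>faces N.
      ?l x' \<theta> * of_int d * ?p \<theta> \<phi> + ?l x' \<theta> * ?l y \<phi> * ?p \<theta> \<phi>)"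
    unfolding pre_form_def using assms(2) by (intro sum.cong refl) (simp add: algebra_simps)
  also have "\<dots> = (\<Sum>\<theta>\<in>faces N. \<Sum>\<phi>\<in>faces N. ?l x' \<theta> * ?l y \<phi> * ?p \<theta> \<phi>)"
    by (simp add: sum.distrib sum_face_pairing_eq_0 flip: sum_distrib_left)
  also have "\<dots> = (\<Sum>\<phi>\<in>faces N. \<Sum>\<theta>\<in>faces N. ?l x' \<theta> * ?l y \<phi> * ?p \<theta> \<phi>)"
    by (rule sum.swap)
  also have "\<dots> = (\<Sum>\<phi>\<in>faces N. \<Sum>\<theta>\<in>faces N.
      of_int c * ?l y \<phi> * ?p \<theta> \<phi> + ?l x \<theta> * ?l y \<phi> * ?p \<theta> \<phi>)"
    using assms(1) by (intro sum.cong refl) (simp add: algebra_simps)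
  also have "\<dots> = (\<Sum>\<phi>\<in>faces N. \<Sum>\<theta>\<in>faces N. ?l x \<theta> * ?l y \<phi> * ?p \<theta> \<phi>)"
    by (simp add: sum.distrib 0 flip: sum_distrib_left)
  also have "\<dots> = pre_form N x y"
    unfolding pre_form_def by (rule sum.swap)
  finally show ?thesis .
qed

lemma lattice_form_class:
  "lattice_form N (face_class N x) (face_class N y) = pre_form N x y"
proof -
  have mem: "w \<in> face_class N w" for w
    by (auto simp: face_class_def r_coset_def face_relation_def pre_lattice_def
        intro!: bexI[of _ 0] generate.one[of "free_Abelian_group (faces N)", simplified])
  have rep: "\<exists>c. \<forall>\<theta>\<in>faces N. Poly_Mapping.lookup w' \<theta> = c + Poly_Mapping.lookup w \<theta>"
    if w': "w' \<in> face_class N w" for w w'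
  proof -
    obtain z where z: "z \<in> face_relation N" "w' = z + w"
      using w' by (auto simp: face_class_def r_coset_def pre_lattice_def)
    then show ?thesis using face_relation_const[OF z(1)] by (auto simp: lookup_add)
  qed
  have "pre_form N x' y' = pre_form N x y"
    if x': "x' \<in> face_class N x" and y': "y' \<in> face_class N y" for x' y'
  proof -
    obtain c d where "\<forall>\<theta>\<in>faces N. Poly_Mapping.lookup x' \<theta> = c + Poly_Mapping.lookup x \<theta>"
      "\<forall>\<theta>\<in>faces N. Poly_Mapping.lookup y' \<theta> = d + Poly_Mapping.lookup y \<theta>"
      using rep[OF x'] rep[OF y'] by blast
    then show ?thesis by (intro pre_form_const) auto
  qed
  then have "(\<lambda>(x, y). pre_form N x y) ` (face_class N x \<times> face_class N y) \<subseteq> {pre_form N x y}"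
    by auto
  moreover have "pre_form N x y \<in> (\<lambda>(x, y). pre_form N x y) ` (face_class N x \<times> face_class N y)"
    by (intro image_eqI[of _ _ "(x, y)"]) (simp_all add: mem)
  ultimately have "(\<lambda>(x, y). pre_form N x y) ` (face_class N x \<times> face_class N y) = {pre_form N x y}"
    by (meson empty_subsetI insert_subsetI subset_antisym)
  then show ?thesis by (simp add: lattice_form_def)
qed

end

section \<open>The quantum torus\<close>

text \<open>
  The parameter \<open>h\<close> is the chosen square root of \<open>q\<close>; as the form takes values in half-integers,
  \<open>half_pow h r\<close> is \<open>q\<close> to the power \<open>r\<close>.
\<close>

definition half_pow :: "'k::field \<Rightarrow> rat \<Rightarrow> 'k" where
  "half_pow h r = h powi \<lfloor>2 * r\<rfloor>"

type_synonym ('e, 'k) torus = "'e face_vector set \<Rightarrow>\<^sub>0 'k"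

definition torus_basis :: "'e face_vector set \<Rightarrow> ('e, 'k::field) torus" where
  "torus_basis \<alpha> = Poly_Mapping.single \<alpha> 1"

definition torus_smult :: "'k::field \<Rightarrow> ('e, 'k) torus \<Rightarrow> ('e, 'k) torus" where
  "torus_smult c X = Poly_Mapping.map (\<lambda>x. c * x) X"

text \<open>The bilinear extension of \<open>Z \<alpha> * Z \<beta> = q\<^bsup>-\<langle>\<alpha>,\<beta>\<rangle>\<^esup> Z (\<alpha> + \<beta>)\<close>.\<close>

definition torus_mult ::
  "('v, 'e) network \<Rightarrow> 'k::field \<Rightarrow> ('e, 'k) torus \<Rightarrow> ('e, 'k) torus \<Rightarrow> ('e, 'k) torus" where
  "torus_mult N h X Y = (\<Sum>\<alpha>\<in>Poly_Mapping.keys X. \<Sum>\<beta>\<in>Poly_Mapping.keys Y.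
     torus_smult (Poly_Mapping.lookup X \<alpha> * Poly_Mapping.lookup Y \<beta> * half_pow h (- lattice_form N \<alpha> \<beta>))
       (torus_basis (\<alpha> \<otimes>\<^bsub>face_lattice N\<^esub> \<beta>)))"

definition torus_const :: "('v, 'e) network \<Rightarrow> 'k::field \<Rightarrow> ('e, 'k) torus" where
  "torus_const N c = torus_smult c (torus_basis \<one>\<^bsub>face_lattice N\<^esub>)"

section \<open>Quantum boundary measurements\<close>

definition adjacent_off :: "('v, 'e) network \<Rightarrow> 'e set \<Rightarrow> ('e \<times> side) set rel" where
  "adjacent_off N S =
     {(face_of N (e, s), face_of N (e, t)) | e s t. e \<in> arcs (net N) - S}"

text \<open>
  A path from a source to a sink cuts the rectangle into two regions. The faces of the right one
  are those that can be reached, without crossing the path, from a face adjacent to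
  the path on its right.
\<close>

definition faces_right_of :: "('v, 'e) network \<Rightarrow> 'e list \<Rightarrow> ('e \<times> side) set set" where
  "faces_right_of N p =
     (adjacent_off N (set p))\<^sup>* `` {face_of N (e, Rgt) | e. e \<in> set p}"

definition path_vector :: "('v, 'e) network \<Rightarrow> 'e list \<Rightarrow> 'e face_vector" where
  "path_vector N p = (\<Sum>\<theta>\<in>faces_right_of N p. frag_of \<theta>)"

definition path_weight :: "('v, 'e) network \<Rightarrow> 'e list \<Rightarrow> ('e, 'k::field) torus" where
  "path_weight N p = torus_basis (face_class N (path_vector N p))"

definition quantum_measurement ::
  "('v, 'e) network \<Rightarrow> nat \<Rightarrow> nat \<Rightarrow> ('e, 'k::field) torus" where
  "quantum_measurement N b a =
     (\<Sum>p | pre_digraph.apath (net N) (source N a) p (sink N b). path_weight N p)"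

section \<open>Tensor products of matrices and the R-matrix\<close>

text \<open>
  Matrices are functions of a row and a column index; the tensor products are indexed by pairs.
  The order of the factors matters, since the entries need not commute; \<open>mul\<close> is the
  multiplication of the algebra of entries.
\<close>

definition tensor12 ::
  "('a \<Rightarrow> 'a \<Rightarrow> 'a) \<Rightarrow> ('i \<Rightarrow> 'j \<Rightarrow> 'a) \<Rightarrow> ('k \<Rightarrow> 'l \<Rightarrow> 'a) \<Rightarrow> 'i \<times> 'k \<Rightarrow> 'j \<times> 'l \<Rightarrow> 'a" where
  "tensor12 mul A B = (\<lambda>(i, k) (j, l). mul (A i j) (B k l))"

definition tensor21 ::
  "('a \<Rightarrow> 'a \<Rightarrow> 'a) \<Rightarrow> ('k \<Rightarrow> 'l \<Rightarrow> 'a) \<Rightarrow> ('i \<Rightarrow> 'j \<Rightarrow> 'a) \<Rightarrow> 'i \<times> 'k \<Rightarrow> 'j \<times> 'l \<Rightarrow> 'a" where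
  "tensor21 mul B A = (\<lambda>(i, k) (j, l). mul (B k l) (A i j))"

definition mat_mult ::
  "('a \<Rightarrow> 'a \<Rightarrow> 'a::comm_monoid_add) \<Rightarrow> 's set \<Rightarrow> ('r \<Rightarrow> 's \<Rightarrow> 'a) \<Rightarrow> ('s \<Rightarrow> 'c \<Rightarrow> 'a)
     \<Rightarrow> 'r \<Rightarrow> 'c \<Rightarrow> 'a" where
  "mat_mult mul I A B = (\<lambda>r c. \<Sum>s\<in>I. mul (A r s) (B s c))"

definition mat_unit :: "nat \<Rightarrow> nat \<Rightarrow> nat \<Rightarrow> nat \<Rightarrow> 'k::field" where
  "mat_unit i j = (\<lambda>r c. if r = i \<and> c = j then 1 else 0)"

definition R_matrix :: "nat \<Rightarrow> 'k::field \<Rightarrow> nat \<times> nat \<Rightarrow> nat \<times> nat \<Rightarrow> 'k" where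
  "R_matrix k q = (\<lambda>r c.
       (\<Sum>i\<in>{1..k}. \<Sum>j\<in>{1..k}. tensor12 (*) (mat_unit i i) (mat_unit j j) r c)
     + (q - 1) * (\<Sum>i\<in>{1..k}. tensor12 (*) (mat_unit i i) (mat_unit i i) r c)
     + (q - inverse q) *
         (\<Sum>i\<in>{1..k}. \<Sum>j\<in>{1..<i}. tensor12 (*) (mat_unit i j) (mat_unit j i) r c))"

definition torus_R_matrix ::
  "('v, 'e) network \<Rightarrow> nat \<Rightarrow> 'k::field \<Rightarrow> nat \<times> nat \<Rightarrow> nat \<times> nat \<Rightarrow> ('e, 'k) torus" where
  "torus_R_matrix N k q = (\<lambda>r c. torus_const N (R_matrix k q r c))"

end

theory Submission
  imports Defs
begin

text \<open>
  Every inner vertex has a stem, its only outgoing arc if it is black and its only incoming one if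
  it is white, a right branch and a left branch. Described in terms of right and left sides of these three arcs, the faces
  around the vertex and the dual arrows between them are the same for both colours
  (\<open>branch_faces\<close>, \<open>arrow_sides\<close>). It follows that the form of two path vectors is a sum over the
  inner vertices at which one path uses the right and the other one the left branch, each
  contributing \<open>1/2\<close> or \<open>- 1/2\<close> (\<open>pre_form_paths\<close>). So the product of the weights of two paths is
  a power of \<open>h\<close> that counts these vertices with signs, times a monomial that depends only on the
  multiset of arcs used by the paths (\<open>path_vectors_determined\<close>). This description makes
  sense also for paths that end at an arbitrary arc, and the claim becomes an
  exchange relation for pairs of such paths.

  The exchange relation is proved by moving a cut across the network, from the sources to the sinks,
  one inner vertex at a time (\<open>exchange_cut\<close>). At the sources only trivial paths are left. If the
  cut passes a white vertex, paths to the stem are continued to both branches; if it passes a black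
  one, paths to both branches are continued to the stem. In either case the relations of
  the new cut are combinations of those of the old one, by identities
  in the field (\<open>exchange_split_right_left\<close>, \<open>exchange_split_left_right\<close>, \<open>exchange_merge\<close>).

  The relation refers to the order of the arcs of the cut from top to bottom, and at a vertex the branches
  must be neighbours in this order. Both are controlled by a height function on the faces that
  is larger on the left side of every arc than on its right side: an arc corresponds to an interval
  of heights, the arcs of a cut have disjoint intervals, and at every vertex the interval of the
  stem is the union of the intervals of the branches (\<open>parents_order\<close>). The height
  counts, up to sign, the paths that have a given face on their right.

  Planarity enters through the fact that a path separates the faces on its right from
  those on its left. This is a statement of homology modulo 2: a set of arcs that satisfies a parity
  condition at every inner vertex is the boundary of a set of faces (\<open>even_set_bounds\<close>). Injectivity up to
  complements is elementary, and by the Euler characteristic there are as many boundaries as even sets.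
\<close>

section \<open>Local structure at an inner vertex\<close>

lemma three_cycle:
  assumes "cyclic_on f S" "card S = 3" "s \<in> S"
  shows "S = {s, f s, f (f s)}" "f (f (f s)) = s" "f s \<noteq> s" "f (f s) \<noteq> s" "f (f s) \<noteq> f s"
proof -
  have S: "S = orbit f s" using assms(1,3) by (auto simp: cyclic_on_alldef)
  with assms(3) have in_orbit: "s \<in> orbit f s" by simp
  let ?d = "funpow_dist1 f s s"
  have im: "S = (\<lambda>n. (f ^^ n) s) ` {0..<?d}"
    unfolding S using in_orbit by (rule orbit_conv_funpow_dist1)
  have inj: "inj_on (\<lambda>n. (f ^^ n) s) {0..<?d}"
    using in_orbit by (rule inj_on_funpow_dist1)
  have d: "?d = 3" using card_image[OF inj] im assms(2) by simp
  have three: "{0..<3} = {0, 1, 2::nat}" by auto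
  show "S = {s, f s, f (f s)}"
    using im unfolding d three by (simp add: numeral_2_eq_2)
  show "f (f (f s)) = s"
    using funpow_dist1_prop[OF in_orbit] unfolding d by (simp add: numeral_3_eq_3)
  show "f s \<noteq> s" "f (f s) \<noteq> s" "f (f s) \<noteq> f s"
    using inj unfolding d three by (auto simp: numeral_2_eq_2 inj_on_def)
qed

context acyclic_network
begin

sublocale dg: fin_digraph "net N" by (rule fin_digraph)

text \<open>
  The stem of an inner vertex is the arc that is alone in its direction: the outgoing arc of a black
  vertex, the incoming arc of a white one. The other two arcs are the branches, named after the
  side on which they lie for somebody who walks along the stem in its direction; so the right
  branch is the upper one if arcs are drawn from right to left. With these names black and white vertices obey the same rules.
\<close>

definition stem :: "'v \<Rightarrow> 'e" where
  "stem v = (if v \<in> black N then THE e. e \<in> out_arcs (net N) v else THE e. e \<in> in_arcs (net N) v)"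

definition right_branch :: "'v \<Rightarrow> 'e" where
  "right_branch v = (if v \<in> black N then cw N v (stem v) else cw N v (cw N v (stem v)))"

definition left_branch :: "'v \<Rightarrow> 'e" where
  "left_branch v = (if v \<in> black N then cw N v (cw N v (stem v)) else cw N v (stem v))"

text \<open>
  Acyclicity is used as well-foundedness, in both directions, of the relation that joins the tail
  of an arc to its head.
\<close>

lemma acyclic_arcs_ends: "Transitive_Closure.acyclic (arcs_ends (net N))"
proof (rule acyclicI, intro allI notI)
  fix u assume "(u, u) \<in> (arcs_ends (net N))\<^sup>+"
  then obtain p where "dg.awalk u p u" "p \<noteq> []" by (auto simp: dg.reachable1_awalk)
  then have "dg.closed_w p" by (auto simp: dg.closed_w_def)
  then show False using dg.closed_w_imp_cycle acyclic by blast
qed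

lemma finite_arcs_ends: "finite (arcs_ends (net N))"
  by (simp add: arcs_ends_def)

lemma wf_arcs_ends: "wf (arcs_ends (net N))"
  using finite_arcs_ends acyclic_arcs_ends by (rule finite_acyclic_wf)

lemma wf_arcs_ends_converse: "wf ((arcs_ends (net N))\<inverse>)"
  using finite_arcs_ends acyclic_arcs_ends by (rule finite_acyclic_wf_converse)

lemma arc_in_arcs_ends: "e \<in> arcs (net N) \<Longrightarrow> (tail (net N) e, head (net N) e) \<in> arcs_ends (net N)"
  by (auto simp: arcs_ends_conv)

lemma tail_neq_head: "e \<in> arcs (net N) \<Longrightarrow> tail (net N) e \<noteq> head (net N) e"
  using acyclic_arcs_ends arc_in_arcs_ends by (metis acyclic_def r_into_trancl)

lemma in_arcs_not_out_arcs: "e \<in> in_arcs (net N) u \<Longrightarrow> e \<notin> out_arcs (net N) u"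
  using tail_neq_head[of e] by auto

lemma black_white_disjoint: "v \<in> black N \<Longrightarrow> v \<notin> white N"
  by (auto simp: black_def white_def)

lemma card_incident:
  assumes "v \<in> inner_verts N"
  shows "card (incident N v) = 3"
proof -
  have "in_arcs (net N) v \<inter> out_arcs (net N) v = {}"
    using in_arcs_not_out_arcs by blast
  then have "card (incident N v) = in_degree (net N) v + out_degree (net N) v"
    unfolding incident_def in_degree_def out_degree_def
    by (intro card_Un_disjoint) (auto simp: in_arcs_def out_arcs_def)
  then show ?thesis using assms by (auto simp: inner_verts_def black_def white_def)
qed

lemma card_one_THE: "card A = 1 \<Longrightarrow> A = {THE x. x \<in> A}"
  by (metis card_1_singletonE singletonD singletonI the_equality)

lemma out_arcs_black: "v \<in> black N \<Longrightarrow> out_arcs (net N) v = {stem v}"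
  using card_one_THE[of "out_arcs (net N) v"] by (simp add: stem_def black_def out_degree_def)

lemma in_arcs_white: "v \<in> white N \<Longrightarrow> in_arcs (net N) v = {stem v}"
  using card_one_THE[of "in_arcs (net N) v"] black_white_disjoint[of v]
  by (auto simp add: stem_def white_def in_degree_def)

lemma stem_incident: "v \<in> inner_verts N \<Longrightarrow> stem v \<in> incident N v"
  using out_arcs_black[of v] in_arcs_white[of v] by (auto simp only: inner_verts_def incident_def)

lemma branches:
  assumes v: "v \<in> inner_verts N"
  shows "incident N v = {stem v, right_branch v, left_branch v}"
    and "right_branch v \<noteq> stem v" "left_branch v \<noteq> stem v" "right_branch v \<noteq> left_branch v"
    and "left_branch v \<noteq> right_branch v" "stem v \<noteq> right_branch v" "stem v \<noteq> left_branch v"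
  using three_cycle[OF rotation[OF v] card_incident[OF v] stem_incident[OF v]]
  by (auto simp: right_branch_def left_branch_def)

lemma in_arcs_black:
  assumes "v \<in> black N" shows "in_arcs (net N) v = {right_branch v, left_branch v}"
proof -
  have "v \<in> inner_verts N" using assms by (simp add: inner_verts_def)
  have "in_arcs (net N) v = incident N v - out_arcs (net N) v"
    using in_arcs_not_out_arcs[of _ v] by (auto simp only: incident_def)
  then show ?thesis
    using branches[OF \<open>v \<in> inner_verts N\<close>] out_arcs_black[OF assms] by auto
qed

lemma out_arcs_white:
  assumes "v \<in> white N" shows "out_arcs (net N) v = {right_branch v, left_branch v}"
proof -
  have "v \<in> inner_verts N" using assms by (simp add: inner_verts_def)
  have "out_arcs (net N) v = incident N v - in_arcs (net N) v"
    using in_arcs_not_out_arcs[of _ v] by (auto simp only: incident_def)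
  then show ?thesis
    using branches[OF \<open>v \<in> inner_verts N\<close>] in_arcs_white[OF assms] by auto
qed

lemma inner_cases[consumes 1, case_names black white]:
  assumes "v \<in> inner_verts N"
  obtains "v \<in> black N" "v \<notin> white N" | "v \<in> white N" "v \<notin> black N"
  using assms black_white_disjoint by (auto simp: inner_verts_def)

lemma black_ends:
  assumes "v \<in> black N"
  shows "tail (net N) (stem v) = v" "head (net N) (right_branch v) = v" "head (net N) (left_branch v) = v"
    and "tail (net N) (right_branch v) \<noteq> v" "tail (net N) (left_branch v) \<noteq> v"
proof -
  have "stem v \<in> out_arcs (net N) v" "right_branch v \<in> in_arcs (net N) v" "left_branch v \<in> in_arcs (net N) v"
    using out_arcs_black[OF assms] in_arcs_black[OF assms] by auto
  then show "tail (net N) (stem v) = v" "head (net N) (right_branch v) = v" "head (net N) (left_branch v) = v"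
    "tail (net N) (right_branch v) \<noteq> v" "tail (net N) (left_branch v) \<noteq> v"
    using tail_neq_head[of "right_branch v"] tail_neq_head[of "left_branch v"] tail_neq_head[of "stem v"] by auto
qed

lemma white_ends:
  assumes "v \<in> white N"
  shows "head (net N) (stem v) = v" "tail (net N) (right_branch v) = v" "tail (net N) (left_branch v) = v"
    and "tail (net N) (stem v) \<noteq> v"
proof -
  have "stem v \<in> in_arcs (net N) v" "right_branch v \<in> out_arcs (net N) v" "left_branch v \<in> out_arcs (net N) v"
    using in_arcs_white[OF assms] out_arcs_white[OF assms] by auto
  then show "head (net N) (stem v) = v" "tail (net N) (right_branch v) = v" "tail (net N) (left_branch v) = v"
    "tail (net N) (stem v) \<noteq> v"
    using tail_neq_head[of "right_branch v"] tail_neq_head[of "left_branch v"] tail_neq_head[of "stem v"] by auto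
qed

text \<open>
  The three faces around a vertex: the one right of stem and right branch, the one between the branches,
  and the one left of stem and left branch. All later arguments see the rotation system only
  through these identities, which do not mention the colour.
\<close>

lemma branch_faces:
  assumes v: "v \<in> inner_verts N"
  shows "face_of N (right_branch v, Rgt) = face_of N (stem v, Rgt)"
    and "face_of N (left_branch v, Rgt) = face_of N (right_branch v, Lft)"
    and "face_of N (left_branch v, Lft) = face_of N (stem v, Lft)"
proof -
  note cycle = three_cycle[OF rotation[OF v] card_incident[OF v] stem_incident[OF v]]
  have corner: "face_of N (ccw_side N v (cw N v e)) = face_of N (cw_side N v e)"
    if "e \<in> {stem v, right_branch v, left_branch v}" for e
    using that branches(1)[OF v] face_of_corner[OF v] by blast
  from v show "face_of N (right_branch v, Rgt) = face_of N (stem v, Rgt)"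
    "face_of N (left_branch v, Rgt) = face_of N (right_branch v, Lft)"
    "face_of N (left_branch v, Lft) = face_of N (stem v, Lft)"
  proof (atomize (full), cases rule: inner_cases)
    case black
    have c: "cw N v (stem v) = right_branch v" "cw N v (right_branch v) = left_branch v"
      "cw N v (left_branch v) = stem v"
      using black cycle(2) by (simp_all add: right_branch_def left_branch_def)
    show "face_of N (right_branch v, Rgt) = face_of N (stem v, Rgt) \<and>
      face_of N (left_branch v, Rgt) = face_of N (right_branch v, Lft) \<and>
      face_of N (left_branch v, Lft) = face_of N (stem v, Lft)"
      using corner[of "stem v"] corner[of "right_branch v"] corner[of "left_branch v"]
        black_ends[OF black(1)] by (simp add: c cw_side_def ccw_side_def)
  next
    case white
    have c: "cw N v (stem v) = left_branch v" "cw N v (left_branch v) = right_branch v"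
      "cw N v (right_branch v) = stem v"
      using white cycle(2) by (simp_all add: right_branch_def left_branch_def)
    show "face_of N (right_branch v, Rgt) = face_of N (stem v, Rgt) \<and>
      face_of N (left_branch v, Rgt) = face_of N (right_branch v, Lft) \<and>
      face_of N (left_branch v, Lft) = face_of N (stem v, Lft)"
      using corner[of "stem v"] corner[of "right_branch v"] corner[of "left_branch v"]
        white_ends[OF white(1)] by (simp add: c cw_side_def ccw_side_def)
  qed
qed

section \<open>Directed walks\<close>

lemma source_vertex:
  assumes "a \<in> {1..nsources N}"
  shows "source N a \<in> verts (net N)" "in_arcs (net N) (source N a) = {}"
    and "out_arcs (net N) (source N a) = {source_arc N a}"
proof -
  have "source N a \<in> {v \<in> verts (net N). in_degree (net N) v = 0 \<and> out_degree (net N) v = 1}"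
    using bij_betwE[OF sources] assms by blast
  then have deg: "source N a \<in> verts (net N)" "card (in_arcs (net N) (source N a)) = 0"
    "card (out_arcs (net N) (source N a)) = 1"
    by (auto simp: in_degree_def out_degree_def)
  then show "source N a \<in> verts (net N)" by simp
  show "in_arcs (net N) (source N a) = {}"
    using deg(2) by (simp add: card_eq_0_iff in_arcs_def)
  show "out_arcs (net N) (source N a) = {source_arc N a}"
    unfolding source_arc_def by (rule card_one_THE[OF deg(3)])
qed

lemma sink_vertex:
  assumes "b \<in> {1..nsinks N}"
  shows "sink N b \<in> verts (net N)" "out_arcs (net N) (sink N b) = {}"
    and "in_arcs (net N) (sink N b) = {sink_arc N b}"
proof -
  have "sink N b \<in> {v \<in> verts (net N). in_degree (net N) v = 1 \<and> out_degree (net N) v = 0}"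
    using bij_betwE[OF sinks] assms by blast
  then have deg: "sink N b \<in> verts (net N)" "card (out_arcs (net N) (sink N b)) = 0"
    "card (in_arcs (net N) (sink N b)) = 1"
    by (auto simp: in_degree_def out_degree_def)
  then show "sink N b \<in> verts (net N)" by simp
  show "out_arcs (net N) (sink N b) = {}"
    using deg(2) by (simp add: card_eq_0_iff out_arcs_def)
  show "in_arcs (net N) (sink N b) = {sink_arc N b}"
    unfolding sink_arc_def by (rule card_one_THE[OF deg(3)])
qed

lemma source_arc_arc:
  assumes "a \<in> {1..nsources N}"
  shows "source_arc N a \<in> arcs (net N)" "tail (net N) (source_arc N a) = source N a"
proof -
  have "source_arc N a \<in> out_arcs (net N) (source N a)"
    using source_vertex(3)[OF assms] by blast
  then show "source_arc N a \<in> arcs (net N)" "tail (net N) (source_arc N a) = source N a" by simp_all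
qed

lemma sink_arc_arc:
  assumes "b \<in> {1..nsinks N}"
  shows "sink_arc N b \<in> arcs (net N)" "head (net N) (sink_arc N b) = sink N b"
proof -
  have "sink_arc N b \<in> in_arcs (net N) (sink N b)"
    using sink_vertex(3)[OF assms] by blast
  then show "sink_arc N b \<in> arcs (net N)" "head (net N) (sink_arc N b) = sink N b" by simp_all
qed

lemma inner_degrees:
  assumes "v \<in> inner_verts N"
  shows "in_arcs (net N) v \<noteq> {}" "out_arcs (net N) v \<noteq> {}"
  using assms by (cases rule: inner_cases;
      simp add: in_arcs_black out_arcs_black in_arcs_white out_arcs_white)+

lemma inner_vert: "v \<in> inner_verts N \<Longrightarrow> v \<in> verts (net N)"
  by (auto simp: inner_verts_def black_def white_def)

lemma source_not_inner: "a \<in> {1..nsources N} \<Longrightarrow> source N a \<notin> inner_verts N"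
  using source_vertex(2) inner_degrees(1) by blast

lemma sink_not_inner: "b \<in> {1..nsinks N} \<Longrightarrow> sink N b \<notin> inner_verts N"
  using sink_vertex(2) inner_degrees(2) by blast

lemma source_neq_sink: "a \<in> {1..nsources N} \<Longrightarrow> b \<in> {1..nsinks N} \<Longrightarrow> source N a \<noteq> sink N b"
  using source_vertex(3)[of a] sink_vertex(2)[of b] by auto

lemma source_inj: "a \<in> {1..nsources N} \<Longrightarrow> a' \<in> {1..nsources N} \<Longrightarrow> source N a = source N a' \<Longrightarrow> a = a'"
  using sources by (auto simp: bij_betw_def dest: inj_onD)

lemma sink_inj: "b \<in> {1..nsinks N} \<Longrightarrow> b' \<in> {1..nsinks N} \<Longrightarrow> sink N b = sink N b' \<Longrightarrow> b = b'"
  using sinks by (auto simp: bij_betw_def dest: inj_onD)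

lemma tail_cases:
  assumes "e \<in> arcs (net N)"
  obtains "tail (net N) e \<in> inner_verts N"
  | a where "a \<in> {1..nsources N}" "tail (net N) e = source N a" "e = source_arc N a"
proof -
  have "tail (net N) e \<in> verts (net N)" using assms by simp
  then consider "tail (net N) e \<in> inner_verts N"
    | a where "a \<in> {1..nsources N}" "tail (net N) e = source N a"
    | b where "b \<in> {1..nsinks N}" "tail (net N) e = sink N b"
    using vertices by blast
  then show ?thesis
  proof cases
    case 2
    have "e \<in> out_arcs (net N) (source N a)" using assms 2 by simp
    then show ?thesis using that 2 source_vertex(3)[OF 2(1)] by blast
  next
    case 3
    have "e \<in> out_arcs (net N) (sink N b)" using assms 3 by simp
    then show ?thesis using sink_vertex(2)[OF 3(1)] by blast
  qed (rule that)
qed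

lemma head_cases:
  assumes "e \<in> arcs (net N)"
  obtains "head (net N) e \<in> inner_verts N"
  | b where "b \<in> {1..nsinks N}" "head (net N) e = sink N b" "e = sink_arc N b"
proof -
  have "head (net N) e \<in> verts (net N)" using assms by simp
  then consider "head (net N) e \<in> inner_verts N"
    | a where "a \<in> {1..nsources N}" "head (net N) e = source N a"
    | b where "b \<in> {1..nsinks N}" "head (net N) e = sink N b"
    using vertices by blast
  then show ?thesis
  proof cases
    case 2
    have "e \<in> in_arcs (net N) (source N a)" using assms 2 by simp
    then show ?thesis using source_vertex(2)[OF 2(1)] by blast
  next
    case 3
    have "e \<in> in_arcs (net N) (sink N b)" using assms 3 by simp
    then show ?thesis using that 3 sink_vertex(3)[OF 3(1)] by blast
  qed (rule that)
qed

lemma head_not_source: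
  assumes "e \<in> arcs (net N)" shows "head (net N) e \<notin> source N ` {1..nsources N}"
proof
  assume "head (net N) e \<in> source N ` {1..nsources N}"
  then obtain a where a: "a \<in> {1..nsources N}" "head (net N) e = source N a" by blast
  then have "e \<in> in_arcs (net N) (source N a)" using assms by simp
  then show False using source_vertex(2)[OF a(1)] by simp
qed

lemma tail_not_sink:
  assumes "e \<in> arcs (net N)" shows "tail (net N) e \<notin> sink N ` {1..nsinks N}"
proof
  assume "tail (net N) e \<in> sink N ` {1..nsinks N}"
  then obtain b where b: "b \<in> {1..nsinks N}" "tail (net N) e = sink N b" by blast
  then have "e \<in> out_arcs (net N) (sink N b)" using assms by simp
  then show False using sink_vertex(2)[OF b(1)] by simp
qed

lemma walk_to_sink:
  "v \<in> verts (net N) \<Longrightarrow> v \<notin> source N ` {1..nsources N} \<Longrightarrow>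
    \<exists>b\<in>{1..nsinks N}. \<exists>p. dg.awalk v p (sink N b)"
proof (induction v rule: wf_induct_rule[OF wf_arcs_ends_converse])
  case (1 v)
  consider "v \<in> inner_verts N" | b where "b \<in> {1..nsinks N}" "v = sink N b"
    using 1(2,3) vertices by blast
  then show ?case
  proof cases
    case 1
    then obtain e where e: "e \<in> arcs (net N)" "tail (net N) e = v"
      using inner_degrees(2) by (metis all_not_in_conv in_out_arcs_conv)
    have "(head (net N) e, v) \<in> (arcs_ends (net N))\<inverse>"
      using arc_in_arcs_ends[OF e(1)] e(2) by simp
    then obtain b p where b: "b \<in> {1..nsinks N}" "dg.awalk (head (net N) e) p (sink N b)"
      using "1.IH" head_not_source[OF e(1)] dg.head_in_verts[OF e(1)] by blast
    have "dg.awalk v (e # p) (sink N b)" using b(2) e by (simp add: dg.awalk_Cons_iff)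
    then show ?thesis using b(1) by blast
  next
    case 2
    then have "dg.awalk v [] (sink N b)" using sink_vertex(1) by (simp add: dg.awalk_Nil_iff)
    then show ?thesis using 2(1) by blast
  qed
qed

lemma walk_from_source:
  "v \<in> verts (net N) \<Longrightarrow> v \<notin> sink N ` {1..nsinks N} \<Longrightarrow>
    \<exists>a\<in>{1..nsources N}. \<exists>p. dg.awalk (source N a) p v"
proof (induction v rule: wf_induct_rule[OF wf_arcs_ends])
  case (1 v)
  consider "v \<in> inner_verts N" | a where "a \<in> {1..nsources N}" "v = source N a"
    using 1(2,3) vertices by blast
  then show ?case
  proof cases
    case 1
    then obtain e where e: "e \<in> arcs (net N)" "head (net N) e = v"
      using inner_degrees(1) by (metis all_not_in_conv in_in_arcs_conv)
    have "(tail (net N) e, v) \<in> arcs_ends (net N)"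
      using arc_in_arcs_ends[OF e(1)] e(2) by simp
    then obtain a p where a: "a \<in> {1..nsources N}" "dg.awalk (source N a) p (tail (net N) e)"
      using "1.IH" tail_not_sink[OF e(1)] dg.tail_in_verts[OF e(1)] by blast
    have "dg.awalk (source N a) (p @ [e]) v"
      using dg.awalk_appendI[OF a(2) dg.arc_implies_awalk[OF e(1)]] e(2) by simp
    then show ?thesis using a(1) by blast
  next
    case 2
    then have "dg.awalk (source N a) [] v" using source_vertex(1) by (simp add: dg.awalk_Nil_iff)
    then show ?thesis using 2(1) by blast
  qed
qed

text \<open>
  Starting from any arc one can continue forwards and backwards until the boundary is reached. This
  is what makes the height function below strictly monotone across every arc.
\<close>

lemma arc_on_walk:
  assumes e: "e \<in> arcs (net N)"
  shows "\<exists>a\<in>{1..nsources N}. \<exists>b\<in>{1..nsinks N}. \<exists>p. dg.awalk (source N a) p (sink N b) \<and> e \<in> set p"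
proof -
  obtain a p where a: "a \<in> {1..nsources N}" "dg.awalk (source N a) p (tail (net N) e)"
    using walk_from_source[OF dg.tail_in_verts[OF e] tail_not_sink[OF e]] by blast
  obtain b q where b: "b \<in> {1..nsinks N}" "dg.awalk (head (net N) e) q (sink N b)"
    using walk_to_sink[OF dg.head_in_verts[OF e] head_not_source[OF e]] by blast
  have "dg.awalk (tail (net N) e) (e # q) (sink N b)"
    using b(2) e by (simp add: dg.awalk_Cons_iff)
  then have "dg.awalk (source N a) (p @ e # q) (sink N b)"
    using a(2) by (rule dg.awalk_appendI[rotated])
  moreover have "e \<in> set (p @ e # q)" by simp
  ultimately show ?thesis using a(1) b(1) by blast
qed

lemma walk_verts_distinct:
  assumes "dg.awalk u p v" shows "distinct (dg.awalk_verts u p)"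
proof (rule ccontr)
  assume "\<not> distinct (dg.awalk_verts u p)"
  then obtain r w where "dg.awalk w r w" "r \<noteq> []"
    using dg.awalk_not_distinct_decomp[OF assms] by blast
  then have "dg.closed_w r" by (auto simp: dg.closed_w_def)
  then show False using dg.closed_w_imp_cycle acyclic by blast
qed

lemma apath_iff_awalk: "dg.apath u p v \<longleftrightarrow> dg.awalk u p v"
  using walk_verts_distinct by (auto simp: dg.apath_def)

lemma finite_walks: "finite {p. dg.awalk u p v}"
  using dg.apaths_finite[of u v] by (simp add: apath_iff_awalk)

lemma walk_verts_tails:
  "dg.awalk u p v \<Longrightarrow> dg.awalk_verts u p = map (tail (net N)) p @ [v]"
  by (induction p arbitrary: u) (auto simp: dg.awalk_Nil_iff dg.awalk_Cons_iff)

lemma walk_verts_heads: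
  "dg.awalk u p v \<Longrightarrow> dg.awalk_verts u p = u # map (head (net N)) p"
  by (induction p arbitrary: u) (auto simp: dg.awalk_Nil_iff dg.awalk_Cons_iff)

lemma walk_tail_inj:
  assumes "dg.awalk u p v" "e \<in> set p" "e' \<in> set p" "tail (net N) e = tail (net N) e'"
  shows "e = e'"
  using walk_verts_distinct[OF assms(1)] assms(2-) unfolding walk_verts_tails[OF assms(1)]
  by (auto simp: distinct_map dest: inj_onD)

lemma walk_head_inj:
  assumes "dg.awalk u p v" "e \<in> set p" "e' \<in> set p" "head (net N) e = head (net N) e'"
  shows "e = e'"
  using walk_verts_distinct[OF assms(1)] assms(2-) unfolding walk_verts_heads[OF assms(1)]
  by (auto simp: distinct_map dest: inj_onD)

lemma walk_vertex_set:
  assumes "dg.awalk u p v"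
  shows "insert u (head (net N) ` set p) = insert v (tail (net N) ` set p)"
  using arg_cong[OF walk_verts_tails[OF assms], of set]
  unfolding walk_verts_heads[OF assms] by simp

lemma walk_one_branch:
  assumes "dg.awalk u p w" and v: "v \<in> inner_verts N"
  shows "right_branch v \<notin> set p \<or> left_branch v \<notin> set p"
proof -
  note inj = walk_tail_inj[OF assms(1), of "right_branch v" "left_branch v"]
    walk_head_inj[OF assms(1), of "right_branch v" "left_branch v"]
  from v show ?thesis
  proof (cases rule: inner_cases)
    case black
    then show ?thesis using inj(2) black_ends[OF black(1)] branches(4)[OF v] by auto
  next
    case white
    then show ?thesis using inj(1) white_ends[OF white(1)] branches(4)[OF v] by auto
  qed
qed

text \<open>
  A path from the boundary to the boundary that visits an inner vertex uses the stem and exactly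
  one branch, since it leaves every inner vertex that it enters and visits no vertex twice. Read
  modulo 2 this is a conservation law.
\<close>

lemma walk_through_inner:
  assumes p: "dg.awalk (source N a) p (sink N b)" "a \<in> {1..nsources N}" "b \<in> {1..nsinks N}"
    and v: "v \<in> inner_verts N"
  shows "stem v \<in> set p \<longleftrightarrow> (right_branch v \<in> set p) \<noteq> (left_branch v \<in> set p)"
proof -
  have ends: "v \<noteq> source N a" "v \<noteq> sink N b"
    using v source_not_inner[OF p(2)] sink_not_inner[OF p(3)] by auto
  have pass: "v \<in> head (net N) ` set p \<longleftrightarrow> v \<in> tail (net N) ` set p"
    using ends walk_vertex_set[OF p(1)] by blast
  have arcs: "set p \<subseteq> arcs (net N)" using p(1) by (auto simp: dg.awalk_def)
  have heads: "v \<in> head (net N) ` set p \<longleftrightarrow> set p \<inter> in_arcs (net N) v \<noteq> {}"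
    and tails: "v \<in> tail (net N) ` set p \<longleftrightarrow> set p \<inter> out_arcs (net N) v \<noteq> {}"
    using arcs by (auto simp: in_arcs_def out_arcs_def)
  note one = walk_one_branch[OF p(1) v]
  from v show ?thesis
  proof (cases rule: inner_cases)
    case black
    have "v \<in> head (net N) ` set p \<longleftrightarrow> right_branch v \<in> set p \<or> left_branch v \<in> set p"
      unfolding heads in_arcs_black[OF black(1)] by simp
    moreover have "v \<in> tail (net N) ` set p \<longleftrightarrow> stem v \<in> set p"
      unfolding tails out_arcs_black[OF black(1)] by simp
    ultimately show ?thesis using pass one by blast
  next
    case white
    have "v \<in> tail (net N) ` set p \<longleftrightarrow> right_branch v \<in> set p \<or> left_branch v \<in> set p"
      unfolding tails out_arcs_white[OF white(1)] by simp
    moreover have "v \<in> head (net N) ` set p \<longleftrightarrow> stem v \<in> set p"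
      unfolding heads in_arcs_white[OF white(1)] by simp
    ultimately show ?thesis using pass one by blast
  qed
qed

section \<open>Planarity: even sets of arcs bound\<close>

text \<open>
  These are the chains modulo 2 of arcs whose boundary is concentrated on the boundary of the rectangle; they
  contain all paths from sources to sinks.
\<close>

definition even_sets :: "'e set set" where
  "even_sets = {S. S \<subseteq> arcs (net N) \<and>
     (\<forall>v\<in>inner_verts N. stem v \<in> S \<longleftrightarrow> (right_branch v \<in> S) \<noteq> (left_branch v \<in> S))}"

definition bdry :: "('e \<times> side) set set \<Rightarrow> 'e set" where
  "bdry A = {e \<in> arcs (net N). (face_of N (e, Rgt) \<in> A) \<noteq> (face_of N (e, Lft) \<in> A)}"

lemma branch_arcs:
  assumes "v \<in> inner_verts N"
  shows "stem v \<in> arcs (net N)" "right_branch v \<in> arcs (net N)" "left_branch v \<in> arcs (net N)"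
proof -
  have "incident N v \<subseteq> arcs (net N)" by (auto simp: incident_def)
  then show "stem v \<in> arcs (net N)" "right_branch v \<in> arcs (net N)" "left_branch v \<in> arcs (net N)"
    unfolding branches(1)[OF assms] by auto
qed

lemma bdry_even: "bdry A \<in> even_sets"
  by (auto simp: even_sets_def bdry_def branch_arcs branch_faces)

lemma bdry_sym_diff: "bdry (sym_diff A B) = sym_diff (bdry A) (bdry B)"
  by (auto simp: bdry_def)

lemma arc_face: "e \<in> arcs (net N) \<Longrightarrow> face_of N (e, s) \<in> faces N"
  by (auto simp: faces_def face_of_def arc_sides_def intro: quotientI)

lemma bdry_complement: "bdry (faces N - A) = bdry A"
proof (rule Set.set_eqI)
  fix e show "e \<in> bdry (faces N - A) \<longleftrightarrow> e \<in> bdry A"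
    using arc_face[of e Rgt] arc_face[of e Lft] by (auto simp: bdry_def)
qed

lemma bdry_mem:
  assumes "e \<in> arcs (net N)"
  shows "e \<in> bdry A \<longleftrightarrow> (face_of N (e, Rgt) \<in> A) \<noteq> (face_of N (e, Lft) \<in> A)"
  using assms by (simp add: bdry_def)

lemma faceE:
  assumes "\<theta> \<in> faces N"
  obtains e s where "e \<in> arcs (net N)" "\<theta> = face_of N (e, s)"
  using assms by (auto simp: faces_def face_of_def arc_sides_def elim!: quotientE)

lemma boundary_corner_face:
  assumes "(s, t) \<in> boundary_corners N"
  shows "face_of N s = face_of N t"
  using assms by (intro face_of_eqI) (auto simp: same_face_def Let_def)

lemma sink_corner_face:
  assumes "b \<in> {1..nsinks N}" "Suc b \<in> {1..nsinks N}"
  shows "face_of N (sink_arc N b, Lft) = face_of N (sink_arc N (Suc b), Rgt)"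
  using assms by (intro boundary_corner_face) (auto simp: boundary_corners_def)

lemma source_corner_face:
  assumes "a \<in> {1..nsources N}" "Suc a \<in> {1..nsources N}"
  shows "face_of N (source_arc N a, Lft) = face_of N (source_arc N (Suc a), Rgt)"
  using assms by (intro boundary_corner_face) (auto simp: boundary_corners_def)

text \<open>
  The dual graph is connected: going around an inner vertex crosses each of its arcs, so a function that
  does not change across arcs takes one value near each vertex; this value can be carried along
  directed walks to a sink, and from sink to sink along the left side of the rectangle. The
  reference value is taken at the bottom face because no path has that face on its right.
\<close>

lemma face_function_const:
  fixes f :: "('e \<times> side) set \<Rightarrow> 'x"
  assumes eq: "\<And>e. e \<in> arcs (net N) \<Longrightarrow> f (face_of N (e, Lft)) = f (face_of N (e, Rgt))"
    and \<theta>: "\<theta> \<in> faces N"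
  shows "f \<theta> = f (face_of N (sink_arc N (nsinks N), Lft))"
proof -
  let ?f = "\<lambda>e. f (face_of N (e, Rgt))"
  have sides: "f (face_of N (e, s)) = ?f e" if "e \<in> arcs (net N)" for e s
    using eq[OF that] by (cases s) auto
  have sinks: "?f (sink_arc N b) = ?f (sink_arc N (nsinks N))" if "b \<in> {1..nsinks N}" for b
  proof -
    have "b \<le> nsinks N" using that by simp
    from this that show ?thesis
    proof (induction b rule: inc_induct)
      case (step b)
      then have b: "b \<in> {1..nsinks N}" "Suc b \<in> {1..nsinks N}" by auto
      then show ?case
        using step.IH sink_corner_face[OF b] sides[OF sink_arc_arc(1)[OF b(1)], of Lft] by simp
    qed simp
  qed
  have inner: "?f (right_branch v) = ?f (stem v) \<and> ?f (left_branch v) = ?f (stem v)"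
    if "v \<in> inner_verts N" for v
    using branch_faces[OF that] eq[OF branch_arcs(1)[OF that]] eq[OF branch_arcs(2)[OF that]]
      eq[OF branch_arcs(3)[OF that]] by simp
  have at_vertex: "?f e = ?f e'" if "v \<in> inner_verts N" "e \<in> incident N v" "e' \<in> incident N v" for v e e'
    using inner[OF that(1)] that(2,3) unfolding branches(1)[OF that(1)] by auto
  have "?f e = ?f (sink_arc N (nsinks N))" if "e \<in> in_arcs (net N) v" for v e
    using that
  proof (induction v arbitrary: e rule: wf_induct_rule[OF wf_arcs_ends_converse])
    case (1 v)
    then have e: "e \<in> arcs (net N)" "head (net N) e = v" by auto
    from e(1) show ?case
    proof (cases rule: head_cases)
      case 1
      then have v: "v \<in> inner_verts N" using e(2) by simp
      then obtain e' where e': "e' \<in> out_arcs (net N) v" using inner_degrees(2) by blast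
      then have "(head (net N) e', v) \<in> (arcs_ends (net N))\<inverse>" "e' \<in> in_arcs (net N) (head (net N) e')"
        using arc_in_arcs_ends[of e'] by auto
      then have "?f e' = ?f (sink_arc N (nsinks N))" using "1.IH" by blast
      moreover have "?f e = ?f e'"
        using at_vertex[OF v, of e e'] e' "1.prems" by (simp add: incident_def)
      ultimately show ?thesis by simp
    next
      case (2 b)
      then show ?thesis using sinks[OF 2(1)] by (simp only:)
    qed
  qed
  then have arc_const: "?f e = ?f (sink_arc N (nsinks N))" if "e \<in> arcs (net N)" for e
    using that by simp
  obtain e s where e: "e \<in> arcs (net N)" "\<theta> = face_of N (e, s)" using \<theta> by (rule faceE)
  obtain b where "b \<in> {1..nsinks N}" using arc_on_walk[OF e(1)] by blast
  then have "nsinks N \<in> {1..nsinks N}" by auto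
  then show ?thesis
    using arc_const[OF e(1)] sides[OF e(1), of s] sides[OF sink_arc_arc(1), of "nsinks N" Lft] e(2) by simp
qed

lemma bdry_empty:
  assumes "A \<subseteq> faces N" "bdry A = {}"
  shows "A = {} \<or> A = faces N"
proof -
  have "(\<theta> \<in> A) = (face_of N (sink_arc N (nsinks N), Lft) \<in> A)" if "\<theta> \<in> faces N" for \<theta>
    using face_function_const[of "\<lambda>\<theta>. \<theta> \<in> A", OF _ that] assms(2) bdry_mem[of _ A] by auto
  then show ?thesis using assms(1) by blast
qed

lemma bdry_eq:
  assumes "A \<subseteq> faces N" "B \<subseteq> faces N" "bdry A = bdry B"
  shows "B = A \<or> B = faces N - A"
proof -
  have "sym_diff A B = {} \<or> sym_diff A B = faces N"
    using bdry_empty[of "sym_diff A B"] assms by (auto simp: bdry_sym_diff)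
  then show ?thesis using assms(1,2) by blast
qed

definition lead_arc :: "'v \<Rightarrow> 'e" where
  "lead_arc v = (if v \<in> black N then stem v else right_branch v)"

lemma lead_arc:
  assumes "v \<in> inner_verts N"
  shows "lead_arc v \<in> arcs (net N)" "tail (net N) (lead_arc v) = v"
  using branch_arcs[OF assms] black_ends(1)[of v] white_ends(2)[of v] assms
  by (auto simp: lead_arc_def inner_verts_def)

text \<open>
  An even set is determined by its arcs other than the lead arcs: in the order of the
  flow, the parity condition at a vertex computes membership of its lead arc from arcs
  that are decided already. This bounds the number of even sets by counting.
\<close>

lemma even_set_determined:
  assumes "S \<in> even_sets" "S \<subseteq> lead_arc ` inner_verts N"
  shows "S = {}"
proof -
  have "lead_arc v \<notin> S" if "v \<in> inner_verts N" for v
    using that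
  proof (induction v rule: wf_induct_rule[OF wf_arcs_ends])
    case (1 v)
    have in_S: "e \<notin> S" if "e \<in> in_arcs (net N) v" for e
    proof
      assume "e \<in> S"
      then obtain u where u: "u \<in> inner_verts N" "e = lead_arc u" using assms(2) by blast
      then have "(u, v) \<in> arcs_ends (net N)"
        using arc_in_arcs_ends[of e] lead_arc[OF u(1)] that by auto
      then show False using "1.IH" u \<open>e \<in> S\<close> by blast
    qed
    have out_S: "e = lead_arc v" if e: "e \<in> S" "tail (net N) e = v" for e
    proof -
      obtain u where "u \<in> inner_verts N" "e = lead_arc u" using assms(2) e(1) by blast
      then show ?thesis using lead_arc(2)[of u] e(2) by simp
    qed
    have even: "stem v \<in> S \<longleftrightarrow> (right_branch v \<in> S) \<noteq> (left_branch v \<in> S)"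
      using assms(1) 1(2) by (auto simp: even_sets_def)
    from 1(2) show ?case
    proof (cases rule: inner_cases)
      case black
      then have "right_branch v \<notin> S" "left_branch v \<notin> S"
        using in_S unfolding in_arcs_black[OF black(1)] by blast+
      then show ?thesis using even black(1) by (simp add: lead_arc_def)
    next
      case white
      have "left_branch v \<notin> S"
        using out_S[of "left_branch v"] white_ends(3)[OF white(1)] branches(5)[OF 1(2)] white(2)
        by (auto simp: lead_arc_def)
      moreover have "stem v \<notin> S"
        using in_S unfolding in_arcs_white[OF white(1)] by blast
      ultimately show ?thesis using even white(2) by (simp add: lead_arc_def)
    qed
  qed
  then show ?thesis using assms(2) by blast
qed

lemma even_sets_sym_diff:
  assumes "S \<in> even_sets" "T \<in> even_sets" shows "sym_diff S T \<in> even_sets"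
  using assms by (auto simp: even_sets_def)

lemma finite_inner: "finite (inner_verts N)"
  using inner_vert finite_subset[OF _ dg.finite_verts] by blast

lemma inj_lead_arc: "inj_on lead_arc (inner_verts N)"
  by (rule inj_on_inverseI[of _ "tail (net N)"]) (rule lead_arc(2))

lemma card_even_sets: "card even_sets \<le> 2 ^ (card (arcs (net N)) - card (inner_verts N))"
proof -
  let ?L = "lead_arc ` inner_verts N"
  have "?L \<subseteq> arcs (net N)" using lead_arc(1) by blast
  then have card: "card (arcs (net N) - ?L) = card (arcs (net N)) - card (inner_verts N)"
    using card_Diff_subset[of ?L "arcs (net N)"] card_image[OF inj_lead_arc] finite_inner by simp
  have "inj_on (\<lambda>S. S - ?L) even_sets"
  proof (rule inj_onI)
    fix S T assume ST: "S \<in> even_sets" "T \<in> even_sets" "S - ?L = T - ?L"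
    have "sym_diff S T \<subseteq> ?L" using ST(3) by blast
    then have "sym_diff S T = {}"
      using even_set_determined[OF even_sets_sym_diff[OF ST(1,2)]] by blast
    then show "S = T" by blast
  qed
  moreover have "(\<lambda>S. S - ?L) ` even_sets \<subseteq> Pow (arcs (net N) - ?L)"
    by (auto simp: even_sets_def)
  ultimately have "card even_sets \<le> card (Pow (arcs (net N) - ?L))"
    by (intro card_inj_on_le) simp_all
  then show ?thesis by (simp add: card_Pow card)
qed

text \<open>
  The homological form of planarity. Let \<open>F\<close>, \<open>E\<close> and \<open>V\<close> be the numbers of
  faces, arcs and inner vertices. A set of faces is determined by the arcs that it bounds up to
  complement, so there are \<open>2 ^ (F - 1)\<close> boundaries, and there are at most \<open>2 ^ (E - V)\<close>
  even sets. Euler characteristic 1 says that the exponents agree, hence every even set bounds.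
\<close>

lemma even_set_bounds:
  assumes "S \<in> even_sets"
  obtains A where "A \<subseteq> faces N" "bdry A = S"
proof (cases "arcs (net N) = {}")
  case True
  then show ?thesis using assms that[of "{}"] by (auto simp: even_sets_def bdry_def)
next
  case False
  then obtain \<theta> where \<theta>: "\<theta> \<in> faces N" using arc_face by blast
  \<comment> \<open>Removing one face selects one set from every pair of complementary sets of faces.\<close>
  have "inj_on bdry (Pow (faces N - {\<theta>}))"
  proof (rule inj_onI)
    fix A B assume AB: "A \<in> Pow (faces N - {\<theta>})" "B \<in> Pow (faces N - {\<theta>})" "bdry A = bdry B"
    then have "B = A \<or> B = faces N - A" by (intro bdry_eq) auto
    then show "A = B" using AB(1,2) \<theta> by auto
  qed
  then have "card (bdry ` Pow (faces N - {\<theta>})) = 2 ^ (card (faces N) - 1)"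
    using \<theta> finite_faces by (simp add: card_image card_Pow card_Diff_singleton)
  moreover have "card (inner_verts N) \<le> card (arcs (net N))"
    using card_inj_on_le[OF inj_lead_arc, of "arcs (net N)"] lead_arc(1) by auto
  then have "card (faces N) - 1 = card (arcs (net N)) - card (inner_verts N)"
    using planar[OF False] by linarith
  ultimately have "card even_sets \<le> card (bdry ` Pow (faces N - {\<theta>}))"
    using card_even_sets by simp
  moreover have "bdry ` Pow (faces N - {\<theta>}) \<subseteq> even_sets"
    using bdry_even by blast
  moreover have "finite even_sets"
    by (rule finite_subset[of _ "Pow (arcs (net N))"]) (auto simp: even_sets_def)
  ultimately have "bdry ` Pow (faces N - {\<theta>}) = even_sets"
    by (intro card_seteq) auto
  then have "S \<in> bdry ` Pow (faces N - {\<theta>})" using assms by simp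
  then obtain A where A: "A \<subseteq> faces N - {\<theta>}" "bdry A = S" by auto
  then have "A \<subseteq> faces N" by blast
  then show ?thesis using A(2) by (rule that)
qed

section \<open>The region to the right of a path\<close>

context
  fixes a b p
  assumes a: "a \<in> {1..nsources N}" and b: "b \<in> {1..nsinks N}"
    and p: "dg.awalk (source N a) p (sink N b)"
begin

lemma path_even: "set p \<in> even_sets"
  using walk_through_inner[OF p a b] p by (auto simp: even_sets_def dg.awalk_def)

text \<open>
  The two sides of a path do not get exchanged along the path: between two consecutive arcs one of the
  two sides is a common face, and at a left branch the right sides are separated only by the
  right branch, which the path does not use.
\<close>

lemma path_sides_const:
  assumes A: "bdry A = set p" and ef: "e \<in> set p" "f \<in> set p"
  shows "face_of N (e, Rgt) \<in> A \<longleftrightarrow> face_of N (f, Rgt) \<in> A"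
proof -
  let ?in = "\<lambda>e s. face_of N (e, s) \<in> A"
  have off: "?in e Rgt = ?in e Lft" if "e \<in> arcs (net N)" "e \<notin> set p" for e
    using bdry_mem[OF that(1), of A] that(2) A by simp
  have step: "?in e Rgt = ?in f Rgt"
    if v: "v \<in> inner_verts N" and "e \<in> set p" "f \<in> set p" "e \<in> incident N v" "f \<in> incident N v" for e f v
  proof -
    have "?in x Rgt = ?in (stem v) Rgt" if x: "x \<in> set p" "x \<in> incident N v" for x
    proof -
      consider "x = stem v" | "x = right_branch v" | "x = left_branch v"
        using x(2) unfolding branches(1)[OF v] by blast
      then show ?thesis
      proof cases
        case 3
        then have "right_branch v \<notin> set p" using walk_one_branch[OF p v] x(1) by auto
        then show ?thesis using off[OF branch_arcs(2)[OF v]] branch_faces[OF v] 3 by simp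
      qed (use branch_faces[OF v] in simp_all)
    qed
    then show ?thesis using that(2-5) by simp
  qed
  have "?in e Rgt = ?in (hd p) Rgt" if "e \<in> set p" for e
  proof -
    obtain r s where rs: "p = r @ e # s" using \<open>e \<in> set p\<close> by (auto simp: in_set_conv_decomp)
    have "\<And>s e. p = r @ e # s \<Longrightarrow> ?in e Rgt = ?in (hd p) Rgt"
    proof (induction r rule: rev_induct)
      case (snoc f r)
      then have w: "dg.awalk (source N a) (r @ f # e # s) (sink N b)" using p by simp
      then have v: "head (net N) f = tail (net N) e" "e \<in> arcs (net N)" "f \<in> arcs (net N)"
        by (auto simp: dg.awalk_Cons_iff)
      have "tail (net N) e \<notin> source N ` {1..nsources N}" using head_not_source[OF v(3)] v(1) by simp
      with v(2) have inner: "tail (net N) e \<in> inner_verts N"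
        by (cases rule: tail_cases) auto
      have "?in e Rgt = ?in f Rgt"
        using snoc.prems v by (intro step[OF inner]) (simp_all add: incident_def)
      then show ?case using snoc.IH[of f "e # s"] snoc.prems by simp
    qed simp
    then show ?thesis using rs by blast
  qed
  then show ?thesis using ef by blast
qed

text \<open>
  Choose a set of faces that is bounded by the path and contains one face on its right. By the previous lemma
  it has the right sides inside and the left sides outside. It can be left only across arcs of the path, so
  it contains everything that can be reached from the right sides. In particular no left side is
  reached, and the reachable region has the path as its boundary, too.
\<close>

lemma right_region: 
  shows "faces_right_of N p \<subseteq> faces N" "bdry (faces_right_of N p) = set p"
    and "e \<in> set p \<Longrightarrow> face_of N (e, Rgt) \<in> faces_right_of N p \<and> face_of N (e, Lft) \<notin> faces_right_of N p"
proof -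
  let ?R = "faces_right_of N p"
  have arcs: "set p \<subseteq> arcs (net N)" using p by (auto simp: dg.awalk_def)
  have "p \<noteq> []" using p source_neq_sink[OF a b] by (auto simp: dg.awalk_Nil_iff)
  then have hd: "hd p \<in> set p" by simp
  obtain A where A: "A \<subseteq> faces N" "bdry A = set p" "face_of N (hd p, Rgt) \<in> A"
  proof -
    obtain A where A: "A \<subseteq> faces N" "bdry A = set p" using even_set_bounds[OF path_even] .
    moreover have "bdry (faces N - A) = set p" using bdry_complement A(2) by simp
    moreover have "face_of N (hd p, Rgt) \<in> faces N" using arc_face[of "hd p" Rgt] hd arcs by auto
    ultimately show ?thesis
      using that[OF A] that[of "faces N - A"] by (cases "face_of N (hd p, Rgt) \<in> A") auto
  qed
  have right_A: "face_of N (e, Rgt) \<in> A" "face_of N (e, Lft) \<notin> A" if "e \<in> set p" for e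
  proof -
    show "face_of N (e, Rgt) \<in> A" using path_sides_const[OF A(2) that hd] A(3) by simp
    then show "face_of N (e, Lft) \<notin> A" using bdry_mem[of e A] A(2) that arcs by auto
  qed
  have "\<phi> \<in> A" if "(\<theta>, \<phi>) \<in> (adjacent_off N (set p))\<^sup>*" "\<theta> \<in> A" for \<theta> \<phi>
    using that
  proof (induction rule: rtrancl_induct)
    case (step y z)
    then obtain e s t where e: "e \<in> arcs (net N)" "e \<notin> set p" "y = face_of N (e, s)" "z = face_of N (e, t)"
      by (auto simp: adjacent_off_def)
    then have "(face_of N (e, Rgt) \<in> A) = (face_of N (e, Lft) \<in> A)" using bdry_mem[OF e(1), of A] A(2) by simp
    then show ?case using step e by (cases s; cases t) auto
  qed
  then have RA: "?R \<subseteq> A" using right_A(1) by (auto simp: faces_right_of_def)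
  have right_R: "face_of N (e, Rgt) \<in> ?R" if "e \<in> set p" for e
    using that by (auto simp: faces_right_of_def)
  have off: "face_of N (e, t) \<in> ?R" if "e \<in> arcs (net N)" "e \<notin> set p" "face_of N (e, s) \<in> ?R" for e s t
  proof -
    have "(face_of N (e, s), face_of N (e, t)) \<in> adjacent_off N (set p)"
      using that by (auto simp: adjacent_off_def)
    then show ?thesis using that(3) rtrancl.rtrancl_into_rtrancl[of _ "face_of N (e, s)" "adjacent_off N (set p)"]
      unfolding faces_right_of_def by blast
  qed
  show "?R \<subseteq> faces N" using RA A(1) by blast
  show "bdry ?R = set p"
  proof (intro equalityI subsetI)
    fix e assume "e \<in> bdry ?R"
    then have e: "e \<in> arcs (net N)" "(face_of N (e, Rgt) \<in> ?R) \<noteq> (face_of N (e, Lft) \<in> ?R)"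
      by (auto simp: bdry_def)
    then show "e \<in> set p" using off[of e] by blast
  next
    fix e assume "e \<in> set p"
    then show "e \<in> bdry ?R" using right_R[of e] right_A(2)[of e] RA arcs bdry_mem[of e ?R] by blast
  qed
  show "face_of N (e, Rgt) \<in> ?R \<and> face_of N (e, Lft) \<notin> ?R" if "e \<in> set p"
    using right_R[OF that] right_A(2)[OF that] RA by blast
qed

lemma bottom_not_right: "face_of N (sink_arc N (nsinks N), Lft) \<notin> faces_right_of N p"
proof -
  let ?R = "faces_right_of N p"
  have arcs: "set p \<subseteq> arcs (net N)" using p by (auto simp: dg.awalk_def)
  have "p \<noteq> []" using p source_neq_sink[OF a b] by (auto simp: dg.awalk_Nil_iff)
  then obtain r e where re: "p = r @ [e]" by (metis rev_exhaust)
  then have e: "e \<in> arcs (net N)" "head (net N) e = sink N b" using p by (auto simp: dg.awalk_Cons_iff dg.awalk_Nil_iff)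
  then have "e \<in> in_arcs (net N) (sink N b)" by simp
  then have e_sink: "sink_arc N b \<in> set p" using sink_vertex(3)[OF b] re by auto
  have "face_of N (sink_arc N c, Lft) \<notin> ?R" if "b \<le> c" "c \<le> nsinks N" for c
    using that
  proof (induction c rule: dec_induct)
    case base
    then show ?case using right_region(3)[OF e_sink] by blast
  next
    case (step c)
    then have c: "c \<in> {1..nsinks N}" "Suc c \<in> {1..nsinks N}" using b by auto
    have "sink_arc N (Suc c) \<notin> set p"
    proof
      assume "sink_arc N (Suc c) \<in> set p"
      then have "sink N (Suc c) \<in> insert (sink N b) (tail (net N) ` set p)"
        using walk_vertex_set[OF p] sink_arc_arc(2)[OF c(2)] by (metis image_eqI insertI2)
      moreover have "sink N (Suc c) \<notin> tail (net N) ` set p"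
      proof
        assume "sink N (Suc c) \<in> tail (net N) ` set p"
        then obtain f where f: "f \<in> arcs (net N)" "tail (net N) f = sink N (Suc c)" using arcs by auto
        show False
          using tail_not_sink[OF f(1)] imageI[OF c(2), of "sink N"] unfolding f(2) by (rule notE)
      qed
      ultimately have "Suc c = b" using sink_inj[OF c(2) b] by simp
      then show False using step(1) by simp
    qed
    then have "sink_arc N (Suc c) \<notin> bdry ?R" using right_region(2) by simp
    moreover have "face_of N (sink_arc N (Suc c), Rgt) \<notin> ?R"
      using step sink_corner_face[OF c] by simp
    ultimately show ?case using bdry_mem[OF sink_arc_arc(1)[OF c(2)], of ?R] by simp
  qed
  then show ?thesis using b by simp
qed

end

section \<open>A height function and the skew form on paths\<close>

definition paths :: "'e list set" where
  "paths = (\<Union>a\<in>{1..nsources N}. \<Union>b\<in>{1..nsinks N}. {p. dg.awalk (source N a) p (sink N b)})"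

lemma finite_paths: "finite paths"
  unfolding paths_def using finite_walks by simp

lemma pathsI:
  assumes "a \<in> {1..nsources N}" "b \<in> {1..nsinks N}" "dg.awalk (source N a) p (sink N b)"
  shows "p \<in> paths"
  unfolding paths_def by (rule UN_I[OF assms(1)], rule UN_I[OF assms(2)]) (simp add: assms(3))

lemma pathsE:
  assumes "p \<in> paths"
  obtains a b where "a \<in> {1..nsources N}" "b \<in> {1..nsinks N}" "dg.awalk (source N a) p (sink N b)"
  using assms by (auto simp: paths_def)

lemma lookup_path_vector:
  assumes "p \<in> paths"
  shows "Poly_Mapping.lookup (path_vector N p) \<theta> = of_bool (\<theta> \<in> faces_right_of N p)"
proof -
  obtain a b where ab: "a \<in> {1..nsources N}" "b \<in> {1..nsinks N}" "dg.awalk (source N a) p (sink N b)"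
    using assms by (rule pathsE)
  have "finite (faces_right_of N p)"
    using right_region(1)[OF ab] finite_faces by (rule finite_subset)
  then show ?thesis
    by (simp add: path_vector_def lookup_sum lookup_single when_def)
qed

lemma path_vector_step:
  assumes p: "p \<in> paths" and e: "e \<in> arcs (net N)"
  shows "Poly_Mapping.lookup (path_vector N p) (face_of N (e, Rgt))
       = Poly_Mapping.lookup (path_vector N p) (face_of N (e, Lft)) + of_bool (e \<in> set p)"
proof -
  obtain a b where ab: "a \<in> {1..nsources N}" "b \<in> {1..nsinks N}" "dg.awalk (source N a) p (sink N b)"
    using p by (rule pathsE)
  show ?thesis
    using bdry_mem[OF e, of "faces_right_of N p"] right_region(2)[OF ab] right_region(3)[OF ab, of e]
    by (auto simp: lookup_path_vector[OF p])
qed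

lemma path_vector_bottom:
  assumes "p \<in> paths"
  shows "Poly_Mapping.lookup (path_vector N p) (face_of N (sink_arc N (nsinks N), Lft)) = 0"
proof -
  obtain a b where ab: "a \<in> {1..nsources N}" "b \<in> {1..nsinks N}" "dg.awalk (source N a) p (sink N b)"
    using assms by (rule pathsE)
  show ?thesis using bottom_not_right[OF ab] by (simp add: lookup_path_vector[OF assms])
qed

lemma keys_path_vector:
  assumes "p \<in> paths"
  shows "Poly_Mapping.keys (path_vector N p) \<subseteq> faces N"
proof -
  obtain a b where ab: "a \<in> {1..nsources N}" "b \<in> {1..nsinks N}" "dg.awalk (source N a) p (sink N b)"
    using assms by (rule pathsE)
  show ?thesis
    using right_region(1)[OF ab] by (auto simp: in_keys_iff lookup_path_vector[OF assms])
qed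

text \<open>
  Each path contributes a drop by 1 from its left to its right side. The sign is chosen so that
  heights grow from the top of the rectangle to the bottom.
\<close>

definition height :: "('e \<times> side) set \<Rightarrow> int" where
  "height \<theta> = - (\<Sum>p\<in>paths. Poly_Mapping.lookup (path_vector N p) \<theta>)"

lemma height_increases:
  assumes e: "e \<in> arcs (net N)"
  shows "height (face_of N (e, Rgt)) < height (face_of N (e, Lft))"
proof -
  obtain a b p where p: "a \<in> {1..nsources N}" "b \<in> {1..nsinks N}" "dg.awalk (source N a) p (sink N b)" "e \<in> set p"
    using arc_on_walk[OF e] by auto
  have "p \<in> paths" using p(1-3) by (rule pathsI)
  have "(\<Sum>p\<in>paths. Poly_Mapping.lookup (path_vector N p) (face_of N (e, Rgt)))
      = (\<Sum>p\<in>paths. Poly_Mapping.lookup (path_vector N p) (face_of N (e, Lft)))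
        + (\<Sum>p\<in>paths. of_bool (e \<in> set p))"
    unfolding sum.distrib[symmetric] by (intro sum.cong refl path_vector_step e)
  moreover have "(\<Sum>p\<in>paths. of_bool (e \<in> set p)) > (0::int)"
    by (rule sum_pos2[OF finite_paths \<open>p \<in> paths\<close>]) (simp_all add: p(4))
  ultimately show ?thesis by (simp add: height_def)
qed

text \<open>
  An arc occupies the interval between the heights of its right and its left side, and arcs are compared
  by the position of these intervals.
\<close>

definition higher :: "'e \<Rightarrow> 'e \<Rightarrow> bool" where
  "higher e f \<longleftrightarrow> height (face_of N (e, Lft)) \<le> height (face_of N (f, Rgt))"

lemma higher_asym:
  assumes "e \<in> arcs (net N)" "f \<in> arcs (net N)" "higher e f"
  shows "\<not> higher f e" "e \<noteq> f"
  using assms height_increases[OF assms(1)] height_increases[OF assms(2)] by (auto simp: higher_def)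

lemma higher_trans:
  assumes "f \<in> arcs (net N)" "higher e f" "higher f g"
  shows "higher e g"
  using assms height_increases[OF assms(1)] by (auto simp: higher_def)

lemma consecutive_higher:
  assumes step: "\<And>a. a \<in> {1..k} \<Longrightarrow> Suc a \<in> {1..k} \<Longrightarrow> face_of N (arc a, Lft) = face_of N (arc (Suc a), Rgt)"
    and arcs: "\<And>a. a \<in> {1..k} \<Longrightarrow> arc a \<in> arcs (net N)"
    and ab: "a \<in> {1..k}" "b \<in> {1..k}" "a < b"
  shows "higher (arc a) (arc b)"
proof -
  have "Suc a \<le> b" using ab(3) by simp
  then show ?thesis using ab(2)
  proof (induction b rule: dec_induct)
    case base
    then show ?case using step[of a] ab(1) by (simp add: higher_def)
  next
    case (step b)
    then have b: "b \<in> {1..k}" "Suc b \<in> {1..k}" by auto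
    have "higher (arc b) (arc (Suc b))" using assms(1)[OF b] by (simp add: higher_def)
    then show ?case using higher_trans[OF arcs[OF b(1)]] step b by blast
  qed
qed

lemma sink_higher:
  assumes "b \<in> {1..nsinks N}" "c \<in> {1..nsinks N}"
  shows "higher (sink_arc N b) (sink_arc N c) \<longleftrightarrow> b < c"
proof
  note up = consecutive_higher[of "nsinks N" "sink_arc N", OF sink_corner_face sink_arc_arc(1)]
  show "b < c \<Longrightarrow> higher (sink_arc N b) (sink_arc N c)" using up assms by blast
  assume abv: "higher (sink_arc N b) (sink_arc N c)"
  note asym = higher_asym[OF sink_arc_arc(1)[OF assms(1)] sink_arc_arc(1)[OF assms(2)] abv]
  show "b < c"
  proof (rule ccontr)
    assume "\<not> b < c"
    then have "b = c \<or> higher (sink_arc N c) (sink_arc N b)" using up assms by (meson linorder_neqE_nat)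
    then show False using asym by auto
  qed
qed

lemma source_higher:
  assumes "a \<in> {1..nsources N}" "a' \<in> {1..nsources N}" "a < a'"
  shows "higher (source_arc N a) (source_arc N a')"
  using consecutive_higher[of "nsources N" "source_arc N", OF source_corner_face source_arc_arc(1)] assms by blast

definition arrow_src :: "'v \<Rightarrow> 'e \<Rightarrow> ('e \<times> side) set" where
  "arrow_src v e = face_of N (if v \<in> black N then cw_side N v e else ccw_side N v e)"

definition arrow_tgt :: "'v \<Rightarrow> 'e \<Rightarrow> ('e \<times> side) set" where
  "arrow_tgt v e = face_of N (if v \<in> black N then ccw_side N v e else cw_side N v e)"

text \<open>
  The direction of the arrows changes with the colour, but so does the direction of the arcs relative to the
  vertex. In terms of right and left sides both colours look the same.
\<close>

lemma arrow_sides: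
  assumes v: "v \<in> inner_verts N"
  shows "arrow_src v (stem v) = face_of N (stem v, Rgt) \<and> arrow_tgt v (stem v) = face_of N (stem v, Lft) \<and>
    arrow_src v (right_branch v) = face_of N (right_branch v, Lft) \<and>
    arrow_tgt v (right_branch v) = face_of N (right_branch v, Rgt) \<and>
    arrow_src v (left_branch v) = face_of N (left_branch v, Lft) \<and>
    arrow_tgt v (left_branch v) = face_of N (left_branch v, Rgt)"
proof -
  have b: "v \<in> black N \<Longrightarrow> ?thesis"
    by (simp add: arrow_src_def arrow_tgt_def cw_side_def ccw_side_def black_ends)
  have w: "v \<in> white N \<Longrightarrow> v \<notin> black N \<Longrightarrow> ?thesis"
    by (simp add: arrow_src_def arrow_tgt_def cw_side_def ccw_side_def white_ends)
  show ?thesis using v b w by (cases rule: inner_cases) auto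
qed

lemma card_dual_arrows:
  "of_nat (card (dual_arrows N \<theta> \<phi>)) =
    (\<Sum>v\<in>inner_verts N. \<Sum>e\<in>incident N v. of_bool (arrow_src v e = \<theta>) * of_bool (arrow_tgt v e = \<phi>) :: rat)"
proof -
  have fin: "finite (incident N v)" if "v \<in> inner_verts N" for v
    using branches(1)[OF that] by simp
  let ?D = "dual_arrows N \<theta> \<phi>"
  have mem: "(v, e) \<in> ?D \<longleftrightarrow>
      v \<in> inner_verts N \<and> e \<in> incident N v \<and> arrow_src v e = \<theta> \<and> arrow_tgt v e = \<phi>" for v e
    using black_white_disjoint[of v]
    by (auto simp: dual_arrows_def arrow_src_def arrow_tgt_def inner_verts_def)
  have sub: "?D \<subseteq> Sigma (inner_verts N) (incident N)"
    using mem by auto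
  have finS: "finite (Sigma (inner_verts N) (incident N))"
    using finite_inner fin by (rule finite_SigmaI)
  have "of_nat (card ?D) = (\<Sum>z\<in>Sigma (inner_verts N) (incident N). of_bool (z \<in> ?D) :: rat)"
    using sub finS by (simp add: sum_of_bool_eq Int_absorb1)
  also have "\<dots> = (\<Sum>v\<in>inner_verts N. \<Sum>e\<in>incident N v. of_bool ((v, e) \<in> ?D))"
    using sum.Sigma[OF finite_inner, of "incident N" "\<lambda>v e. of_bool ((v, e) \<in> ?D) :: rat"] fin by simp
  also have "\<dots> = (\<Sum>v\<in>inner_verts N. \<Sum>e\<in>incident N v.
      of_bool (arrow_src v e = \<theta>) * of_bool (arrow_tgt v e = \<phi>))"
    unfolding mem by (intro sum.cong refl) (simp add: of_bool_conj)
  finally show ?thesis .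
qed

lemma sum_dirac:
  fixes g :: "'x \<Rightarrow> 'y \<Rightarrow> rat"
  assumes "finite A" "finite B" "s \<in> A" "t \<in> B"
  shows "(\<Sum>x\<in>A. \<Sum>y\<in>B. g x y * (of_bool (s = x) * of_bool (t = y))) = g s t"
proof -
  have "(\<Sum>x\<in>A. \<Sum>y\<in>B. g x y * (of_bool (s = x) * of_bool (t = y)))
      = (\<Sum>x\<in>A. if s = x then (\<Sum>y\<in>B. if t = y then g x y else 0) else 0)"
    by (intro sum.cong refl) (auto intro!: sum.cong)
  then show ?thesis using assms by simp
qed

lemma pre_form_arrows:
  "pre_form N x y = (\<Sum>v\<in>inner_verts N. \<Sum>e\<in>incident N v.
      of_int (Poly_Mapping.lookup x (arrow_src v e)) * of_int (Poly_Mapping.lookup y (arrow_tgt v e))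
    - of_int (Poly_Mapping.lookup x (arrow_tgt v e)) * of_int (Poly_Mapping.lookup y (arrow_src v e))) / 2"
proof -
  let ?g = "\<lambda>\<theta> \<phi>. of_int (Poly_Mapping.lookup x \<theta>) * of_int (Poly_Mapping.lookup y \<phi>) :: rat"
  let ?c = "\<lambda>\<theta> \<phi>. of_nat (card (dual_arrows N \<theta> \<phi>)) :: rat"
  have arrow_faces: "arrow_src v e \<in> faces N" "arrow_tgt v e \<in> faces N" if "e \<in> incident N v" for v e
    using face_of_in_faces[OF that] by (auto simp: arrow_src_def arrow_tgt_def cw_side_def ccw_side_def)
  have move: "(\<Sum>\<theta>\<in>faces N. \<Sum>\<phi>\<in>faces N. ?g \<theta> \<phi> * (\<Sum>v\<in>inner_verts N. \<Sum>e\<in>incident N v.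
        of_bool (s v e = \<theta>) * of_bool (t v e = \<phi>)))
      = (\<Sum>v\<in>inner_verts N. \<Sum>e\<in>incident N v. ?g (s v e) (t v e))"
    if "\<And>v e. e \<in> incident N v \<Longrightarrow> s v e \<in> faces N" "\<And>v e. e \<in> incident N v \<Longrightarrow> t v e \<in> faces N"
    for s t :: "'v \<Rightarrow> 'e \<Rightarrow> ('e \<times> side) set"
  proof -
    have "(\<Sum>\<theta>\<in>faces N. \<Sum>\<phi>\<in>faces N. ?g \<theta> \<phi> * (\<Sum>v\<in>inner_verts N. \<Sum>e\<in>incident N v.
        of_bool (s v e = \<theta>) * of_bool (t v e = \<phi>)))
      = (\<Sum>\<theta>\<in>faces N. \<Sum>\<phi>\<in>faces N. \<Sum>v\<in>inner_verts N. \<Sum>e\<in>incident N v.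
          ?g \<theta> \<phi> * (of_bool (s v e = \<theta>) * of_bool (t v e = \<phi>)))"
      by (simp only: sum_distrib_left)
    also have "\<dots> = (\<Sum>\<theta>\<in>faces N. \<Sum>v\<in>inner_verts N. \<Sum>\<phi>\<in>faces N. \<Sum>e\<in>incident N v.
          ?g \<theta> \<phi> * (of_bool (s v e = \<theta>) * of_bool (t v e = \<phi>)))"
      by (intro sum.cong refl sum.swap)
    also have "\<dots> = (\<Sum>v\<in>inner_verts N. \<Sum>\<theta>\<in>faces N. \<Sum>\<phi>\<in>faces N. \<Sum>e\<in>incident N v.
          ?g \<theta> \<phi> * (of_bool (s v e = \<theta>) * of_bool (t v e = \<phi>)))"
      by (rule sum.swap)
    also have "\<dots> = (\<Sum>v\<in>inner_verts N. \<Sum>\<theta>\<in>faces N. \<Sum>e\<in>incident N v. \<Sum>\<phi>\<in>faces N.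
          ?g \<theta> \<phi> * (of_bool (s v e = \<theta>) * of_bool (t v e = \<phi>)))"
      by (intro sum.cong refl sum.swap)
    also have "\<dots> = (\<Sum>v\<in>inner_verts N. \<Sum>e\<in>incident N v. \<Sum>\<theta>\<in>faces N. \<Sum>\<phi>\<in>faces N.
          ?g \<theta> \<phi> * (of_bool (s v e = \<theta>) * of_bool (t v e = \<phi>)))"
      by (intro sum.cong refl sum.swap)
    also have "\<dots> = (\<Sum>v\<in>inner_verts N. \<Sum>e\<in>incident N v. ?g (s v e) (t v e))"
      by (intro sum.cong refl sum_dirac finite_faces that)
    finally show ?thesis .
  qed
  have swap: "?c \<phi> \<theta> = (\<Sum>v\<in>inner_verts N. \<Sum>e\<in>incident N v.
      of_bool (arrow_tgt v e = \<theta>) * of_bool (arrow_src v e = \<phi>))" for \<theta> \<phi>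
    unfolding card_dual_arrows by (intro sum.cong refl mult.commute)
  have "pre_form N x y = (\<Sum>\<theta>\<in>faces N. \<Sum>\<phi>\<in>faces N. (?g \<theta> \<phi> * ?c \<theta> \<phi> - ?g \<theta> \<phi> * ?c \<phi> \<theta>) / 2)"
    unfolding pre_form_def face_pairing_def by (simp add: right_diff_distrib)
  also have "\<dots> = ((\<Sum>\<theta>\<in>faces N. \<Sum>\<phi>\<in>faces N. ?g \<theta> \<phi> * ?c \<theta> \<phi>)
      - (\<Sum>\<theta>\<in>faces N. \<Sum>\<phi>\<in>faces N. ?g \<theta> \<phi> * ?c \<phi> \<theta>)) / 2"
    by (simp only: sum_divide_distrib[symmetric] sum_subtractf)
  also have "(\<Sum>\<theta>\<in>faces N. \<Sum>\<phi>\<in>faces N. ?g \<theta> \<phi> * ?c \<theta> \<phi>)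
      = (\<Sum>v\<in>inner_verts N. \<Sum>e\<in>incident N v. ?g (arrow_src v e) (arrow_tgt v e))"
    unfolding card_dual_arrows by (rule move[OF arrow_faces(1,2)])
  also have "(\<Sum>\<theta>\<in>faces N. \<Sum>\<phi>\<in>faces N. ?g \<theta> \<phi> * ?c \<phi> \<theta>)
      = (\<Sum>v\<in>inner_verts N. \<Sum>e\<in>incident N v. ?g (arrow_tgt v e) (arrow_src v e))"
    unfolding swap by (rule move[OF arrow_faces(2,1)])
  finally show ?thesis by (simp only: sum_subtractf)
qed

text \<open>
  The number of vertices at which the first path uses the right and the second one the left branch,
  minus the number of those at which it is the other way round. The set of vertices is a parameter
  because the products are built up vertex by vertex.
\<close>

definition turning :: "'v set \<Rightarrow> 'e list \<Rightarrow> 'e list \<Rightarrow> int" where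
  "turning S p p' = (\<Sum>v\<in>S. of_bool (right_branch v \<in> set p \<and> left_branch v \<in> set p')
     - of_bool (left_branch v \<in> set p \<and> right_branch v \<in> set p'))"

text \<open>
  At one vertex the form is a cyclic sum over the three faces. It does not change if a
  constant is added to one of the vectors, so it depends only on the jumps across the two
  branches, which are 1 or 0 according to whether the path uses the branch; what remains is a
  two by two determinant.
\<close>

lemma pre_form_paths:
  assumes "p \<in> paths" "p' \<in> paths"
  shows "pre_form N (path_vector N p) (path_vector N p') = - of_int (turning (inner_verts N) p p') / 2"
proof -
  let ?x = "\<lambda>\<theta>. of_int (Poly_Mapping.lookup (path_vector N p) \<theta>) :: rat"
  let ?y = "\<lambda>\<theta>. of_int (Poly_Mapping.lookup (path_vector N p') \<theta>) :: rat"
  have "(\<Sum>e\<in>incident N v. ?x (arrow_src v e) * ?y (arrow_tgt v e) - ?x (arrow_tgt v e) * ?y (arrow_src v e))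
      = - of_int (of_bool (right_branch v \<in> set p \<and> left_branch v \<in> set p')
          - of_bool (left_branch v \<in> set p \<and> right_branch v \<in> set p'))"
    if v: "v \<in> inner_verts N" for v
  proof -
    have step: "?x (face_of N (e, Rgt)) = ?x (face_of N (e, Lft)) + of_bool (e \<in> set p)"
      "?y (face_of N (e, Rgt)) = ?y (face_of N (e, Lft)) + of_bool (e \<in> set p')" if "e \<in> arcs (net N)" for e
      using path_vector_step[OF assms(1) that] path_vector_step[OF assms(2) that] by simp_all
    have x: "?x (face_of N (right_branch v, Lft)) = ?x (face_of N (stem v, Lft)) + of_bool (left_branch v \<in> set p)"
      "?x (face_of N (stem v, Rgt)) = ?x (face_of N (right_branch v, Lft)) + of_bool (right_branch v \<in> set p)"
      using step(1)[OF branch_arcs(2)[OF v]] step(1)[OF branch_arcs(3)[OF v]] branch_faces[OF v] by simp_all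
    have y: "?y (face_of N (right_branch v, Lft)) = ?y (face_of N (stem v, Lft)) + of_bool (left_branch v \<in> set p')"
      "?y (face_of N (stem v, Rgt)) = ?y (face_of N (right_branch v, Lft)) + of_bool (right_branch v \<in> set p')"
      using step(2)[OF branch_arcs(2)[OF v]] step(2)[OF branch_arcs(3)[OF v]] branch_faces[OF v] by simp_all
    \<comment> \<open>\<open>m + r\<close>, \<open>m\<close> and \<open>b\<close> are the values on the top, middle and bottom face at the vertex.\<close>
    have alg: "(m + r) * b' - b * (m' + r') + (m * (m' + r') - (m + r) * m') + (b * m' - m * b') = - (r * l' - l * r')"
      if "m = b + l" "m' = b' + l'" for m r b l m' r' b' l' :: rat
      unfolding that by (simp add: algebra_simps)
    show ?thesis
      unfolding branches(1)[OF v] using branches(2-)[OF v]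
        alg[OF x(1) y(1), of "of_bool (right_branch v \<in> set p)" "of_bool (right_branch v \<in> set p')"]
      by (simp add: arrow_sides[OF v] branch_faces[OF v] of_bool_conj x(2) y(2) add.assoc
          del: add_diff_eq diff_add_eq)
  qed
  then show ?thesis
    unfolding pre_form_arrows turning_def by (simp add: sum_negf[symmetric])
qed

section \<open>Moving a cut across the network\<close>

definition walks_to :: "'e \<Rightarrow> nat \<Rightarrow> 'e list set" where
  "walks_to e a = {p. p \<noteq> [] \<and> dg.awalk (source N a) p (head (net N) e) \<and> last p = e}"

lemma finite_walks_to: "finite (walks_to e a)"
  using finite_subset[OF _ finite_walks[of "source N a" "head (net N) e"]] by (auto simp: walks_to_def)

lemma walks_to_snocE:
  assumes "p \<in> walks_to e a"
  obtains q where "p = q @ [e]" "dg.awalk (source N a) q (tail (net N) e)" "e \<in> arcs (net N)"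
proof -
  have p: "p = butlast p @ [e]"
    using assms append_butlast_last_id[of p] by (auto simp: walks_to_def)
  define q where "q = butlast p"
  have q: "p = q @ [e]" unfolding q_def by (rule p)
  moreover have "dg.awalk (source N a) (q @ [e]) (head (net N) e)"
    using assms q by (simp add: walks_to_def)
  ultimately show ?thesis using that[of q] by (auto simp: dg.awalk_Cons_iff)
qed

lemma walks_to_snocI:
  assumes "dg.awalk (source N a) q (tail (net N) e)" "e \<in> arcs (net N)"
  shows "q @ [e] \<in> walks_to e a"
  using dg.awalk_appendI[OF assms(1) dg.arc_implies_awalk[OF assms(2)]] by (simp add: walks_to_def)

lemma walk_last:
  assumes "dg.awalk u q v" "q \<noteq> []"
  shows "last q \<in> arcs (net N)" "head (net N) (last q) = v"
proof -
  obtain r e where q: "q = r @ [e]" using assms(2) by (cases q rule: rev_cases) simp_all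
  then have "dg.awalk (dg.awlast u r) [e] v" using assms(1) by simp
  then show "last q \<in> arcs (net N)" "head (net N) (last q) = v"
    using q by (simp_all add: dg.awalk_Cons_iff dg.awalk_Nil_iff)
qed

lemma walks_to_source_arc:
  assumes a: "a \<in> {1..nsources N}" and b: "b \<in> {1..nsources N}"
  shows "walks_to (source_arc N b) a = (if a = b then {[source_arc N b]} else {})"
proof -
  note arc = source_arc_arc[OF b]
  have only: "p = [source_arc N b] \<and> a = b" if p: "p \<in> walks_to (source_arc N b) a" for p
  proof -
    obtain q where q: "p = q @ [source_arc N b]" "dg.awalk (source N a) q (source N b)"
      using walks_to_snocE[OF p] unfolding arc(2) by blast
    have "q = []"
    proof (rule ccontr)
      assume "q \<noteq> []"
      note l = walk_last[OF q(2) this]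
      then have "last q \<in> in_arcs (net N) (source N b)" by simp
      then show False using source_vertex(2)[OF b] by simp
    qed
    then show ?thesis using q source_inj[OF a b] by (simp add: dg.awalk_Nil_iff)
  qed
  have mem: "[source_arc N b] \<in> walks_to (source_arc N b) b"
    using walks_to_snocI[of b "[]" "source_arc N b"] arc source_vertex(1)[OF b] by (simp add: dg.awalk_Nil_iff)
  show ?thesis
  proof (cases "a = b")
    case True
    then have "walks_to (source_arc N b) a = {[source_arc N b]}" using only mem by blast
    then show ?thesis using True by simp
  next
    case False
    then have "walks_to (source_arc N b) a = {}" using only by blast
    then show ?thesis using False by simp
  qed
qed

lemma walks_to_out_arc:
  assumes v: "v \<in> inner_verts N" and e: "e \<in> out_arcs (net N) v" and a: "a \<in> {1..nsources N}"
  shows "walks_to e a = (\<Union>f\<in>in_arcs (net N) v. (\<lambda>p. p @ [e]) ` walks_to f a)"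
proof (intro equalityI subsetI)
  fix p assume "p \<in> walks_to e a"
  then obtain q where "p = q @ [e]" "dg.awalk (source N a) q (tail (net N) e)"
    by (rule walks_to_snocE)
  then have q: "p = q @ [e]" "dg.awalk (source N a) q v" using e by simp_all
  have "q \<noteq> []" using q(2) source_not_inner[OF a] v by (auto simp: dg.awalk_Nil_iff)
  then have "last q \<in> in_arcs (net N) v" "q \<in> walks_to (last q) a"
    using walk_last[OF q(2)] q(2) by (simp_all add: walks_to_def)
  then show "p \<in> (\<Union>f\<in>in_arcs (net N) v. (\<lambda>p. p @ [e]) ` walks_to f a)" using q(1) by blast
next
  fix p assume "p \<in> (\<Union>f\<in>in_arcs (net N) v. (\<lambda>p. p @ [e]) ` walks_to f a)"
  then obtain f q where f: "f \<in> in_arcs (net N) v" "q \<in> walks_to f a" "p = q @ [e]" by auto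
  then have "dg.awalk (source N a) q (tail (net N) e)" using e by (simp add: walks_to_def)
  then show "p \<in> walks_to e a" using walks_to_snocI[of a q e] e f(3) by simp
qed

text \<open>
  A down-closed set of inner vertices, together with the sources, is the part of the network to
  the right of a curve from the top to the bottom of the rectangle; the arcs of the cut are those that
  cross the curve.
\<close>

definition down_closed :: "'v set \<Rightarrow> bool" where
  "down_closed S \<longleftrightarrow> S \<subseteq> inner_verts N \<and>
     (\<forall>e\<in>arcs (net N). head (net N) e \<in> S \<longrightarrow> tail (net N) e \<in> S \<union> source N ` {1..nsources N})"

definition cut :: "'v set \<Rightarrow> 'e set" where
  "cut S = {e \<in> arcs (net N). tail (net N) e \<in> S \<union> source N ` {1..nsources N} \<and> head (net N) e \<notin> S}"

lemma down_closed_inner: "down_closed (inner_verts N)"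
  unfolding down_closed_def
proof (intro conjI ballI impI subset_refl)
  fix e assume "e \<in> arcs (net N)"
  then show "tail (net N) e \<in> inner_verts N \<union> source N ` {1..nsources N}"
    by (cases rule: tail_cases) auto
qed

lemma down_closed_induct[consumes 1, case_names empty insert]:
  assumes "down_closed S" and base: "P {}"
    and step: "\<And>S v. down_closed S \<Longrightarrow> down_closed (insert v S) \<Longrightarrow> v \<in> inner_verts N \<Longrightarrow> v \<notin> S \<Longrightarrow> P S
      \<Longrightarrow> P (insert v S)"
  shows "P S"
proof -
  have "finite S" using assms(1) finite_subset[OF _ finite_inner] by (auto simp: down_closed_def)
  then show ?thesis using assms(1)
  proof (induction S rule: finite_psubset_induct)
    case (psubset S)
    show ?case
    proof (cases "S = {}")
      case False
      then obtain v where v: "v \<in> S" "\<And>w. (w, v) \<in> (arcs_ends (net N))\<inverse> \<Longrightarrow> w \<notin> S"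
        using wfE_min'[OF wf_arcs_ends_converse, of S] by blast
      have "down_closed (S - {v})"
        unfolding down_closed_def
      proof (intro conjI ballI impI)
        show "S - {v} \<subseteq> inner_verts N" using psubset.prems by (auto simp: down_closed_def)
        fix e assume e: "e \<in> arcs (net N)" "head (net N) e \<in> S - {v}"
        have "tail (net N) e \<noteq> v"
          using v(2)[of "head (net N) e"] arc_in_arcs_ends[OF e(1)] e(2) by auto
        then show "tail (net N) e \<in> S - {v} \<union> source N ` {1..nsources N}"
          using psubset.prems e by (auto simp: down_closed_def)
      qed
      moreover have "insert v (S - {v}) = S" using v(1) by blast
      moreover have "v \<in> inner_verts N" using v(1) psubset.prems by (auto simp: down_closed_def)
      ultimately show ?thesis
        using step[of "S - {v}" v] psubset.IH[of "S - {v}"] psubset.prems v(1) by auto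
    qed (simp add: base)
  qed
qed

text \<open>
  Going back along a path that ends on the cut, down-closedness keeps every earlier vertex behind the
  cut. So a path contains no arc beyond the cut, and its last arc is the only one on the cut.
\<close>

lemma walks_to_cut:
  assumes S: "down_closed S" and e: "e \<in> cut S" and p: "p \<in> walks_to e a" and f: "f \<in> set p"
  shows "tail (net N) f \<in> S \<union> source N ` {1..nsources N}" "f = e \<or> head (net N) f \<in> S"
proof -
  let ?T = "S \<union> source N ` {1..nsources N}"
  have walk: "\<And>s e f. tail (net N) e \<in> ?T \<Longrightarrow> dg.awalk s q (tail (net N) e) \<Longrightarrow> f \<in> set q \<Longrightarrow>
      head (net N) f \<in> S \<and> tail (net N) f \<in> ?T" for q
  proof (induction q rule: rev_induct)
    case (snoc g q)
    have g: "g \<in> arcs (net N)" "head (net N) g = tail (net N) e"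
      using walk_last[OF snoc.prems(2)] by simp_all
    have w: "dg.awalk s q (tail (net N) g)"
      using snoc.prems(2) by (auto simp: dg.awalk_Cons_iff)
    have head: "head (net N) g \<in> S" using snoc.prems(1) g head_not_source[OF g(1)] by auto
    then have tail: "tail (net N) g \<in> ?T"
      using S g(1) by (simp add: down_closed_def)
    show ?case using snoc.IH[OF tail w, of f] snoc.prems(3) head tail by auto
  qed simp
  obtain q where q: "p = q @ [e]" "dg.awalk (source N a) q (tail (net N) e)"
    using p by (rule walks_to_snocE)
  have e_tail: "tail (net N) e \<in> ?T" using e by (simp add: cut_def)
  have "f = e \<or> f \<in> set q" using f q(1) by auto
  then show "tail (net N) f \<in> ?T" "f = e \<or> head (net N) f \<in> S"
    using walk[OF e_tail q(2), of f] e_tail by blast+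
qed

text \<open>
  The product of two measurements at a cut, as a linear functional: \<open>F\<close> stands for any functional on
  the free module over multisets of arcs, and \<open>h powi turning S p p'\<close> for the scalar that is
  produced by multiplying the monomials of the two paths. Quantifying over all \<open>F\<close> replaces the
  construction of a quantum torus on the arcs, and multiplication by the monomial of an arc turns into
  a shift of the argument of \<open>F\<close>.
\<close>

definition pair_sum ::
  "'k::field \<Rightarrow> 'v set \<Rightarrow> ('e multiset \<Rightarrow> 'k) \<Rightarrow> 'e \<Rightarrow> nat \<Rightarrow> 'e \<Rightarrow> nat \<Rightarrow> 'k" where
  "pair_sum h S F e a e' a' =
     (\<Sum>p\<in>walks_to e a. \<Sum>p'\<in>walks_to e' a'. h powi turning S p p' * F (mset p + mset p'))"

text \<open>
  The arcs by which a path to an arc of the new cut crosses the old cut, if \<open>v\<close> is the vertex between the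
  two cuts.
\<close>

definition parents :: "'v \<Rightarrow> 'e \<Rightarrow> 'e set" where
  "parents v e = (if e \<in> out_arcs (net N) v then in_arcs (net N) v else {e})"

definition extension :: "'v \<Rightarrow> 'e \<Rightarrow> 'e list" where
  "extension v e = (if e \<in> out_arcs (net N) v then [e] else [])"

definition turn_at :: "'v \<Rightarrow> 'e set \<Rightarrow> 'e set \<Rightarrow> int" where
  "turn_at v A B = of_bool (right_branch v \<in> A \<and> left_branch v \<in> B)
     - of_bool (left_branch v \<in> A \<and> right_branch v \<in> B)"

lemma turning_insert:
  "finite S \<Longrightarrow> v \<notin> S \<Longrightarrow> turning (insert v S) p p' = turn_at v (set p) (set p') + turning S p p'"
  by (simp add: turning_def turn_at_def)

lemma inj_append: "inj_on (\<lambda>p. p @ x) A"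
  by (auto simp: inj_on_def)

context
  fixes S :: "'v set" and v :: 'v
  assumes S: "down_closed S" "down_closed (insert v S)" and v: "v \<in> inner_verts N" "v \<notin> S"
begin

lemma finite_S: "finite S"
  using S(1) finite_subset[OF _ finite_inner] by (auto simp: down_closed_def)

lemma out_arc_head:
  assumes "e \<in> out_arcs (net N) v" shows "head (net N) e \<notin> insert v S"
proof
  assume h: "head (net N) e \<in> insert v S"
  have e: "e \<in> arcs (net N)" "tail (net N) e = v" using assms by simp_all
  then have "head (net N) e \<in> S" using h tail_neq_head[OF e(1)] by auto
  then have "v \<in> S \<union> source N ` {1..nsources N}" using S(1) e by (auto simp: down_closed_def)
  then show False using v source_not_inner by auto
qed

lemma cut_insert: "cut (insert v S) = (cut S - in_arcs (net N) v) \<union> out_arcs (net N) v"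
proof (intro Set.set_eqI iffI)
  fix e assume "e \<in> cut (insert v S)"
  then show "e \<in> (cut S - in_arcs (net N) v) \<union> out_arcs (net N) v" by (auto simp: cut_def)
next
  fix e assume "e \<in> (cut S - in_arcs (net N) v) \<union> out_arcs (net N) v"
  then show "e \<in> cut (insert v S)" using out_arc_head[of e] by (auto simp: cut_def)
qed

lemma in_arcs_cut: "in_arcs (net N) v \<subseteq> cut S"
proof
  fix e assume "e \<in> in_arcs (net N) v"
  then have e: "e \<in> arcs (net N)" "head (net N) e = v" by simp_all
  then have "tail (net N) e \<in> insert v S \<union> source N ` {1..nsources N}"
    using S(2) by (auto simp: down_closed_def)
  then show "e \<in> cut S" using e v(2) tail_neq_head[OF e(1)] by (auto simp: cut_def)
qed

lemma parents_cut: "e \<in> cut (insert v S) \<Longrightarrow> parents v e \<subseteq> cut S"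
  using in_arcs_cut by (auto simp: parents_def cut_insert)

lemma finite_parents: "finite (parents v e)"
  by (simp add: parents_def in_arcs_def)

lemma walks_to_parents:
  assumes "e \<in> cut (insert v S)" "a \<in> {1..nsources N}"
  shows "walks_to e a = (\<Union>f\<in>parents v e. (\<lambda>p. p @ extension v e) ` walks_to f a)"
  using walks_to_out_arc[OF v(1) _ assms(2), of e] by (simp add: parents_def extension_def)

lemma sum_walks_to_parents:
  assumes "e \<in> cut (insert v S)" "a \<in> {1..nsources N}"
  shows "(\<Sum>p\<in>walks_to e a. g p) = (\<Sum>f\<in>parents v e. \<Sum>p\<in>walks_to f a. g (p @ extension v e))"
proof -
  have "(\<Sum>p\<in>walks_to e a. g p) = (\<Sum>f\<in>parents v e. \<Sum>p\<in>(\<lambda>p. p @ extension v e) ` walks_to f a. g p)"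
    unfolding walks_to_parents[OF assms]
  proof (rule sum.UNION_disjoint)
    show "\<forall>f\<in>parents v e. \<forall>f'\<in>parents v e. f \<noteq> f' \<longrightarrow>
        (\<lambda>p. p @ extension v e) ` walks_to f a \<inter> (\<lambda>p. p @ extension v e) ` walks_to f' a = {}"
      by (auto simp: walks_to_def)
  qed (simp_all add: finite_parents finite_walks_to)
  also have "\<dots> = (\<Sum>f\<in>parents v e. \<Sum>p\<in>walks_to f a. g (p @ extension v e))"
    by (simp add: sum.reindex[OF inj_append])
  finally show ?thesis .
qed

lemma turn_at_parents:
  assumes "e \<in> cut (insert v S)" "f \<in> parents v e" "p \<in> walks_to f a"
  shows "right_branch v \<in> set (p @ extension v e) \<longleftrightarrow> right_branch v \<in> {e, f}"
    and "left_branch v \<in> set (p @ extension v e) \<longleftrightarrow> left_branch v \<in> {e, f}"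
proof -
  have f: "f \<in> cut S" using parents_cut[OF assms(1)] assms(2) by blast
  have "f \<in> set p" using assms(3) by (auto simp: walks_to_def intro: last_in_set)
  note walk = walks_to_cut[OF S(1) f assms(3)]
  have v_source: "v \<notin> S \<union> source N ` {1..nsources N}" using v source_not_inner by auto
  have branch: "x \<in> set (p @ extension v e) \<longleftrightarrow> x \<in> {e, f}"
    if x: "x \<in> in_arcs (net N) v \<or> x \<in> out_arcs (net N) v" for x
  proof (cases "x \<in> in_arcs (net N) v")
    case True
    then have "x \<noteq> e" using assms(1) in_arcs_not_out_arcs[of x v] by (auto simp: cut_insert)
    moreover have "x \<notin> set (extension v e)" using \<open>x \<noteq> e\<close> by (simp add: extension_def)
    moreover have "x \<in> set p \<longleftrightarrow> x = f" using walk(2)[of x] True v(2) \<open>f \<in> set p\<close> by auto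
    ultimately show ?thesis by auto
  next
    case False
    then have out: "x \<in> out_arcs (net N) v" using x by blast
    have "x \<notin> set p" using walk(1)[of x] out v_source by auto
    moreover have "x \<noteq> f" using calculation \<open>f \<in> set p\<close> by blast
    moreover have "x \<in> set (extension v e) \<longleftrightarrow> x = e" using out by (auto simp: extension_def)
    ultimately show ?thesis by auto
  qed
  have "right_branch v \<in> incident N v" "left_branch v \<in> incident N v"
    using branches(1)[OF v(1)] by auto
  then show "right_branch v \<in> set (p @ extension v e) \<longleftrightarrow> right_branch v \<in> {e, f}"
    "left_branch v \<in> set (p @ extension v e) \<longleftrightarrow> left_branch v \<in> {e, f}"
    using branch unfolding incident_def by blast+
qed

lemma turning_extension:
  "turning S (p @ extension v e) (p' @ extension v e') = turning S p p'"
proof -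
  have off: "right_branch u \<notin> set (extension v e)" "left_branch u \<notin> set (extension v e)" if "u \<in> S" for u e
  proof -
    have u: "u \<in> inner_verts N" using that S(1) by (auto simp: down_closed_def)
    have "x \<notin> out_arcs (net N) v" if x: "x \<in> incident N u" for x
      using x out_arc_head[of x] \<open>u \<in> S\<close> v(2) by (auto simp: incident_def)
    then show "right_branch u \<notin> set (extension v e)" "left_branch u \<notin> set (extension v e)"
      using branches(1)[OF u] by (auto simp: extension_def)
  qed
  show ?thesis unfolding turning_def by (intro sum.cong refl) (simp add: off)
qed

text \<open>
  Passing a vertex. A white vertex replaces its stem by two branches, and a black one replaces two
  branches by its stem; in both cases only the turn at this vertex is new, and it can be read off from the
  last two arcs of the paths.
\<close>

lemma pair_sum_insert:
  fixes h :: "'k::field"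
  assumes h: "h \<noteq> 0"
    and e: "e \<in> cut (insert v S)" "e' \<in> cut (insert v S)"
    and a: "a \<in> {1..nsources N}" "a' \<in> {1..nsources N}"
  shows "pair_sum h (insert v S) F e a e' a' =
    (\<Sum>f\<in>parents v e. \<Sum>f'\<in>parents v e'. h powi turn_at v {e, f} {e', f'} *
      pair_sum h S (\<lambda>M. F (M + (mset (extension v e) + mset (extension v e')))) f a f' a')"
proof -
  have summand: "h powi turning (insert v S) (p @ extension v e) (p' @ extension v e')
        * F (mset (p @ extension v e) + mset (p' @ extension v e'))
      = h powi turn_at v {e, f} {e', f'} *
        (h powi turning S p p' * F (mset p + mset p' + (mset (extension v e) + mset (extension v e'))))"
    if f: "f \<in> parents v e" "f' \<in> parents v e'" and p: "p \<in> walks_to f a" "p' \<in> walks_to f' a'" for f f' p p'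
  proof -
    have "turning (insert v S) (p @ extension v e) (p' @ extension v e') = turn_at v {e, f} {e', f'} + turning S p p'"
      unfolding turning_insert[OF finite_S v(2)] turning_extension turn_at_def
        turn_at_parents[OF e(1) f(1) p(1)] turn_at_parents[OF e(2) f(2) p(2)] by simp
    moreover have "mset (p @ extension v e) + mset (p' @ extension v e')
        = mset p + mset p' + (mset (extension v e) + mset (extension v e'))"
      by (simp add: ac_simps)
    ultimately show ?thesis using h by (simp only: power_int_add mult.assoc simp_thms)
  qed
  have "pair_sum h (insert v S) F e a e' a' =
      (\<Sum>f\<in>parents v e. \<Sum>p\<in>walks_to f a. \<Sum>f'\<in>parents v e'. \<Sum>p'\<in>walks_to f' a'.
        h powi turning (insert v S) (p @ extension v e) (p' @ extension v e')
        * F (mset (p @ extension v e) + mset (p' @ extension v e')))"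
    unfolding pair_sum_def sum_walks_to_parents[OF e(1) a(1)] sum_walks_to_parents[OF e(2) a(2)] ..
  also have "\<dots> = (\<Sum>f\<in>parents v e. \<Sum>p\<in>walks_to f a. \<Sum>f'\<in>parents v e'. \<Sum>p'\<in>walks_to f' a'.
        h powi turn_at v {e, f} {e', f'} *
        (h powi turning S p p' * F (mset p + mset p' + (mset (extension v e) + mset (extension v e')))))"
    by (intro sum.cong refl summand)
  also have "\<dots> = (\<Sum>f\<in>parents v e. \<Sum>f'\<in>parents v e'. \<Sum>p\<in>walks_to f a. \<Sum>p'\<in>walks_to f' a'.
        h powi turn_at v {e, f} {e', f'} *
        (h powi turning S p p' * F (mset p + mset p' + (mset (extension v e) + mset (extension v e')))))"
    by (intro sum.cong refl sum.swap)
  finally show ?thesis by (simp only: pair_sum_def sum_distrib_left)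
qed

end

end

section \<open>The exchange relation on every cut\<close>

text \<open>
  Three identities in the field. In all of them \<open>t\<close> is the indicator of \<open>a < a'\<close> for the
  two sources \<open>a\<close>, \<open>a'\<close>, and \<open>d\<close> is \<open>h ^ 2\<close> if they agree and 1 otherwise; a prime
  marks the sum with the sources interchanged. When a stem splits,
  all relations among the two branches reduce to the relation of the stem with itself, since the
  products for the two orders of the branches are \<open>h\<close> and \<open>inverse h\<close> times the same sum.
\<close>

lemma exchange_split_right_left:
  fixes h :: "'k::field"
  assumes "h \<noteq> 0" and rel: "h ^ 2 * y + c * (0 - t) * y = d * y'"
  shows "h * y + c * (0 - t) * (inverse h * y) = d * (inverse h * y')"
proof -
  have "h * y = inverse h * (h ^ 2 * y)" using assms(1) by (simp add: power2_eq_square)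
  then have "h * y + c * (0 - t) * (inverse h * y) = inverse h * (h ^ 2 * y + c * (0 - t) * y)"
    by (simp only: distrib_left mult.left_commute)
  then show ?thesis unfolding rel by (simp only: mult.left_commute)
qed

lemma exchange_split_left_right:
  fixes h :: "'k::field"
  assumes "h \<noteq> 0" and rel: "h ^ 2 * y + (h ^ 2 - inverse (h ^ 2)) * (0 - t) * y = d * y'"
  shows "inverse h * y + (h ^ 2 - inverse (h ^ 2)) * (1 - t) * (h * y) = d * (h * y')"
proof -
  have "inverse h * y + (h ^ 2 - inverse (h ^ 2)) * (1 - t) * (h * y)
      = h * (h ^ 2 * y + (h ^ 2 - inverse (h ^ 2)) * (0 - t) * y)"
    using assms(1) by (simp add: field_simps power2_eq_square)
  then show ?thesis unfolding rel by (simp only: mult.left_commute)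
qed

text \<open>
  When two branches merge, the relation of the stem with itself needs all four relations among the branches.
  The letters say which branch the first and the second path come through.
\<close>

lemma exchange_merge:
  fixes h :: "'k::field"
  assumes "h \<noteq> 0"
    and rr: "h ^ 2 * rr + (h ^ 2 - inverse (h ^ 2)) * (0 - t) * rr = d * rr'"
    and ll: "h ^ 2 * ll + (h ^ 2 - inverse (h ^ 2)) * (0 - t) * ll = d * ll'"
    and rl: "rl + (h ^ 2 - inverse (h ^ 2)) * (0 - t) * lr = d * lr'"
    and lr: "lr + (h ^ 2 - inverse (h ^ 2)) * (1 - t) * rl = d * rl'"
  shows "h ^ 2 * (rr + h * rl + (inverse h * lr + ll))
    + (h ^ 2 - inverse (h ^ 2)) * (0 - t) * (rr + h * rl + (inverse h * lr + ll))
    = d * (rr' + h * rl' + (inverse h * lr' + ll'))"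
proof -
  have "d * (rr' + h * rl' + (inverse h * lr' + ll')) = d * rr' + h * (d * rl') + inverse h * (d * lr') + d * ll'"
    by (simp add: algebra_simps)
  also have "\<dots> = h ^ 2 * (rr + h * rl + (inverse h * lr + ll))
    + (h ^ 2 - inverse (h ^ 2)) * (0 - t) * (rr + h * rl + (inverse h * lr + ll))"
    unfolding rr[symmetric] ll[symmetric] rl[symmetric] lr[symmetric]
    using assms(1) by (simp add: field_simps power2_eq_square)
  finally show ?thesis ..
qed

context acyclic_network
begin

definition separated :: "'v set \<Rightarrow> bool" where
  "separated S \<longleftrightarrow> (\<forall>e\<in>cut S. \<forall>f\<in>cut S. e \<noteq> f \<longrightarrow> higher e f \<or> higher f e)"

lemma parents_not_out: "e \<notin> out_arcs (net N) v \<Longrightarrow> f \<in> parents v e \<Longrightarrow> f = e"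
  by (simp only: parents_def if_False singleton_iff)

lemma separatedD: "separated S \<Longrightarrow> e \<in> cut S \<Longrightarrow> f \<in> cut S \<Longrightarrow> e \<noteq> f \<Longrightarrow> higher e f \<or> higher f e"
  by (simp add: separated_def)

text \<open>
  One entry of the matrix identity, with the sinks replaced by arcs of a cut and their order by \<open>higher\<close>.
  The two terms with coefficient \<open>h ^ 2 - inverse (h ^ 2)\<close>, one from each side of the matrix identity,
  contain the same product and are collected into one.
\<close>

definition exchange :: "'k::field \<Rightarrow> 'v set \<Rightarrow> ('e multiset \<Rightarrow> 'k) \<Rightarrow> 'e \<Rightarrow> nat \<Rightarrow> 'e \<Rightarrow> nat \<Rightarrow> bool" where
  "exchange h S F e a e' a' \<longleftrightarrow>
     (if e = e' then h ^ 2 else 1) * pair_sum h S F e a e' a'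
     + (h ^ 2 - inverse (h ^ 2)) * (of_bool (higher e' e) - of_bool (a < a')) * pair_sum h S F e' a e a'
     = (if a = a' then h ^ 2 else 1) * pair_sum h S F e' a' e a"

text \<open>
  In terms of intervals of heights, \<open>e\<close> lies inside \<open>f\<close>, and \<open>g\<close> is disjoint from \<open>f\<close>.
\<close>

lemma higher_part:
  assumes arcs: "e \<in> arcs (net N)" "f \<in> arcs (net N)" "g \<in> arcs (net N)"
    and within: "height (face_of N (f, Rgt)) \<le> height (face_of N (e, Rgt))"
      "height (face_of N (e, Lft)) \<le> height (face_of N (f, Lft))"
    and sep: "higher f g \<or> higher g f"
  shows "higher e g \<longleftrightarrow> higher f g" "higher g e \<longleftrightarrow> higher g f"
  using within sep height_increases[OF arcs(1)] height_increases[OF arcs(2)] height_increases[OF arcs(3)]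
  by (auto simp: higher_def)

context
  fixes S :: "'v set" and v :: 'v
  assumes S: "down_closed S" "down_closed (insert v S)" and v: "v \<in> inner_verts N" "v \<notin> S"
    and sep: "separated S"
begin

lemma cut_arc: "e \<in> cut T \<Longrightarrow> e \<in> arcs (net N)"
  by (simp add: cut_def)

lemma right_higher_left: "higher (right_branch v) (left_branch v)"
  using branch_faces(2)[OF v(1)] by (simp add: higher_def)

lemma left_not_higher: "\<not> higher (left_branch v) (right_branch v)" "\<not> higher e e" if "e \<in> arcs (net N)"
  using higher_asym(1)[OF branch_arcs(2,3)[OF v(1)] right_higher_left] height_increases[OF that]
  by (auto simp: higher_def)

text \<open>
  The interval of the stem is the union of the intervals of the branches, and these two are
  adjacent. Therefore no third arc of a cut can lie between the branches, and replacing stem by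
  branches or branches by stem does not change the order relative to the other arcs.
\<close>

lemma parents_order:
  assumes e: "e \<in> cut (insert v S)" and g: "g \<in> cut (insert v S)" "g \<notin> out_arcs (net N) v"
    and f: "f \<in> parents v e" and ne: "e \<noteq> g"
  shows "f \<noteq> g" "higher e g \<longleftrightarrow> higher f g" "higher g e \<longleftrightarrow> higher g f" "higher e g \<or> higher g e"
proof -
  have gS: "g \<in> cut S" "g \<notin> in_arcs (net N) v" using g cut_insert[OF S v] by auto
  have arcs: "e \<in> arcs (net N)" "g \<in> arcs (net N)" using e g(1) by (simp_all add: cut_def)
  have "f \<noteq> g \<and> (higher e g \<longleftrightarrow> higher f g) \<and> (higher g e \<longleftrightarrow> higher g f) \<and> (higher e g \<or> higher g e)"
  proof (cases "e \<in> out_arcs (net N) v")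
    case False
    then have "f = e" "e \<in> cut S" using parents_not_out[OF _ f] e cut_insert[OF S v] by auto
    then show ?thesis using ne separatedD[OF sep _ gS(1), of e] by simp
  next
    case True
    have ins: "in_arcs (net N) v \<subseteq> cut S" by (rule in_arcs_cut[OF S v])
    have "f \<in> in_arcs (net N) v" using f True by (simp add: parents_def)
    then have "f \<noteq> g" using gS(2) by blast
    have apart: "higher x g \<or> higher g x" if x: "x \<in> in_arcs (net N) v" for x
    proof (rule separatedD[OF sep _ gS(1)])
      show "x \<in> cut S" using ins x by (rule subsetD)
      show "x \<noteq> g" using gS(2) x by auto
    qed
    from v(1) show ?thesis
    proof (cases rule: inner_cases)
      case white
      have fs: "f = stem v" using \<open>f \<in> in_arcs (net N) v\<close> in_arcs_white[OF white(1)] by simp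
      have "e = right_branch v \<or> e = left_branch v" using True out_arcs_white[OF white(1)] by auto
      moreover have "height (face_of N (stem v, Rgt)) \<le> height (face_of N (x, Rgt)) \<and>
          height (face_of N (x, Lft)) \<le> height (face_of N (stem v, Lft))"
        if "x = right_branch v \<or> x = left_branch v" for x
        using that branch_faces[OF v(1)] height_increases[OF branch_arcs(2)[OF v(1)]]
          height_increases[OF branch_arcs(3)[OF v(1)]] by auto
      ultimately have "height (face_of N (f, Rgt)) \<le> height (face_of N (e, Rgt))"
        "height (face_of N (e, Lft)) \<le> height (face_of N (f, Lft))" unfolding fs by blast+
      note part = higher_part[OF arcs(1) _ arcs(2) this apart]
      have "f \<in> arcs (net N)" using \<open>f \<in> in_arcs (net N) v\<close> by simp
      then show ?thesis using part \<open>f \<in> in_arcs (net N) v\<close> apart \<open>f \<noteq> g\<close> by blast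
    next
      case black
      have es: "e = stem v" using True out_arcs_black[OF black(1)] by simp
      have rl: "higher (right_branch v) g \<or> higher g (right_branch v)" "higher (left_branch v) g \<or> higher g (left_branch v)"
        using apart in_arcs_black[OF black(1)] by simp_all
      have sep_e: "higher e g \<or> higher g e"
        using rl branch_faces[OF v(1)] height_increases[OF arcs(2)] unfolding es higher_def by auto
      have fs: "f = right_branch v \<or> f = left_branch v"
        using \<open>f \<in> in_arcs (net N) v\<close> in_arcs_black[OF black(1)] by simp
      have "height (face_of N (e, Rgt)) \<le> height (face_of N (x, Rgt)) \<and>
          height (face_of N (x, Lft)) \<le> height (face_of N (e, Lft))"
        if "x = right_branch v \<or> x = left_branch v" for x
        using that branch_faces[OF v(1)] height_increases[OF branch_arcs(2)[OF v(1)]]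
          height_increases[OF branch_arcs(3)[OF v(1)]] unfolding es by auto
      then have w: "height (face_of N (e, Rgt)) \<le> height (face_of N (f, Rgt))"
        "height (face_of N (f, Lft)) \<le> height (face_of N (e, Lft))" using fs by blast+
      have "f \<in> arcs (net N)" using \<open>f \<in> in_arcs (net N) v\<close> by simp
      then show ?thesis using higher_part[OF _ arcs w sep_e] sep_e \<open>f \<noteq> g\<close> by blast
    qed
  qed
  then show "f \<noteq> g" "higher e g \<longleftrightarrow> higher f g" "higher g e \<longleftrightarrow> higher g f" "higher e g \<or> higher g e"
    by blast+
qed

lemma separated_insert: "separated (insert v S)"
  unfolding separated_def
proof (intro ballI impI)
  fix e f assume ef: "e \<in> cut (insert v S)" "f \<in> cut (insert v S)" "e \<noteq> f"
  have ne: "parents v x \<noteq> {}" for x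
    using inner_degrees(1)[OF v(1)] by (simp add: parents_def)
  consider "e \<notin> out_arcs (net N) v" | "f \<notin> out_arcs (net N) v"
    | "e \<in> out_arcs (net N) v" "f \<in> out_arcs (net N) v" by blast
  then show "higher e f \<or> higher f e"
  proof cases
    case 1
    then show ?thesis using parents_order(4)[OF ef(2,1) 1 _ ef(3)[symmetric]] ne[of f] by blast
  next
    case 2
    then show ?thesis using parents_order(4)[OF ef(1,2) 2 _ ef(3)] ne[of e] by blast
  next
    case 3
    from v(1) show ?thesis
    proof (cases rule: inner_cases)
      case black
      then show ?thesis using 3 ef(3) out_arcs_black[OF black(1)] by simp
    next
      case white
      then show ?thesis using 3 ef(3) out_arcs_white[OF white(1)] right_higher_left by auto
    qed
  qed
qed

context
  fixes h :: "'k::field" and a a' :: nat and F :: "'e multiset \<Rightarrow> 'k"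
  assumes h: "h \<noteq> 0" and a: "a \<in> {1..nsources N}" "a' \<in> {1..nsources N}"
    and ex: "\<And>e e' F. e \<in> cut S \<Longrightarrow> e' \<in> cut S \<Longrightarrow> exchange h S F e a e' a'"
begin

text \<open>
  If one of two different arcs does not start at the new vertex, no new turn occurs, and the relation is a
  sum of relations of the old cut.
\<close>

lemma exchange_insert_separate:
  assumes e: "e \<in> cut (insert v S)" "e' \<in> cut (insert v S)" "e \<noteq> e'"
    and one: "e \<notin> out_arcs (net N) v \<or> e' \<notin> out_arcs (net N) v"
  shows "exchange h (insert v S) F e a e' a'"
proof -
  let ?G = "\<lambda>M. F (M + (mset (extension v e) + mset (extension v e')))"
  have G: "?G = (\<lambda>M. F (M + (mset (extension v e') + mset (extension v e))))"
    by (simp add: add.commute)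
  let ?c = "h ^ 2 - inverse (h ^ 2)"
  have no_turn: "turn_at v {e, f} {e', f'} = 0" "turn_at v {e', f'} {e, f} = 0"
    if "f \<in> parents v e" "f' \<in> parents v e'" for f f'
  proof -
    have "x \<notin> {right_branch v, left_branch v}" if "x \<in> cut (insert v S)" "x \<notin> out_arcs (net N) v" for x
    proof -
      have "x \<notin> incident N v" using that cut_insert[OF S v] by (auto simp: incident_def)
      then show ?thesis using branches(1)[OF v(1)] by auto
    qed
    note off = this
    have "{e, f} \<inter> {right_branch v, left_branch v} = {} \<or> {e', f'} \<inter> {right_branch v, left_branch v} = {}"
      using one
    proof
      assume 1: "e \<notin> out_arcs (net N) v"
      then have "f = e" using parents_not_out that(1) by blast
      then show ?thesis using off[OF e(1) 1] by simp
    next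
      assume 1: "e' \<notin> out_arcs (net N) v"
      then have "f' = e'" using parents_not_out that(2) by blast
      then show ?thesis using off[OF e(2) 1] by simp
    qed
    then show "turn_at v {e, f} {e', f'} = 0" "turn_at v {e', f'} {e, f} = 0"
      unfolding turn_at_def by auto
  qed
  have order: "f \<noteq> f'" "higher f' f \<longleftrightarrow> higher e' e" if f: "f \<in> parents v e" "f' \<in> parents v e'" for f f'
  proof -
    have "f \<noteq> f' \<and> (higher f' f \<longleftrightarrow> higher e' e)"
      using one
    proof
      assume 1: "e \<notin> out_arcs (net N) v"
      then have "f = e" using parents_not_out f(1) by blast
      then show ?thesis using parents_order[OF e(2,1) 1 f(2) e(3)[symmetric]] by auto
    next
      assume 1: "e' \<notin> out_arcs (net N) v"
      then have "f' = e'" using parents_not_out f(2) by blast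
      then show ?thesis using parents_order[OF e(1,2) 1 f(1) e(3)] by auto
    qed
    then show "f \<noteq> f'" "higher f' f \<longleftrightarrow> higher e' e" by blast+
  qed
  have sum: "pair_sum h (insert v S) F e b e' b' = (\<Sum>f\<in>parents v e. \<Sum>f'\<in>parents v e'. pair_sum h S ?G f b f' b')"
    if "b \<in> {1..nsources N}" "b' \<in> {1..nsources N}" for b b'
    unfolding pair_sum_insert[OF S v h e(1,2) that] using no_turn(1) by (intro sum.cong refl) simp
  have sum': "pair_sum h (insert v S) F e' b e b' = (\<Sum>f\<in>parents v e. \<Sum>f'\<in>parents v e'. pair_sum h S ?G f' b f b')"
    if "b \<in> {1..nsources N}" "b' \<in> {1..nsources N}" for b b'
    unfolding pair_sum_insert[OF S v h e(2,1) that] G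
    by (subst sum.swap) (intro sum.cong refl, simp add: no_turn(2))
  have "pair_sum h S ?G f a f' a' + ?c * (of_bool (higher e' e) - of_bool (a < a')) * pair_sum h S ?G f' a f a'
      = (if a = a' then h ^ 2 else 1) * pair_sum h S ?G f' a' f a"
    if f: "f \<in> parents v e" "f' \<in> parents v e'" for f f'
  proof -
    have "f \<in> cut S" "f' \<in> cut S" using f parents_cut[OF S v e(1)] parents_cut[OF S v e(2)] by auto
    then have "exchange h S ?G f a f' a'" by (rule ex)
    then show ?thesis using order[OF f] by (simp add: exchange_def)
  qed
  then have "(\<Sum>f\<in>parents v e. \<Sum>f'\<in>parents v e'. pair_sum h S ?G f a f' a'
        + ?c * (of_bool (higher e' e) - of_bool (a < a')) * pair_sum h S ?G f' a f a')
      = (\<Sum>f\<in>parents v e. \<Sum>f'\<in>parents v e'. (if a = a' then h ^ 2 else 1) * pair_sum h S ?G f' a' f a)"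
    by (intro sum.cong refl)
  then show ?thesis
    unfolding exchange_def sum[OF a] sum'[OF a] sum'[OF a(2,1)] sum_distrib_left
    using e(3) by (simp only: sum.distrib if_False mult_1_left)
qed

text \<open>
  The remaining entries have the same arc twice or both arcs at the new vertex. At a white vertex they all come from the
  relation of the stem with itself, at a black vertex from the four relations among the branches.
\<close>

lemma exchange_insert:
  assumes e: "e \<in> cut (insert v S)" "e' \<in> cut (insert v S)"
  shows "exchange h (insert v S) F e a e' a'"
proof -
  let ?r = "right_branch v" and ?l = "left_branch v" and ?s = "stem v"
  note b = branches(2-)[OF v(1)]
  consider "e \<noteq> e'" "e \<notin> out_arcs (net N) v \<or> e' \<notin> out_arcs (net N) v"
    | "e = e'" "e \<notin> out_arcs (net N) v"
    | "e \<in> out_arcs (net N) v" "e' \<in> out_arcs (net N) v" by blast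
  then show ?thesis
  proof cases
    case 1
    then show ?thesis using exchange_insert_separate[OF e] by blast
  next
    case 2
    have "e \<notin> incident N v" using e(1) 2 cut_insert[OF S v] by (auto simp: incident_def)
    then have t: "turn_at v {e, e} {e, e} = 0" using branches(1)[OF v(1)] by (auto simp: turn_at_def)
    have "e \<in> cut S" using e(1) 2 cut_insert[OF S v] by auto
    then have rel: "exchange h S F e a e a'" using ex by blast
    have par: "parents v e = {e}" "extension v e = []"
      by (simp_all only: parents_def extension_def 2(2) if_False)
    have "pair_sum h (insert v S) F e i e j = pair_sum h S F e i e j"
      if "i \<in> {1..nsources N}" "j \<in> {1..nsources N}" for i j
      unfolding pair_sum_insert[OF S v h e(1) e(1) that] par using t by simp
    then show ?thesis using rel a unfolding 2(1)[symmetric] exchange_def by simp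
  next
    case 3
    let ?G = "\<lambda>M. F (M + ({#e#} + {#e'#}))"
    have G: "?G = (\<lambda>M. F (M + ({#e'#} + {#e#})))" by (simp add: add.commute)
    from v(1) show ?thesis
    proof (cases rule: inner_cases)
      case white
      have s: "?s \<in> cut S" using in_arcs_cut[OF S v] in_arcs_white[OF white(1)] by auto
      have P: "pair_sum h (insert v S) F x i y j = h powi turn_at v {x, ?s} {y, ?s} *
          pair_sum h S (\<lambda>M. F (M + ({#x#} + {#y#}))) ?s i ?s j"
        if "x \<in> {e, e'}" "y \<in> {e, e'}" "i \<in> {a, a'}" "j \<in> {a, a'}" for x y i j
      proof -
        have xy: "x \<in> cut (insert v S)" "y \<in> cut (insert v S)" "x \<in> out_arcs (net N) v" "y \<in> out_arcs (net N) v"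
          using that e 3 by auto
        have ij: "i \<in> {1..nsources N}" "j \<in> {1..nsources N}" using that a by auto
        show ?thesis
          unfolding pair_sum_insert[OF S v h xy(1,2) ij] using xy(3,4) in_arcs_white[OF white(1)]
          by (simp only: parents_def extension_def if_True) simp
      qed
      have rel: "h ^ 2 * pair_sum h S ?G ?s a ?s a'
          + (h ^ 2 - inverse (h ^ 2)) * (0 - of_bool (a < a')) * pair_sum h S ?G ?s a ?s a'
          = (if a = a' then h ^ 2 else 1) * pair_sum h S ?G ?s a' ?s a"
        using ex[OF s s, of ?G] left_not_higher(2)[OF branch_arcs(1)[OF v(1)]] by (simp add: exchange_def)
      have turns: "turn_at v {?r, ?s} {?r, ?s} = 0" "turn_at v {?l, ?s} {?l, ?s} = 0"
        "turn_at v {?r, ?s} {?l, ?s} = 1" "turn_at v {?l, ?s} {?r, ?s} = -1"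
        using b by (auto simp: turn_at_def)
      have pow: "h powi 1 = h" "h powi - 1 = inverse h" "h powi 0 = 1"
        by (simp_all add: power_int_minus)
      have "e \<in> {?r, ?l}" "e' \<in> {?r, ?l}" using 3 out_arcs_white[OF white(1)] by auto
      then consider "e = e'" | "e = ?r" "e' = ?l" | "e = ?l" "e' = ?r" by auto
      then show ?thesis
      proof cases
        case 1
        have "turn_at v {e, ?s} {e, ?s} = 0" using turns(1,2) \<open>e \<in> {?r, ?l}\<close> by auto
        then show ?thesis
          using rel 1 left_not_higher(2)[OF cut_arc[OF e(1)]] by (simp add: exchange_def P pow)
      next
        case 2
        show ?thesis
          using exchange_split_right_left[OF h rel] 2 left_not_higher(1)[OF cut_arc[OF e(1)]] b turns G
          by (simp add: exchange_def P pow)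
      next
        case 3
        show ?thesis
          using exchange_split_left_right[OF h rel] 3 right_higher_left b turns G
          by (simp add: exchange_def P pow)
      qed
    next
      case black
      have ee: "e = ?s" "e' = ?s" using 3 out_arcs_black[OF black(1)] by auto
      have rl: "?r \<in> cut S" "?l \<in> cut S" using in_arcs_cut[OF S v] in_arcs_black[OF black(1)] by auto
      let ?H = "\<lambda>M. F (M + ({#?s#} + {#?s#}))"
      have turns: "turn_at v {?s, ?r} {?s, ?r} = 0" "turn_at v {?s, ?l} {?s, ?l} = 0"
        "turn_at v {?s, ?r} {?s, ?l} = 1" "turn_at v {?s, ?l} {?s, ?r} = -1"
        using b by (auto simp: turn_at_def)
      have pow: "h powi 1 = h" "h powi - 1 = inverse h" "h powi 0 = 1"
        by (simp_all add: power_int_minus)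
      have P: "pair_sum h (insert v S) F ?s i ?s j = pair_sum h S ?H ?r i ?r j + h * pair_sum h S ?H ?r i ?l j
          + (inverse h * pair_sum h S ?H ?l i ?r j + pair_sum h S ?H ?l i ?l j)"
        if "i \<in> {a, a'}" "j \<in> {a, a'}" for i j
      proof -
        have s: "?s \<in> cut (insert v S)" "?s \<in> out_arcs (net N) v" using e 3 ee by auto
        have ij: "i \<in> {1..nsources N}" "j \<in> {1..nsources N}" using that a by auto
        have par: "parents v ?s = {?r, ?l}" "extension v ?s = [?s]"
          using s(2) in_arcs_black[OF black(1)] by (simp_all add: parents_def extension_def)
        show ?thesis
          unfolding pair_sum_insert[OF S v h s(1) s(1) ij] par using b turns pow by simp
      qed
      note nh = left_not_higher(2)[OF branch_arcs(1)[OF v(1)]] left_not_higher(2)[OF branch_arcs(2)[OF v(1)]]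
        left_not_higher(2)[OF branch_arcs(3)[OF v(1)]] left_not_higher(1)[OF branch_arcs(1)[OF v(1)]] right_higher_left
      have "h ^ 2 * pair_sum h (insert v S) F ?s a ?s a'
          + (h ^ 2 - inverse (h ^ 2)) * (0 - of_bool (a < a')) * pair_sum h (insert v S) F ?s a ?s a'
          = (if a = a' then h ^ 2 else 1) * pair_sum h (insert v S) F ?s a' ?s a"
        unfolding P[OF insertI1 insertI2[OF insertI1]] P[OF insertI2[OF insertI1] insertI1]
        using ex[OF rl(1) rl(1), of ?H] ex[OF rl(2) rl(2), of ?H] ex[OF rl(1) rl(2), of ?H] ex[OF rl(2) rl(1), of ?H] nh b
        by (intro exchange_merge[OF h]) (simp_all add: exchange_def)
      then show ?thesis using nh ee by (simp add: exchange_def)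
    qed
  qed
qed

end

end

lemma cut_empty:
  assumes "x \<in> cut {}"
  obtains i where "i \<in> {1..nsources N}" "x = source_arc N i"
proof -
  have x: "x \<in> arcs (net N)" "tail (net N) x \<in> source N ` {1..nsources N}" using assms by (auto simp: cut_def)
  from x(1) show ?thesis
  proof (cases rule: tail_cases)
    case 1
    then show ?thesis using x(2) source_not_inner by auto
  next
    case (2 i)
    then show ?thesis by (intro that)
  qed
qed

lemma exchange_sources:
  assumes e: "e \<in> cut {}" "e' \<in> cut {}" and a: "a \<in> {1..nsources N}" "a' \<in> {1..nsources N}"
  shows "exchange h {} F e a e' a'"
proof -
  obtain i k where ik: "i \<in> {1..nsources N}" "k \<in> {1..nsources N}" "e = source_arc N i" "e' = source_arc N k"
    using cut_empty[OF e(1)] cut_empty[OF e(2)] by metis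
  have eq: "source_arc N i = source_arc N k \<longleftrightarrow> i = k"
    using source_arc_arc(2)[OF ik(1)] source_arc_arc(2)[OF ik(2)] source_inj[OF ik(1,2)] by auto
  have hi: "higher (source_arc N k) (source_arc N i) \<longleftrightarrow> k < i"
    using source_higher[OF ik(2,1)] source_higher[OF ik(1,2)]
      higher_asym[OF source_arc_arc(1)[OF ik(1)] source_arc_arc(1)[OF ik(2)]]
      higher_asym[OF source_arc_arc(1)[OF ik(2)] source_arc_arc(1)[OF ik(1)]] eq
    by (metis linorder_neqE_nat)
  have P: "pair_sum h {} F (source_arc N x) y (source_arc N x') y' =
      of_bool (y = x \<and> y' = x') * F ({#source_arc N x#} + {#source_arc N x'#})"
    if "x \<in> {1..nsources N}" "x' \<in> {1..nsources N}" "y \<in> {1..nsources N}" "y' \<in> {1..nsources N}" for x x' y y'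
    unfolding pair_sum_def walks_to_source_arc[OF that(3,1)] walks_to_source_arc[OF that(4,2)]
    by (simp add: turning_def add_mset_commute)
  show ?thesis
    unfolding exchange_def ik(3,4) eq hi P[OF ik(1,2) a] P[OF ik(2,1) a] P[OF ik(2,1) a(2,1)]
    by (auto simp: add.commute)
qed

lemma separated_sources: "separated {}"
  unfolding separated_def
proof (intro ballI impI)
  fix e f assume ef: "e \<in> cut {}" "f \<in> cut {}" "e \<noteq> f"
  obtain i k where ik: "i \<in> {1..nsources N}" "k \<in> {1..nsources N}" "e = source_arc N i" "f = source_arc N k"
    using cut_empty[OF ef(1)] cut_empty[OF ef(2)] by metis
  then have "i \<noteq> k" using ef(3) by auto
  then have "i < k \<or> k < i" by linarith
  then show "higher e f \<or> higher f e"
    using source_higher[OF ik(1,2)] source_higher[OF ik(2,1)] unfolding ik(3,4) by blast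
qed

lemma exchange_cut:
  fixes h :: "'k::field"
  assumes "down_closed S" and h: "h \<noteq> 0"
  shows "separated S \<and> (\<forall>e\<in>cut S. \<forall>e'\<in>cut S. \<forall>a\<in>{1..nsources N}. \<forall>a'\<in>{1..nsources N}. \<forall>F.
    exchange h S F e a e' a')"
  using assms(1)
proof (induction S rule: down_closed_induct)
  case empty
  show ?case using separated_sources exchange_sources by blast
next
  case (insert S v)
  have sep: "separated S" using insert.IH by blast
  show ?case
  proof (intro conjI ballI allI)
    show "separated (insert v S)" by (rule separated_insert[OF insert.hyps sep])
    fix e e' a a' F
    assume e: "e \<in> cut (insert v S)" "e' \<in> cut (insert v S)" and a: "a \<in> {1..nsources N}" "a' \<in> {1..nsources N}"
    show "exchange h (insert v S) F e a e' a'"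
    proof (rule exchange_insert[OF insert.hyps sep h a _ e])
      show "exchange h S F e a e' a'" if "e \<in> cut S" "e' \<in> cut S" for e e' F
        using insert.IH that a by blast
    qed
  qed
qed

section \<open>Products of boundary measurements\<close>

lemma sink_arc_cut:
  assumes b: "b \<in> {1..nsinks N}"
  shows "sink_arc N b \<in> cut (inner_verts N)"
proof -
  note arc = sink_arc_arc[OF b]
  from arc(1) have "tail (net N) (sink_arc N b) \<in> inner_verts N \<union> source N ` {1..nsources N}"
    by (cases rule: tail_cases) auto
  then show ?thesis using arc sink_not_inner[OF b] by (simp add: cut_def)
qed

lemma walks_to_sink_arc:
  assumes a: "a \<in> {1..nsources N}" and b: "b \<in> {1..nsinks N}"
  shows "walks_to (sink_arc N b) a = {p. dg.apath (source N a) p (sink N b)}"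
proof (intro Set.set_eqI iffI)
  fix p assume "p \<in> walks_to (sink_arc N b) a"
  then show "p \<in> {p. dg.apath (source N a) p (sink N b)}"
    using sink_arc_arc(2)[OF b] by (simp add: walks_to_def apath_iff_awalk)
next
  fix p assume "p \<in> {p. dg.apath (source N a) p (sink N b)}"
  then have p: "dg.awalk (source N a) p (sink N b)" by (simp add: apath_iff_awalk)
  have ne: "p \<noteq> []" using p source_neq_sink[OF a b] by (auto simp: dg.awalk_Nil_iff)
  have "last p \<in> in_arcs (net N) (sink N b)" using walk_last[OF p ne] by simp
  then have "last p = sink_arc N b" using sink_vertex(3)[OF b] by simp
  then show "p \<in> walks_to (sink_arc N b) a"
    using p ne sink_arc_arc(2)[OF b] by (simp add: walks_to_def)
qed

lemma walks_to_sink_paths: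
  assumes "a \<in> {1..nsources N}" "b \<in> {1..nsinks N}" "p \<in> walks_to (sink_arc N b) a"
  shows "p \<in> paths"
  using assms(3) walks_to_sink_arc[OF assms(1,2)] pathsI[OF assms(1,2)] by (simp add: apath_iff_awalk)

lemma count_path:
  assumes "p \<in> paths"
  shows "int (count (mset p) e) = of_bool (e \<in> set p)"
proof -
  obtain a b where "dg.awalk (source N a) p (sink N b)"
    using assms by (rule pathsE)
  then have "distinct p"
    using walk_verts_distinct walk_verts_tails by (fastforce simp: distinct_map)
  then show ?thesis by (simp add: distinct_count_atmost_1)
qed

text \<open>
  The difference of the two sums does not change across any arc, because the jumps of a path
  vector record which arcs the path uses. So it is constant on faces, and it vanishes at the
  bottom face. Hence even before passing to the quotient lattice the product of two path
  weights is a scalar times a monomial that depends only on the multiset of arcs used.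
\<close>

lemma path_vectors_determined:
  assumes p: "p \<in> paths" "p' \<in> paths" "r \<in> paths" "r' \<in> paths"
    and eq: "mset p + mset p' = mset r + mset r'"
  shows "path_vector N p + path_vector N p' = path_vector N r + path_vector N r'"
proof (rule poly_mapping_eqI)
  fix \<theta>
  let ?v = "\<lambda>p \<theta>. Poly_Mapping.lookup (path_vector N p) \<theta>"
  let ?f = "\<lambda>\<theta>. ?v p \<theta> + ?v p' \<theta> - ?v r \<theta> - ?v r' \<theta>"
  have "?f \<theta> = 0"
  proof (cases "\<theta> \<in> faces N")
    case True
    have "?f (face_of N (e, Lft)) = ?f (face_of N (e, Rgt))" if e: "e \<in> arcs (net N)" for e
    proof -
      have "int (count (mset p + mset p') e) = int (count (mset r + mset r') e)" by (simp only: eq)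
      then have "of_bool (e \<in> set p) + of_bool (e \<in> set p') = (of_bool (e \<in> set r) + of_bool (e \<in> set r') :: int)"
        using count_path[OF p(1), of e] count_path[OF p(2), of e] count_path[OF p(3), of e] count_path[OF p(4), of e]
        by simp
      then show ?thesis
        using path_vector_step[OF p(1) e] path_vector_step[OF p(2) e] path_vector_step[OF p(3) e]
          path_vector_step[OF p(4) e] by linarith
    qed
    then have "?f \<theta> = ?f (face_of N (sink_arc N (nsinks N), Lft))"
      using True by (rule face_function_const)
    then show ?thesis
      using path_vector_bottom[OF p(1)] path_vector_bottom[OF p(2)] path_vector_bottom[OF p(3)]
        path_vector_bottom[OF p(4)] by simp
  next
    case False
    have "?v s \<theta> = 0" if "s \<in> paths" for s
      using False keys_path_vector[OF that] by (meson in_keys_iff subsetD)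
    then show ?thesis using p by simp
  qed
  then show "Poly_Mapping.lookup (path_vector N p + path_vector N p') \<theta>
      = Poly_Mapping.lookup (path_vector N r + path_vector N r') \<theta>"
    by (simp add: lookup_add)
qed

lemma comm_group_pre_lattice: "comm_group (pre_lattice N)"
  by (simp add: pre_lattice_def abelian_free_Abelian_group)

lemma path_vector_carrier: "p \<in> paths \<Longrightarrow> path_vector N p \<in> carrier (pre_lattice N)"
  using keys_path_vector by (simp add: pre_lattice_def)

lemma face_relation_normal: "face_relation N \<lhd> pre_lattice N"
proof -
  interpret G: comm_group "pre_lattice N" by (rule comm_group_pre_lattice)
  have "all_faces N \<in> carrier (pre_lattice N)"
    unfolding all_faces_def pre_lattice_def using finite_faces by (intro sum_closed_free_Abelian_group) auto
  then have "subgroup (face_relation N) (pre_lattice N)"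
    unfolding face_relation_def by (intro G.generate_is_subgroup) simp
  then show ?thesis by (rule G.subgroup_imp_normal)
qed

lemma face_class_mult:
  assumes "x \<in> carrier (pre_lattice N)" "y \<in> carrier (pre_lattice N)"
  shows "face_class N x \<otimes>\<^bsub>face_lattice N\<^esub> face_class N y = face_class N (x + y)"
proof -
  interpret H: normal "face_relation N" "pre_lattice N" by (rule face_relation_normal)
  show ?thesis
    using H.rcos_sum[OF assms] by (simp add: face_lattice_def face_class_def FactGroup_def pre_lattice_def)
qed

lemma zero_carrier: "0 \<in> carrier (pre_lattice N)"
  by (simp add: pre_lattice_def)

lemma face_lattice_one: "\<one>\<^bsub>face_lattice N\<^esub> = face_class N 0"
proof -
  interpret H: normal "face_relation N" "pre_lattice N" by (rule face_relation_normal)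
  have "face_relation N #>\<^bsub>pre_lattice N\<^esub> \<one>\<^bsub>pre_lattice N\<^esub> = face_relation N"
    by (rule H.coset_mult_one[OF H.subset])
  then show ?thesis by (simp add: face_lattice_def face_class_def FactGroup_def pre_lattice_def)
qed

lemma lookup_smult: "Poly_Mapping.lookup (torus_smult c X) \<alpha> = c * Poly_Mapping.lookup X \<alpha>"
  by (simp add: torus_smult_def Poly_Mapping.map.rep_eq when_def)

text \<open>
  The keys of a sum can be fewer than those of the summands, so bilinearity is proved for sums over
  fixed finite sets that contain all keys involved.
\<close>

lemma torus_mult_supersets:
  assumes "finite A" "Poly_Mapping.keys X \<subseteq> A" "finite B" "Poly_Mapping.keys Y \<subseteq> B"
  shows "torus_mult N h X Y = (\<Sum>\<alpha>\<in>A. \<Sum>\<beta>\<in>B.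
     torus_smult (Poly_Mapping.lookup X \<alpha> * Poly_Mapping.lookup Y \<beta> * half_pow h (- lattice_form N \<alpha> \<beta>))
       (torus_basis (\<alpha> \<otimes>\<^bsub>face_lattice N\<^esub> \<beta>)))"
proof -
  have zero: "torus_smult 0 Z = 0" for Z
    by (rule poly_mapping_eqI) (simp add: lookup_smult)
  show ?thesis
    unfolding torus_mult_def
    using assms by (intro sum.mono_neutral_cong_left) (auto simp: in_keys_iff zero intro!: sum.mono_neutral_left sum.neutral)
qed

lemma torus_mult_add_left: "torus_mult N h (X + X') Y = torus_mult N h X Y + torus_mult N h X' Y"
proof -
  let ?K = "Poly_Mapping.keys X \<union> Poly_Mapping.keys X'"
  have add: "torus_smult (a + b) Z = torus_smult a Z + torus_smult b Z" for a b Z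
    by (rule poly_mapping_eqI) (simp add: lookup_smult lookup_add algebra_simps)
  show ?thesis
    using Poly_Mapping.keys_add[of X X']
    by (simp add: torus_mult_supersets[of ?K _ "Poly_Mapping.keys Y"] lookup_add distrib_right add sum.distrib)
qed

lemma torus_mult_add_right: "torus_mult N h X (Y + Y') = torus_mult N h X Y + torus_mult N h X Y'"
proof -
  let ?K = "Poly_Mapping.keys Y \<union> Poly_Mapping.keys Y'"
  have add: "torus_smult (a + b) Z = torus_smult a Z + torus_smult b Z" for a b Z
    by (rule poly_mapping_eqI) (simp add: lookup_smult lookup_add algebra_simps)
  show ?thesis
    using Poly_Mapping.keys_add[of Y Y']
    by (simp add: torus_mult_supersets[of "Poly_Mapping.keys X" _ ?K] lookup_add distrib_right distrib_left add sum.distrib)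
qed

lemma torus_mult_zero: "torus_mult N h 0 Y = 0" "torus_mult N h X 0 = 0"
  by (simp_all add: torus_mult_def)

lemma torus_mult_sum_left: "torus_mult N h (\<Sum>i\<in>I. f i) Y = (\<Sum>i\<in>I. torus_mult N h (f i) Y)"
  by (induction I rule: infinite_finite_induct) (simp_all add: torus_mult_zero torus_mult_add_left)

lemma torus_mult_sum_right: "torus_mult N h X (\<Sum>i\<in>I. f i) = (\<Sum>i\<in>I. torus_mult N h X (f i))"
  by (induction I rule: infinite_finite_induct) (simp_all add: torus_mult_zero torus_mult_add_right)

lemma keys_smult_basis: "Poly_Mapping.keys (torus_smult c (torus_basis \<gamma>)) \<subseteq> {\<gamma>}"
  by (auto simp: in_keys_iff lookup_smult torus_basis_def lookup_single when_def split: if_splits)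

lemma torus_mult_basis:
  "torus_mult N h (torus_smult c (torus_basis \<alpha>)) (torus_smult d (torus_basis \<beta>)) =
    torus_smult (c * d * half_pow h (- lattice_form N \<alpha> \<beta>)) (torus_basis (\<alpha> \<otimes>\<^bsub>face_lattice N\<^esub> \<beta>))"
  by (simp add: torus_mult_supersets[OF _ keys_smult_basis _ keys_smult_basis] lookup_smult)
    (simp add: torus_basis_def)

lemma torus_smult_one: "torus_smult 1 X = X"
  by (rule poly_mapping_eqI) (simp add: lookup_smult)

text \<open>
  The type of torus elements allows arbitrary sets of vectors as exponents; constants act as scalars
  only on elements whose exponents belong to the lattice.
\<close>

definition in_torus :: "('e, 'k::field) torus \<Rightarrow> bool" where
  "in_torus X \<longleftrightarrow> Poly_Mapping.keys X \<subseteq> face_class N ` carrier (pre_lattice N)"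

lemma lattice_form_zero:
  "lattice_form N (face_class N 0) (face_class N x) = 0" "lattice_form N (face_class N x) (face_class N 0) = 0"
  unfolding lattice_form_class by (simp_all add: pre_form_def)

lemma torus_smult_expansion:
  "(\<Sum>\<beta>\<in>Poly_Mapping.keys X. torus_smult (c * Poly_Mapping.lookup X \<beta>) (torus_basis \<beta>)) = torus_smult c X"
proof (rule poly_mapping_eqI)
  fix \<mu>
  have "Poly_Mapping.lookup (\<Sum>\<beta>\<in>Poly_Mapping.keys X. torus_smult (c * Poly_Mapping.lookup X \<beta>) (torus_basis \<beta>)) \<mu>
      = (\<Sum>\<beta>\<in>Poly_Mapping.keys X. if \<beta> = \<mu> then c * Poly_Mapping.lookup X \<beta> else 0)"
    unfolding lookup_sum by (intro sum.cong refl) (simp add: lookup_smult torus_basis_def lookup_single when_def)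
  also have "\<dots> = c * Poly_Mapping.lookup X \<mu>"
    by (simp add: in_keys_iff)
  finally show "Poly_Mapping.lookup (\<Sum>\<beta>\<in>Poly_Mapping.keys X. torus_smult (c * Poly_Mapping.lookup X \<beta>) (torus_basis \<beta>)) \<mu>
      = Poly_Mapping.lookup (torus_smult c X) \<mu>" by (simp add: lookup_smult)
qed

lemma torus_const_mult:
  assumes "in_torus X"
  shows "torus_mult N h (torus_const N c) X = torus_smult c X" "torus_mult N h X (torus_const N c) = torus_smult c X"
proof -
  let ?one = "face_class N 0"
  have keys: "Poly_Mapping.keys (torus_const N c) \<subseteq> {?one}"
    unfolding torus_const_def face_lattice_one by (rule keys_smult_basis)
  have const: "Poly_Mapping.lookup (torus_const N c) ?one = c"
    by (simp add: torus_const_def face_lattice_one lookup_smult torus_basis_def)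
  have half: "half_pow h 0 = 1" by (simp add: half_pow_def)
  have unit: "?one \<otimes>\<^bsub>face_lattice N\<^esub> \<beta> = \<beta>" "\<beta> \<otimes>\<^bsub>face_lattice N\<^esub> ?one = \<beta>"
    "lattice_form N ?one \<beta> = 0" "lattice_form N \<beta> ?one = 0" if \<beta>: "\<beta> \<in> Poly_Mapping.keys X" for \<beta>
  proof -
    obtain x where x: "\<beta> = face_class N x" "x \<in> carrier (pre_lattice N)"
      using subsetD[OF assms[unfolded in_torus_def] \<beta>] by (rule imageE)
    show "?one \<otimes>\<^bsub>face_lattice N\<^esub> \<beta> = \<beta>" "\<beta> \<otimes>\<^bsub>face_lattice N\<^esub> ?one = \<beta>"
      "lattice_form N ?one \<beta> = 0" "lattice_form N \<beta> ?one = 0"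
      unfolding x(1) by (simp_all add: face_class_mult zero_carrier x(2) lattice_form_zero)
  qed
  have "torus_mult N h (torus_const N c) X
      = (\<Sum>\<beta>\<in>Poly_Mapping.keys X. torus_smult (c * Poly_Mapping.lookup X \<beta>) (torus_basis \<beta>))"
    unfolding torus_mult_supersets[OF _ keys _ subset_refl, simplified] const
    by (intro sum.cong refl) (simp add: unit half)
  then show "torus_mult N h (torus_const N c) X = torus_smult c X"
    by (simp only: torus_smult_expansion)
  have "torus_mult N h X (torus_const N c)
      = (\<Sum>\<beta>\<in>Poly_Mapping.keys X. torus_smult (c * Poly_Mapping.lookup X \<beta>) (torus_basis \<beta>))"
    unfolding torus_mult_supersets[OF _ subset_refl _ keys, simplified] const
    by (intro sum.cong refl) (simp add: unit half mult.commute)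
  then show "torus_mult N h X (torus_const N c) = torus_smult c X"
    by (simp only: torus_smult_expansion)
qed

lemma path_weight_mult:
  fixes h :: "'k::field"
  assumes "p \<in> paths" "p' \<in> paths"
  shows "torus_mult N h (path_weight N p) (path_weight N p') =
    torus_smult (h powi turning (inner_verts N) p p') (torus_basis (face_class N (path_vector N p + path_vector N p')))"
proof -
  let ?x = "path_vector N p" and ?y = "path_vector N p'"
  have "2 * - lattice_form N (face_class N ?x) (face_class N ?y) = of_int (turning (inner_verts N) p p')"
    unfolding lattice_form_class pre_form_paths[OF assms] by simp
  then have "half_pow h (- lattice_form N (face_class N ?x) (face_class N ?y)) = h powi turning (inner_verts N) p p'"
    unfolding half_pow_def by (simp only: floor_of_int)
  then show ?thesis
    using torus_mult_basis[of h 1 "face_class N ?x" 1 "face_class N ?y"]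
    by (simp add: torus_smult_one path_weight_def face_class_mult path_vector_carrier assms)
qed

lemma measurement_mult:
  fixes h :: "'k::field"
  assumes j: "j \<in> {1..nsources N}" "l \<in> {1..nsources N}" and i: "i \<in> {1..nsinks N}" "k \<in> {1..nsinks N}"
  shows "torus_mult N h (quantum_measurement N i j) (quantum_measurement N k l) =
    (\<Sum>(p, p')\<in>walks_to (sink_arc N i) j \<times> walks_to (sink_arc N k) l.
      torus_smult (h powi turning (inner_verts N) p p') (torus_basis (face_class N (path_vector N p + path_vector N p'))))"
proof -
  have "torus_mult N h (quantum_measurement N i j) (quantum_measurement N k l) =
     (\<Sum>p\<in>walks_to (sink_arc N i) j. \<Sum>p'\<in>walks_to (sink_arc N k) l. torus_mult N h (path_weight N p) (path_weight N p'))"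
    unfolding quantum_measurement_def walks_to_sink_arc[OF j(1) i(1)] walks_to_sink_arc[OF j(2) i(2)]
      torus_mult_sum_left by (simp only: torus_mult_sum_right)
  also have "\<dots> = (\<Sum>p\<in>walks_to (sink_arc N i) j. \<Sum>p'\<in>walks_to (sink_arc N k) l.
      torus_smult (h powi turning (inner_verts N) p p') (torus_basis (face_class N (path_vector N p + path_vector N p'))))"
    by (intro sum.cong refl path_weight_mult walks_to_sink_paths[OF j(1) i(1)] walks_to_sink_paths[OF j(2) i(2)])
  finally show ?thesis by (simp add: sum.cartesian_product)
qed

text \<open>
  The exponent of the product of two path weights, in terms of the arcs used. This is a relation
  because a multiset of arcs need not come from two paths.
\<close>

definition class_of_flow :: "'e multiset \<Rightarrow> 'e face_vector set \<Rightarrow> bool" where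
  "class_of_flow M \<mu> \<longleftrightarrow> (\<exists>p\<in>paths. \<exists>p'\<in>paths. M = mset p + mset p' \<and> \<mu> = face_class N (path_vector N p + path_vector N p'))"

lemma class_of_flow_iff:
  assumes "p \<in> paths" "p' \<in> paths"
  shows "class_of_flow (mset p + mset p') \<mu> \<longleftrightarrow> \<mu> = face_class N (path_vector N p + path_vector N p')"
proof
  assume "class_of_flow (mset p + mset p') \<mu>"
  then obtain r r' where r: "r \<in> paths" "r' \<in> paths" "mset p + mset p' = mset r + mset r'"
    "\<mu> = face_class N (path_vector N r + path_vector N r')" by (auto simp: class_of_flow_def)
  show "\<mu> = face_class N (path_vector N p + path_vector N p')"
    unfolding r(4) path_vectors_determined[OF assms r(1-3)] ..
qed (use assms in \<open>auto simp: class_of_flow_def\<close>)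

text \<open>
  Reading off one coefficient of a product of measurements is a functional as in \<open>pair_sum\<close>.
\<close>

lemma lookup_measurement_mult:
  fixes h :: "'k::field"
  assumes j: "j \<in> {1..nsources N}" "l \<in> {1..nsources N}" and i: "i \<in> {1..nsinks N}" "k \<in> {1..nsinks N}"
  shows "Poly_Mapping.lookup (torus_mult N h (quantum_measurement N i j) (quantum_measurement N k l)) \<mu> =
    pair_sum h (inner_verts N) (\<lambda>M. of_bool (class_of_flow M \<mu>)) (sink_arc N i) j (sink_arc N k) l"
proof -
  have "Poly_Mapping.lookup (torus_mult N h (quantum_measurement N i j) (quantum_measurement N k l)) \<mu> =
    (\<Sum>p\<in>walks_to (sink_arc N i) j. \<Sum>p'\<in>walks_to (sink_arc N k) l. h powi turning (inner_verts N) p p'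
      * of_bool (\<mu> = face_class N (path_vector N p + path_vector N p')))"
    unfolding measurement_mult[OF assms] sum.cartesian_product
    by (auto simp: lookup_sum lookup_smult torus_basis_def lookup_single when_def intro!: sum.cong)
  also have "\<dots> = pair_sum h (inner_verts N) (\<lambda>M. of_bool (class_of_flow M \<mu>)) (sink_arc N i) j (sink_arc N k) l"
    unfolding pair_sum_def
  proof (intro sum.cong refl)
    fix p p' assume p: "p \<in> walks_to (sink_arc N i) j" "p' \<in> walks_to (sink_arc N k) l"
    show "h powi turning (inner_verts N) p p' * of_bool (\<mu> = face_class N (path_vector N p + path_vector N p'))
      = h powi turning (inner_verts N) p p' * of_bool (class_of_flow (mset p + mset p') \<mu>)"
      using class_of_flow_iff[OF walks_to_sink_paths[OF j(1) i(1) p(1)] walks_to_sink_paths[OF j(2) i(2) p(2)]] by simp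
  qed
  finally show ?thesis .
qed

lemma in_torus_measurement_mult:
  fixes h :: "'k::field"
  assumes j: "j \<in> {1..nsources N}" "l \<in> {1..nsources N}" and i: "i \<in> {1..nsinks N}" "k \<in> {1..nsinks N}"
  shows "in_torus (torus_mult N h (quantum_measurement N i j) (quantum_measurement N k l))"
proof -
  let ?I = "walks_to (sink_arc N i) j \<times> walks_to (sink_arc N k) l"
  have carrier: "path_vector N (fst z) + path_vector N (snd z) \<in> carrier (pre_lattice N)" if "z \<in> ?I" for z
  proof -
    interpret G: comm_group "pre_lattice N" by (rule comm_group_pre_lattice)
    have "fst z \<in> paths" "snd z \<in> paths"
      using that walks_to_sink_paths[OF j(1) i(1)] walks_to_sink_paths[OF j(2) i(2)] by auto
    then have "path_vector N (fst z) \<otimes>\<^bsub>pre_lattice N\<^esub> path_vector N (snd z) \<in> carrier (pre_lattice N)"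
      by (intro G.m_closed path_vector_carrier)
    then show ?thesis by (simp add: pre_lattice_def)
  qed
  show ?thesis
    unfolding in_torus_def measurement_mult[OF assms] case_prod_beta
  proof (rule order_trans[OF keys_sum UN_least])
    fix z assume "z \<in> ?I"
    then have "face_class N (path_vector N (fst z) + path_vector N (snd z)) \<in> face_class N ` carrier (pre_lattice N)"
      by (intro imageI carrier)
    then show "Poly_Mapping.keys (torus_smult (h powi turning (inner_verts N) (fst z) (snd z))
        (torus_basis (face_class N (path_vector N (fst z) + path_vector N (snd z)))))
      \<subseteq> face_class N ` carrier (pre_lattice N)"
      by (intro order_trans[OF keys_smult_basis]) simp
  qed
qed

end

section \<open>Entries of the matrix identity\<close>

lemma R_matrix_entry:
  assumes "i \<in> {1..k}" "j \<in> {1..k}"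
  shows "R_matrix k q (i, j) (s, t) = of_bool ((s, t) = (i, j)) * (if i = j then q else 1)
     + (q - inverse q) * (of_bool (j < i) * of_bool ((s, t) = (j, i)))"
proof -
  have d: "(\<Sum>x\<in>{1..k}. \<Sum>y\<in>{1..k}. tensor12 (*) (mat_unit x x) (mat_unit y y) (i, j) (s, t)) = (of_bool ((s, t) = (i, j)) :: 'a)"
    (is "(\<Sum>x\<in>_. \<Sum>y\<in>_. ?t x y) = _")
  proof -
    have "?t x y = (if x = i then if y = j then of_bool ((s, t) = (i, j)) else 0 else 0)" for x y
      by (auto simp: tensor12_def mat_unit_def)
    then have "(\<Sum>x\<in>{1..k}. \<Sum>y\<in>{1..k}. ?t x y)
        = (\<Sum>x\<in>{1..k}. if x = i then \<Sum>y\<in>{1..k}. if y = j then of_bool ((s, t) = (i, j)) else 0 else 0)"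
      by (intro sum.cong refl) simp
    then show ?thesis using assms by simp
  qed
  have e: "(\<Sum>x\<in>{1..k}. tensor12 (*) (mat_unit x x) (mat_unit x x) (i, j) (s, t)) = (of_bool (i = j \<and> (s, t) = (i, j)) :: 'a)"
    (is "(\<Sum>x\<in>_. ?t x) = _")
  proof -
    have "?t x = (if x = i then of_bool (i = j \<and> (s, t) = (i, j)) else 0)" for x
      by (auto simp: tensor12_def mat_unit_def)
    then show ?thesis using assms by simp
  qed
  have f: "(\<Sum>x\<in>{1..k}. \<Sum>y\<in>{1..<x}. tensor12 (*) (mat_unit x y) (mat_unit y x) (i, j) (s, t)) = (of_bool (j < i \<and> (s, t) = (j, i)) :: 'a)"
    (is "(\<Sum>x\<in>_. \<Sum>y\<in>_. ?t x y) = _")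
  proof -
    have "?t x y = (if x = i then if y = j then of_bool ((s, t) = (j, i)) else 0 else 0)" for x y
      by (auto simp: tensor12_def mat_unit_def)
    then have "(\<Sum>x\<in>{1..k}. \<Sum>y\<in>{1..<x}. ?t x y)
        = (\<Sum>x\<in>{1..k}. if x = i then \<Sum>y\<in>{1..<i}. if y = j then of_bool ((s, t) = (j, i)) else 0 else 0)"
      by (intro sum.cong refl) simp
    also have "\<dots> = (\<Sum>y\<in>{1..<i}. if y = j then of_bool ((s, t) = (j, i)) else 0)"
      using assms by simp
    finally show ?thesis using assms by simp
  qed
  show ?thesis unfolding R_matrix_def d e f by (auto simp: algebra_simps)
qed

lemma of_bool_weights:
  "(of_bool P * x + y * (of_bool L * of_bool Q)) * z
    = (if P then x * z else 0) + (if Q then y * of_bool L * z else 0)" for z :: "'k::field"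
  by (simp add: distrib_right)

text \<open>
  Two conditions on the row of an entry, turned into conditions on its column.
\<close>

lemma column_weights:
  "(if (i, j) = (x, y) then (if x = y then q else 1) * z else 0)
     + (if (i, j) = (y, x) then w * of_bool (y < x) * z else 0)
    = (if (x, y) = (i, j) then (if i = j then q else 1) * z else 0)
     + (if (x, y) = (j, i) then w * of_bool (i < j) * z else 0)"
  for i j x y :: nat and q w z :: "'k::field"
proof (rule arg_cong2[where f = "(+)"])
  show "(if (i, j) = (x, y) then (if x = y then q else 1) * z else 0)
      = (if (x, y) = (i, j) then (if i = j then q else 1) * z else 0)"
    by (rule if_cong) (rule eq_commute, simp, rule refl)
  have "(i, j) = (y, x) \<longleftrightarrow> (x, y) = (j, i)" by (simp only: prod.inject) blast
  then show "(if (i, j) = (y, x) then w * of_bool (y < x) * z else 0)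
      = (if (x, y) = (j, i) then w * of_bool (i < j) * z else 0)"
    by (rule if_cong) (simp, rule refl)
qed

lemma R_matrix_sum_rows:
  fixes g :: "nat \<times> nat \<Rightarrow> 'k::field"
  assumes "i \<in> {1..k}" "j \<in> {1..k}"
  shows "(\<Sum>s\<in>{1..k} \<times> {1..k}. R_matrix k q (i, j) s * g s)
     = (if i = j then q else 1) * g (i, j) + (q - inverse q) * of_bool (j < i) * g (j, i)"
proof -
  have "R_matrix k q (i, j) s * g s = (if s = (i, j) then (if i = j then q else 1) * g s else 0)
      + (if s = (j, i) then (q - inverse q) * of_bool (j < i) * g s else 0)" for s
    by (cases s) (simp only: R_matrix_entry[OF assms] of_bool_weights)
  then show ?thesis using assms by (simp add: sum.distrib)
qed

lemma R_matrix_sum_columns: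
  fixes g :: "nat \<times> nat \<Rightarrow> 'k::field"
  assumes "i \<in> {1..k}" "j \<in> {1..k}"
  shows "(\<Sum>s\<in>{1..k} \<times> {1..k}. R_matrix k q s (i, j) * g s)
     = (if i = j then q else 1) * g (i, j) + (q - inverse q) * of_bool (i < j) * g (j, i)"
proof -
  have entry: "R_matrix k q s (i, j) * g s = (if s = (i, j) then (if i = j then q else 1) * g s else 0)
      + (if s = (j, i) then (q - inverse q) * of_bool (i < j) * g s else 0)" if s: "s \<in> {1..k} \<times> {1..k}" for s
  proof -
    obtain x y where xy: "s = (x, y)" "x \<in> {1..k}" "y \<in> {1..k}" using s by auto
    show ?thesis
      unfolding xy(1) R_matrix_entry[OF xy(2,3)] of_bool_weights by (rule column_weights)
  qed
  have "(\<Sum>s\<in>{1..k} \<times> {1..k}. R_matrix k q s (i, j) * g s)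
    = (\<Sum>s\<in>{1..k} \<times> {1..k}. (if s = (i, j) then (if i = j then q else 1) * g s else 0)
      + (if s = (j, i) then (q - inverse q) * of_bool (i < j) * g s else 0))"
    by (rule sum.cong[OF refl entry])
  then show ?thesis using assms by (simp add: sum.distrib)
qed

theorem lemma7p17:
  fixes N :: "('v, 'e) network" and m n :: nat and h q :: "'k::field"
  assumes "acyclic_network N"
    and "m = nsinks N" and "n = nsources N"
    and "h \<noteq> 0" and "q = h ^ 2"
  shows "\<forall>r \<in> {1..m} \<times> {1..m}. \<forall>c \<in> {1..n} \<times> {1..n}.
      mat_mult (torus_mult N h) ({1..m} \<times> {1..m})
        (torus_R_matrix N m q)
        (tensor12 (torus_mult N h) (quantum_measurement N) (quantum_measurement N)) r c
    = mat_mult (torus_mult N h) ({1..n} \<times> {1..n})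
        (tensor21 (torus_mult N h) (quantum_measurement N) (quantum_measurement N))
        (torus_R_matrix N n q) r c"
proof (intro ballI)
  interpret acyclic_network N by (rule assms(1))
  fix r c assume "r \<in> {1..m} \<times> {1..m}" "c \<in> {1..n} \<times> {1..n}"
  then obtain i k j l where r: "r = (i, k)" "i \<in> {1..m}" "k \<in> {1..m}" and c: "c = (j, l)" "j \<in> {1..n}" "l \<in> {1..n}"
    by auto
  let ?Q = "quantum_measurement N :: nat \<Rightarrow> nat \<Rightarrow> ('e, 'k) torus"
  let ?A = "tensor12 (torus_mult N h) ?Q ?Q" and ?B = "tensor21 (torus_mult N h) ?Q ?Q"
  have left: "mat_mult (torus_mult N h) ({1..m} \<times> {1..m}) (torus_R_matrix N m q) ?A r c
      = (\<Sum>s\<in>{1..m} \<times> {1..m}. torus_smult (R_matrix m q r s) (?A s c))"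
    unfolding mat_mult_def torus_R_matrix_def
  proof (intro sum.cong refl)
    fix s assume "s \<in> {1..m} \<times> {1..m}"
    then obtain x y where s: "s = (x, y)" "x \<in> {1..m}" "y \<in> {1..m}" by auto
    have "in_torus (?A s c)"
      unfolding s(1) c(1) tensor12_def prod.case
      by (rule in_torus_measurement_mult[OF c(2,3)[unfolded assms(3)] s(2,3)[unfolded assms(2)]])
    then show "torus_mult N h (torus_const N (R_matrix m q r s)) (?A s c) = torus_smult (R_matrix m q r s) (?A s c)"
      by (rule torus_const_mult(1))
  qed
  have right: "mat_mult (torus_mult N h) ({1..n} \<times> {1..n}) ?B (torus_R_matrix N n q) r c
      = (\<Sum>s\<in>{1..n} \<times> {1..n}. torus_smult (R_matrix n q s c) (?B r s))"
    unfolding mat_mult_def torus_R_matrix_def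
  proof (intro sum.cong refl)
    fix s assume "s \<in> {1..n} \<times> {1..n}"
    then obtain x y where s: "s = (x, y)" "x \<in> {1..n}" "y \<in> {1..n}" by auto
    have "in_torus (?B r s)"
      unfolding s(1) r(1) tensor21_def prod.case
      by (rule in_torus_measurement_mult[OF s(3,2)[unfolded assms(3)] r(3,2)[unfolded assms(2)]])
    then show "torus_mult N h (?B r s) (torus_const N (R_matrix n q s c)) = torus_smult (R_matrix n q s c) (?B r s)"
      by (rule torus_const_mult(2))
  qed
  show "mat_mult (torus_mult N h) ({1..m} \<times> {1..m}) (torus_R_matrix N m q) ?A r c
      = mat_mult (torus_mult N h) ({1..n} \<times> {1..n}) ?B (torus_R_matrix N n q) r c"
    unfolding left right
  proof (rule poly_mapping_eqI)
    fix \<mu>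
    let ?X = "\<lambda>i j k l. pair_sum h (inner_verts N) (\<lambda>M. of_bool (class_of_flow M \<mu>)) (sink_arc N i) j (sink_arc N k) l"
    have X: "Poly_Mapping.lookup (torus_mult N h (?Q i j) (?Q k l)) \<mu> = ?X i j k l"
      if "i \<in> {1..m}" "k \<in> {1..m}" "j \<in> {1..n}" "l \<in> {1..n}" for i j k l
      using lookup_measurement_mult[of j l i k h \<mu>] that unfolding assms(2,3) by simp
    have ex: "exchange h (inner_verts N) (\<lambda>M. of_bool (class_of_flow M \<mu>)) (sink_arc N i) j (sink_arc N k) l"
      using exchange_cut[OF down_closed_inner assms(4)] sink_arc_cut[OF r(2)[unfolded assms(2)]]
        sink_arc_cut[OF r(3)[unfolded assms(2)]] c(2,3)[unfolded assms(3)] by blast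
    have eq: "sink_arc N i = sink_arc N k \<longleftrightarrow> i = k"
      using sink_arc_arc(2)[of i] sink_arc_arc(2)[of k] sink_inj[of i k] r unfolding assms(2) by auto
    have hi: "higher (sink_arc N k) (sink_arc N i) \<longleftrightarrow> k < i"
      using sink_higher[of k i] r unfolding assms(2) by blast
    have "Poly_Mapping.lookup (\<Sum>s\<in>{1..m} \<times> {1..m}. torus_smult (R_matrix m q r s) (?A s c)) \<mu>
        = (\<Sum>s\<in>{1..m} \<times> {1..m}. R_matrix m q (i, k) s * Poly_Mapping.lookup (?A s c) \<mu>)"
      unfolding r(1) by (simp add: lookup_sum lookup_smult)
    also have "\<dots> = (if i = k then q else 1) * ?X i j k l + (q - inverse q) * of_bool (k < i) * ?X k j i l"
      unfolding R_matrix_sum_rows[OF r(2,3)] by (simp only: tensor12_def c(1) prod.case X r(2,3) c(2,3))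
    also have "\<dots> = (if j = l then q else 1) * ?X k l i j + (q - inverse q) * of_bool (j < l) * ?X k j i l"
    proof -
      have "x + w * s * z = y + w * t * z" if "x + w * (s - t) * z = y" for w x y z s t :: 'k
        using that by (simp add: algebra_simps)
      then show ?thesis using ex unfolding exchange_def eq hi assms(5) by blast
    qed
    also have "\<dots> = (\<Sum>s\<in>{1..n} \<times> {1..n}. R_matrix n q s (j, l) * Poly_Mapping.lookup (?B r s) \<mu>)"
      unfolding R_matrix_sum_columns[OF c(2,3)] by (simp only: tensor21_def r(1) prod.case X r(2,3) c(2,3))
    also have "\<dots> = Poly_Mapping.lookup (\<Sum>s\<in>{1..n} \<times> {1..n}. torus_smult (R_matrix n q s c) (?B r s)) \<mu>"
      unfolding c(1) by (simp add: lookup_sum lookup_smult)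
    finally show "Poly_Mapping.lookup (\<Sum>s\<in>{1..m} \<times> {1..m}. torus_smult (R_matrix m q r s) (?A s c)) \<mu>
        = Poly_Mapping.lookup (\<Sum>s\<in>{1..n} \<times> {1..n}. torus_smult (R_matrix n q s c) (?B r s)) \<mu>" .
  qed
qed

end
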